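(* Let $\Lambda>0$ and let $R=[-\frac{a_0}2,\frac{a_0}2]\times[-\frac{b_0}2,\frac{b_0}2]$ with $a_0b_0=1$, $b_0<a_0$ and $a_0+b_0<\Lambda$. There is $\tau_0=\tau_0(\Lambda)>0$ such that for any $0<\tau<\tau_0$ and any approximate flat $\mathrm P_{|\cdot|_1}$ area-preserving mean-curvature flow $\{R^\tau_t\}_{t\ge0}$ with initial datum $R$ and time step $\tau$ the following holds. For all $k\ge1$, $$R^\tau_t=\Big[-\tfrac{a((k+1)\tau)}2,\tfrac{a((k+1)\tau)}2\Big]\times\Big[-\tfrac{b((k+1)\tau)}2,\tfrac{b((k+1)\tau)}2\Big]\quad\forall t\in[(k+1)\tau,(k+2)\tau),$$ where $a(k\tau),b(k\tau)$ are defined by recurrence with $a(0)=a_0$, $b(0)=b_0$ and $$a((k+1)\tau)=a(k\tau)-2x(k\tau),\quad x(k\tau)=\frac{2(a(k\tau)-b(k\tau))}{b(k\tau)(a(k\tau)+b(k\tau))}\tau+O(\tau^2),$$ $$b((k+1)\tau)=b(k\tau)+2y(k\tau),\quad y(k\tau)=\frac{b(k\tau)x(k\tau)}{a(k\tau)-2x(k\tau)},$$ and they satisfy $a((k+1)\tau)b((k+1)\tau)=1$, $a((k+1)\tau)+b((k+1)\tau)<a(k\tau)+b(k\tau)<\Lambda$, $|a((k+1)\tau)-a(k\tau)|\le\tau C(\Lambda)$, $|b((k+1)\tau)-b(k\tau)|\le\tau C(\Lambda)$, with $C(\Lambda)$ depending only on $\Lambda$. Moreover there exists a unique flat $\mathrm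 P_{|\cdot|_1}$ area-preserving mean-curvature flow $\{R_t\}_{t\ge0}$ with initial datum $R$; for all $t\ge0$, $R_t=[-\frac{\tilde a(t)}2,\frac{\tilde a(t)}2]\times[-\frac{\tilde b(t)}2,\frac{\tilde b(t)}2]$ with $\tilde a(0)=a_0$, $\tilde b(0)=b_0$, and $$\lim_{\tau\to0}|R^\tau_t\triangle R_t|=0,\quad \lim_{\tau\to0}a^\tau(t)=\tilde a(t),\quad\lim_{\tau\to0}b^\tau(t)=\tilde b(t),$$ $$\frac{d}{dt}\tilde a(t)=-\frac{4}{\tilde b(t)}+\frac{8}{\tilde a(t)+\tilde b(t)},\qquad \frac{d}{dt}\tilde b(t)=-\frac{4}{\tilde a(t)}+\frac{8}{\tilde a(t)+\tilde b(t)},$$ where $a^\tau(t):=a((k+1)\tau)$ and $b^\tau(t):=b((k+1)\tau)$ for $t\in[(k+1)\tau,(k+2)\tau)$.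
   Context: $|\nu|_1=|\nu_1|+|\nu_2|$, $|z|_\infty=\max\{|z_1|,|z_2|\}$. For a set of finite perimeter $E$, $\mathrm P_{|\cdot|_1}(E)=\int_{\partial^*E}|\nu_E|_1\,d\mathcal H^1$. $d_\infty(z,\partial F)=\inf\{|z-\hat z|_\infty:\hat z\in\partial F\}$, $\mathcal D(E,F)=\int_{E\triangle F}d_\infty(z,\partial F)\,dz$, $\mathcal F_\tau(E,F)=\mathrm P_{|\cdot|_1}(E)+\frac1\tau\mathcal D(E,F)$, $\mathrm{Bar}(E)=\int_Ex\,dx$. Approximate flat flow: given a rectangle $R_0$ with $|R_0|=1$, $\mathrm{Bar}(R_0)=(0,0)$, and $\tau>0$, let $E^{(\tau)}_0=R_0$ and for $k\ge1$ let $E^{(\tau)}_{k\tau}$ be any element of $\arg\min\{\mathcal F_\tau(E,E^{(\tau)}_{(k-1)\tau}):E\subset\mathbb{R}^2,|E|=1\}$; set $E^{(\tau)}_t=E^{(\tau)}_{k\tau}$ for $t\in[k\tau,(k+1)\tau)$. Then $\{E^{(\tau)}_t\}_{t\ge0}$ is called an approximate flat $\mathrm P_{|\cdot|_1}$ area-preserving mean-curvature flow with initial datum $R_0$ and time step $\tau$. Flat flow: a family $\{E_t\}_{t\ge0}$ with $\chi_{E_t}\in BV(\mathbb{R}^2)$ for all $t$ such that, for some vanishing sequence $\tau_k$ and approximate flat flows $\{E^{(\tau_k)}_t\}$ with initial datum $R_0$, $\|\chi_{E^{(\tau_k)}_t}-\chi_{E_t}\|_{L^1(\mathbb{R}^2)}\to0$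 locally uniformly in $t$, is called a flat $\mathrm P_{|\cdot|_1}$ area-preserving mean-curvature flow with initial datum $R_0$. $O(g)$ denotes a quantity bounded by a constant times $|g|$. *)

theory Defs
  imports "HOL-Analysis.Analysis"
begin

type_synonym pt = "real \<times> real"

definition norm_inf :: "pt \<Rightarrow> real" where
  "norm_inf z = max \<bar>fst z\<bar> \<bar>snd z\<bar>"

definition symdiff :: "pt set \<Rightarrow> pt set \<Rightarrow> pt set" where
  "symdiff A B = (A - B) \<union> (B - A)"

definition ae_eq :: "pt set \<Rightarrow> pt set \<Rightarrow> bool" where
  "ae_eq A B \<longleftrightarrow> symdiff A B \<in> null_sets lebesgue"

definition rect :: "real \<Rightarrow> real \<Rightarrow> pt set" where
  "rect a b = {-a/2..a/2} \<times> {-b/2..b/2}"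

definition perim_test :: "(pt \<Rightarrow> pt) \<Rightarrow> bool" where
  "perim_test g \<longleftrightarrow> (\<forall>x. g differentiable (at x)) \<and>
     (\<forall>v. continuous_on UNIV (\<lambda>x. frechet_derivative g (at x) v)) \<and>
     bounded {x. g x \<noteq> 0} \<and> (\<forall>x. norm_inf (g x) \<le> 1)"

definition divergence :: "(pt \<Rightarrow> pt) \<Rightarrow> pt \<Rightarrow> real" where
  "divergence g x = fst (frechet_derivative g (at x) (1, 0)) + snd (frechet_derivative g (at x) (0, 1))"

text \<open>Anisotropic perimeter P_{|.|_1}(E) (anisotropic total variation of the indicator of E;
  the dual norm of |.|_1 is |.|_inf). Equals +infinity if E is not of finite perimeter.\<close>
definition perimeter1 :: "pt set \<Rightarrow> ennreal" where
  "perimeter1 E = (SUP g \<in> {g. perim_test g}.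
      ennreal (integral\<^sup>L lebesgue (\<lambda>x. indicator E x * divergence g x)))"

text \<open>Boundary of the normalized (Lebesgue) representative of F.\<close>
definition ess_boundary :: "pt set \<Rightarrow> pt set" where
  "ess_boundary F = {x. \<forall>r>0. emeasure lebesgue (F \<inter> ball x r) > 0 \<and>
                                emeasure lebesgue (ball x r - F) > 0}"

definition dist_inf_bd :: "pt \<Rightarrow> pt set \<Rightarrow> ennreal" where
  "dist_inf_bd z F = (INF w \<in> ess_boundary F. ennreal (norm_inf (z - w)))"

definition Dfun :: "pt set \<Rightarrow> pt set \<Rightarrow> ennreal" where
  "Dfun E F = (\<integral>\<^sup>+ z. indicator (symdiff E F) z * dist_inf_bd z F \<partial>lebesgue)"

definition Ftau :: "real \<Rightarrow> pt set \<Rightarrow> pt set \<Rightarrow> ennreal" where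
  "Ftau \<tau> E F = perimeter1 E + ennreal (1 / \<tau>) * Dfun E F"

definition is_minimizer :: "real \<Rightarrow> pt set \<Rightarrow> pt set \<Rightarrow> bool" where
  "is_minimizer \<tau> F E \<longleftrightarrow> E \<in> sets lebesgue \<and> emeasure lebesgue E = 1 \<and>
     (\<forall>E'. E' \<in> sets lebesgue \<and> emeasure lebesgue E' = 1 \<longrightarrow> Ftau \<tau> E F \<le> Ftau \<tau> E' F)"

definition approx_flat_flow :: "pt set \<Rightarrow> real \<Rightarrow> (real \<Rightarrow> pt set) \<Rightarrow> bool" where
  "approx_flat_flow R0 \<tau> E \<longleftrightarrow> 0 < \<tau> \<and>
     (\<exists>S. S 0 = R0 \<and> (\<forall>k. is_minimizer \<tau> (S k) (S (Suc k))) \<and>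
          (\<forall>t\<ge>0. E t = S (nat \<lfloor>t / \<tau>\<rfloor>)))"

definition flat_flow :: "pt set \<Rightarrow> (real \<Rightarrow> pt set) \<Rightarrow> bool" where
  "flat_flow R0 E \<longleftrightarrow>
     (\<forall>t\<ge>0. E t \<in> sets lebesgue \<and> emeasure lebesgue (E t) < \<infinity> \<and> perimeter1 (E t) < \<infinity>) \<and>
     (\<exists>\<tau>s Es. (\<forall>k. 0 < \<tau>s k) \<and> \<tau>s \<longlonglongrightarrow> 0 \<and>
        (\<forall>k. approx_flat_flow R0 (\<tau>s k) (Es k)) \<and>
        (\<forall>T\<ge>0. \<forall>\<epsilon>>0. eventually (\<lambda>k. \<forall>t\<in>{0..T}.
            emeasure lebesgue (symdiff (Es k t) (E t)) < ennreal \<epsilon>) sequentially))"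

end

theory Submission
  imports Defs
begin

text \<open>
  Let \<open>sd\<close> be the signed \<open>\<infinity>\<close>-distance to the boundary of the current rectangle, so that the dissipation of
  \<open>E\<close> is the integral of \<open>sd\<close> over \<open>E\<close> minus a constant. Since every line parallel to an axis
  that meets \<open>E\<close> contributes at least \<open>2\<close>, the perimeter of \<open>E\<close> is at least \<open>2 \<bar>S\<bar> + 2 \<bar>T\<bar>\<close>, where
  \<open>S\<close> and \<open>T\<close> are the essential projections of \<open>E\<close>. With a Lagrange multiplier \<open>\<mu>\<close> and
  \<open>w = max 0 (\<mu> - sd / \<tau>)\<close>, the energy of \<open>E\<close> is therefore bounded below by
  \<open>2 \<bar>S\<bar> + 2 \<bar>T\<bar>\<close> minus the integral of \<open>w\<close> over \<open>S \<times> T\<close>, up to a constant. As \<open>w\<close> is symmetric and decreasing,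
  \<open>S\<close> and \<open>T\<close> may be replaced by centered intervals, and what remains is a two-dimensional
  optimization problem whose unique solution is the rectangle satisfying the Euler-Lagrange equation.

  For the limit, the difference \<open>v = a - b\<close> of the sides satisfies
  \<open>v (k + 1) = (1 - 4 \<tau>) v k + O(\<tau>\<^sup>2)\<close>, hence converges to \<open>v 0 exp (- 4 t)\<close>, and \<open>a\<close>, \<open>b\<close> are recovered
  from \<open>v\<close> and \<open>a b = 1\<close>.
\<close>

section \<open>Continuously differentiable test fields\<close>

text \<open>The perimeter is a supremum over compactly supported C1 fields, while a competitor is an
  arbitrary measurable set of area 1, possibly without any regular boundary. The slice bound is
  therefore produced by explicit test fields: \<open>E\<close> is approximated in L1 by a smooth
  density, and saturating functions of the primitives of this density along the two axes serve as
  components. All estimates are quantitative in the L1 error, so that the approximation is removed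
  for a fixed saturation parameter before this parameter tends to 0. The multiplier is effective
  because \<open>\<mu> - sd / \<tau> \<le> w\<close> everywhere, with equality on the old and on the
  new rectangle. The minimal energy is attained by an explicit rectangle, so existence of minimizers
  and their uniqueness up to null sets come together. The difference of the sides is the right
  variable for the limit because, with a b = 1, the limiting equations give (a - b)' = -4 (a - b),
  which is linear and explicitly solvable.\<close>

definition C1 :: "(pt \<Rightarrow> real) \<Rightarrow> (pt \<Rightarrow> real) \<Rightarrow> (pt \<Rightarrow> real) \<Rightarrow> bool" where
  "C1 f f1 f2 \<longleftrightarrow> (\<forall>z. (f has_derivative (\<lambda>h. f1 z * fst h + f2 z * snd h)) (at z)) \<and>
     continuous_on UNIV f1 \<and> continuous_on UNIV f2"

lemma C1_continuous: "C1 f f1 f2 \<Longrightarrow> continuous_on UNIV f"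
  unfolding C1_def by (meson continuous_at_imp_continuous_on has_derivative_continuous)

lemma C1_const: "C1 (\<lambda>_. c) (\<lambda>_. 0) (\<lambda>_. 0)"
  unfolding C1_def by (auto intro!: derivative_eq_intros)

lemma C1_fst:
  assumes "\<And>t. (u has_real_derivative u' t) (at t)" "continuous_on UNIV u'"
  shows "C1 (\<lambda>z. u (fst z)) (\<lambda>z. u' (fst z)) (\<lambda>_. 0)"
proof -
  have "((\<lambda>z. u (fst z)) has_derivative (\<lambda>h. u' (fst z) * fst h)) (at z)" for z :: pt
    by (rule has_derivative_compose[where g = u and f = fst])
       (auto intro!: derivative_eq_intros assms(1)[unfolded has_field_derivative_def])
  moreover have "continuous_on UNIV (\<lambda>z::pt. u' (fst z))"
    by (rule continuous_on_compose2[OF assms(2)]) (auto intro!: continuous_intros)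
  ultimately show ?thesis by (simp add: C1_def)
qed

lemma C1_snd:
  assumes "\<And>t. (u has_real_derivative u' t) (at t)" "continuous_on UNIV u'"
  shows "C1 (\<lambda>z. u (snd z)) (\<lambda>_. 0) (\<lambda>z. u' (snd z))"
proof -
  have "((\<lambda>z. u (snd z)) has_derivative (\<lambda>h. u' (snd z) * snd h)) (at z)" for z :: pt
    by (rule has_derivative_compose[where g = u and f = snd])
       (auto intro!: derivative_eq_intros assms(1)[unfolded has_field_derivative_def])
  moreover have "continuous_on UNIV (\<lambda>z::pt. u' (snd z))"
    by (rule continuous_on_compose2[OF assms(2)]) (auto intro!: continuous_intros)
  ultimately show ?thesis by (simp add: C1_def)
qed

lemma C1_add:
  assumes "C1 f f1 f2" "C1 g g1 g2"
  shows "C1 (\<lambda>z. f z + g z) (\<lambda>z. f1 z + g1 z) (\<lambda>z. f2 z + g2 z)"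
proof -
  have "((\<lambda>z. f z + g z) has_derivative (\<lambda>h. (f1 z + g1 z) * fst h + (f2 z + g2 z) * snd h)) (at z)" for z
    by (rule has_derivative_eq_rhs, rule has_derivative_add,
        rule assms(1)[unfolded C1_def, THEN conjunct1, rule_format],
        rule assms(2)[unfolded C1_def, THEN conjunct1, rule_format]) (simp add: algebra_simps fun_eq_iff)
  then show ?thesis using assms by (auto simp: C1_def intro!: continuous_intros)
qed

lemma C1_mult:
  assumes "C1 f f1 f2" "C1 g g1 g2"
  shows "C1 (\<lambda>z. f z * g z) (\<lambda>z. f1 z * g z + f z * g1 z) (\<lambda>z. f2 z * g z + f z * g2 z)"
proof -
  have "((\<lambda>z. f z * g z) has_derivative
      (\<lambda>h. (f1 z * g z + f z * g1 z) * fst h + (f2 z * g z + f z * g2 z) * snd h)) (at z)" for z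
    by (rule has_derivative_eq_rhs, rule has_derivative_mult,
        rule assms(1)[unfolded C1_def, THEN conjunct1, rule_format],
        rule assms(2)[unfolded C1_def, THEN conjunct1, rule_format]) (simp add: algebra_simps fun_eq_iff)
  then show ?thesis
    using assms C1_continuous[OF assms(1)] C1_continuous[OF assms(2)]
    by (auto simp: C1_def intro!: continuous_intros)
qed

lemma C1_compose:
  assumes f: "C1 f f1 f2" and \<theta>: "\<And>z. (\<theta> has_real_derivative \<theta>' (f z)) (at (f z))"
    and c: "continuous_on UNIV (\<lambda>z. \<theta>' (f z))"
  shows "C1 (\<lambda>z. \<theta> (f z)) (\<lambda>z. \<theta>' (f z) * f1 z) (\<lambda>z. \<theta>' (f z) * f2 z)"
proof -
  have "((\<lambda>z. \<theta> (f z)) has_derivative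
      (\<lambda>h. \<theta>' (f z) * f1 z * fst h + \<theta>' (f z) * f2 z * snd h)) (at z)" for z
    by (rule has_derivative_eq_rhs, rule has_derivative_compose,
        rule f[unfolded C1_def, THEN conjunct1, rule_format],
        rule \<theta>[unfolded has_field_derivative_def]) (simp add: algebra_simps fun_eq_iff)
  then show ?thesis using f c by (auto simp: C1_def intro!: continuous_intros)
qed

text \<open>The entry point to the supremum from below. The divergence consists of the diagonal
  partials \<open>a\<close> and \<open>d\<close>; \<open>b\<close> and \<open>c\<close> certify that
  the pair is a continuously differentiable field.\<close>

lemma perimeter1_ge_C1:
  assumes X: "C1 X1 a b" "C1 X2 c d" and le: "\<And>z. \<bar>X1 z\<bar> \<le> 1" "\<And>z. \<bar>X2 z\<bar> \<le> 1"
    and bd: "bounded {z. X1 z \<noteq> 0}" "bounded {z. X2 z \<noteq> 0}"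
  shows "ennreal (LINT z|lebesgue. indicator E z * (a z + d z)) \<le> perimeter1 E"
proof -
  define g where "g = (\<lambda>z. (X1 z, X2 z))"
  define D where "D = (\<lambda>z h. (a z * fst h + b z * snd h, c z * fst h + d z * snd h))"
  have der: "(g has_derivative D z) (at z)" for z
    unfolding g_def D_def using X unfolding C1_def by (intro has_derivative_Pair) blast+
  then have fd: "frechet_derivative g (at z) = D z" for z
    by (metis frechet_derivative_at)
  have "bounded {z. g z \<noteq> 0}"
    by (rule bounded_subset[of "{z. X1 z \<noteq> 0} \<union> {z. X2 z \<noteq> 0}"]) (use bd in \<open>auto simp: g_def zero_prod_def\<close>)
  moreover have "continuous_on UNIV (\<lambda>x. frechet_derivative g (at x) v)" for v
    using X unfolding fd D_def C1_def by (auto intro!: continuous_intros)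
  ultimately have "perim_test g"
    using der le unfolding perim_test_def differentiable_def norm_inf_def
    by (intro conjI allI exI[of _ "D _"]) (auto simp: g_def)
  moreover have "divergence g z = a z + d z" for z
    by (simp add: divergence_def fd D_def)
  ultimately show ?thesis
    unfolding perimeter1_def by (intro SUP_upper2[of g]) auto
qed

section \<open>Piecewise polynomial C1 steps and cutoffs\<close>

definition pos_part :: "real \<Rightarrow> real" where "pos_part t = max 0 t"

text \<open>Away from 0 this is the power rule; at 0 the difference quotient is at most
  \<open>\<bar>h\<bar> ^ (n - 1)\<close>, which tends to 0 because the exponent is positive.\<close>

lemma DERIV_pos_part_power:
  assumes "n \<ge> 2"
  shows "((\<lambda>t. pos_part t ^ n) has_real_derivative real n * pos_part t ^ (n - 1)) (at t)"
proof -
  have n: "n \<noteq> 0" "n - 1 \<noteq> 0" using assms by auto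
  consider "t < 0" | "t > 0" | "t = 0" by linarith
  then show ?thesis
  proof cases
    case 1
    have "((\<lambda>_. 0) has_real_derivative real n * pos_part t ^ (n - 1)) (at t)"
      using 1 n assms by (simp add: pos_part_def zero_power)
    then show ?thesis
      by (rule has_field_derivative_transform_within_open[of _ _ _ "{..<0}"])
         (use 1 n in \<open>auto simp: pos_part_def max_def\<close>)
  next
    case 2
    have "((\<lambda>t. t ^ n) has_real_derivative real n * pos_part t ^ (n - 1)) (at t)"
      using 2 by (auto simp: pos_part_def intro!: derivative_eq_intros)
    then show ?thesis
      by (rule has_field_derivative_transform_within_open[of _ _ _ "{0<..}"])
         (use 2 n in \<open>auto simp: pos_part_def max_def\<close>)
  next
    case 3
    have "(\<lambda>h. pos_part h ^ n / h) \<midarrow>0\<rightarrow> 0"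
    proof (rule Lim_null_comparison)
      show "\<forall>\<^sub>F h in at 0. norm (pos_part h ^ n / h) \<le> \<bar>h\<bar> ^ (n - 1)"
      proof (intro always_eventually allI)
        fix h :: real
        have "pos_part h ^ n \<le> \<bar>h\<bar> ^ n" by (intro power_mono) (auto simp: pos_part_def)
        also have "\<dots> = \<bar>h\<bar> ^ (n - 1) * \<bar>h\<bar>" using n by (metis mult.commute power_eq_if)
        finally show "norm (pos_part h ^ n / h) \<le> \<bar>h\<bar> ^ (n - 1)"
          by (auto simp: divide_simps pos_part_def)
      qed
      have "((\<lambda>h::real. \<bar>h\<bar> ^ (n - 1)) \<longlongrightarrow> \<bar>0\<bar> ^ (n - 1)) (at 0)"
        by (intro tendsto_intros)
      moreover have "\<bar>0::real\<bar> ^ (n - 1) = 0" using n by (simp add: zero_power)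
      ultimately show "((\<lambda>h::real. \<bar>h\<bar> ^ (n - 1)) \<longlongrightarrow> 0) (at 0)" by metis
    qed
    moreover have "real n * pos_part t ^ (n - 1) = 0" "pos_part t ^ n = 0"
      using 3 n by (simp_all add: pos_part_def zero_power)
    ultimately show ?thesis unfolding 3 DERIV_def by (simp only: diff_zero add_0)
  qed
qed

lemma continuous_on_pos_part [continuous_intros]:
  "continuous_on S f \<Longrightarrow> continuous_on S (\<lambda>x. pos_part (f x))"
  unfolding pos_part_def by (intro continuous_intros)

text \<open>A quadratic spline rising from 0 at 0 to 1 at 1. Its derivative \<open>dstep\<close> is
  the tent of height 2 over [0, 1], and \<open>istep\<close> is its primitive vanishing on the
  negative axis, so a density, its primitive and its derivative are all explicit.\<close>

definition step :: "real \<Rightarrow> real" where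
  "step t = 2 * pos_part t ^ 2 - 4 * pos_part (t - 1/2) ^ 2 + 2 * pos_part (t - 1) ^ 2"

definition dstep :: "real \<Rightarrow> real" where
  "dstep t = 4 * pos_part t - 8 * pos_part (t - 1/2) + 4 * pos_part (t - 1)"

definition istep :: "real \<Rightarrow> real" where
  "istep t = (2/3) * pos_part t ^ 3 - (4/3) * pos_part (t - 1/2) ^ 3 + (2/3) * pos_part (t - 1) ^ 3"

lemma DERIV_step: "(step has_real_derivative dstep t) (at t)"
proof -
  have "((\<lambda>t. pos_part (t - c) ^ 2) has_real_derivative 2 * pos_part (t - c)) (at t)" for c
    by (rule DERIV_chain2[where g = "\<lambda>t. t - c", OF DERIV_pos_part_power, THEN DERIV_cong])
       (auto intro!: derivative_eq_intros)
  from DERIV_add[OF DERIV_diff[OF DERIV_cmult[OF this[of 0], of 2] DERIV_cmult[OF this[of "1/2"], of 4]]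
      DERIV_cmult[OF this[of 1], of 2]]
  show ?thesis unfolding step_def[abs_def] dstep_def by simp
qed

lemma DERIV_istep: "(istep has_real_derivative step t) (at t)"
proof -
  have "((\<lambda>t. pos_part (t - c) ^ 3) has_real_derivative 3 * pos_part (t - c) ^ 2) (at t)" for c
    by (rule DERIV_chain2[where g = "\<lambda>t. t - c", OF DERIV_pos_part_power, THEN DERIV_cong])
       (auto intro!: derivative_eq_intros)
  from DERIV_add[OF DERIV_diff[OF DERIV_cmult[OF this[of 0], of "2/3"] DERIV_cmult[OF this[of "1/2"], of "4/3"]]
      DERIV_cmult[OF this[of 1], of "2/3"]]
  show ?thesis unfolding istep_def[abs_def] step_def by simp
qed

lemma continuous_dstep: "continuous_on UNIV dstep"
  unfolding dstep_def[abs_def] by (intro continuous_intros)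

lemma continuous_step: "continuous_on UNIV step"
  unfolding step_def[abs_def] by (intro continuous_intros)

lemma step_le_0: "t \<le> 0 \<Longrightarrow> step t = 0"
  by (simp add: step_def pos_part_def)

lemma istep_le_0: "t \<le> 0 \<Longrightarrow> istep t = 0"
  by (simp add: istep_def pos_part_def)

lemma step_ge_1: "t \<ge> 1 \<Longrightarrow> step t = 1"
  by (simp add: step_def pos_part_def power2_eq_square algebra_simps)

lemma dstep_bounds: "0 \<le> dstep t" "dstep t \<le> 2"
  by (simp_all add: dstep_def pos_part_def max_def)

lemma step_mono: "s \<le> t \<Longrightarrow> step s \<le> step t"
  by (rule DERIV_nonneg_imp_nondecreasing[of s t step], assumption) (meson DERIV_step dstep_bounds(1))

lemma step_bounds: "0 \<le> step t" "step t \<le> 1"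
proof -
  show "0 \<le> step t"
    by (metis linear order_refl step_le_0 step_mono)
  show "step t \<le> 1"
    by (metis linear order_refl step_ge_1 step_mono)
qed

lemma istep_mono: "s \<le> t \<Longrightarrow> istep s \<le> istep t"
  by (rule DERIV_nonneg_imp_nondecreasing[of s t istep], assumption) (meson DERIV_istep step_bounds(1))

text \<open>Equal to 1 on [-1, 1] and to 0 outside (-2, 2); the two factors descend on opposite
  sides.\<close>

definition cutoff :: "real \<Rightarrow> real" where "cutoff t = step (2 - t) * step (2 + t)"

definition dcutoff :: "real \<Rightarrow> real" where
  "dcutoff t = - dstep (2 - t) * step (2 + t) + step (2 - t) * dstep (2 + t)"

lemma DERIV_cutoff: "(cutoff has_real_derivative dcutoff t) (at t)"
proof -
  have "((\<lambda>t. step (2 - t)) has_real_derivative - dstep (2 - t)) (at t)"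
    by (rule DERIV_chain2[OF DERIV_step, THEN DERIV_cong]) (auto intro!: derivative_eq_intros)
  moreover have "((\<lambda>t. step (2 + t)) has_real_derivative dstep (2 + t)) (at t)"
    by (rule DERIV_chain2[OF DERIV_step, THEN DERIV_cong]) (auto intro!: derivative_eq_intros)
  ultimately show ?thesis
    unfolding cutoff_def[abs_def] dcutoff_def by (rule DERIV_mult[THEN DERIV_cong]) simp
qed

lemma cutoff_bounds: "0 \<le> cutoff t" "cutoff t \<le> 1"
  unfolding cutoff_def by (simp_all add: step_bounds mult_le_one)

lemma continuous_dcutoff: "continuous_on UNIV dcutoff"
proof -
  have "continuous_on UNIV (\<lambda>t. dstep (2 - t))" "continuous_on UNIV (\<lambda>t. dstep (2 + t))"
    by (rule continuous_on_compose2[OF continuous_dstep]; intro continuous_intros subset_UNIV)+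
  moreover have "continuous_on UNIV (\<lambda>t. step (2 - t))" "continuous_on UNIV (\<lambda>t. step (2 + t))"
    by (rule continuous_on_compose2[OF continuous_step]; intro continuous_intros subset_UNIV)+
  ultimately show ?thesis
    unfolding dcutoff_def[abs_def] by (intro continuous_on_add continuous_on_mult continuous_on_minus)
qed

lemma cutoff_eq_1: "\<bar>t\<bar> \<le> 1 \<Longrightarrow> cutoff t = 1"
  by (simp add: cutoff_def step_ge_1)

lemma cutoff_eq_0: "\<bar>t\<bar> \<ge> 2 \<Longrightarrow> cutoff t = 0"
  by (cases "t \<ge> 0") (simp_all add: cutoff_def step_le_0)

lemma dcutoff_bound: "\<bar>dcutoff t\<bar> \<le> 4"
proof -
  have "\<bar>dstep (2 - t) * step (2 + t)\<bar> \<le> 2 * 1" "\<bar>step (2 - t) * dstep (2 + t)\<bar> \<le> 1 * 2"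
    unfolding abs_mult by (intro mult_mono; simp add: dstep_bounds step_bounds)+
  then show ?thesis unfolding dcutoff_def by linarith
qed

section \<open>Densities with explicit primitives\<close>

text \<open>\<open>M1\<close> and \<open>M2\<close> are the primitives of \<open>f\<close> along
  horizontal and vertical lines, normalized to vanish to the left of and below the support. They
  have to be C1 in both variables because functions of them become the components of a test field;
  their transversal partials stay out of the divergence, hence the existential
  \<open>g\<close>.\<close>

definition density :: "real \<Rightarrow> (pt \<Rightarrow> real) \<Rightarrow> (pt \<Rightarrow> real) \<Rightarrow> (pt \<Rightarrow> real) \<Rightarrow> bool" where
  "density R f M1 M2 \<longleftrightarrow> R > 0 \<and> (\<forall>z. 0 \<le> f z) \<and> (\<forall>z. f z \<noteq> 0 \<longrightarrow> \<bar>fst z\<bar> \<le> R \<and> \<bar>snd z\<bar> \<le> R) \<and>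
     (\<exists>g. C1 M1 f g) \<and> (\<exists>g. C1 M2 g f) \<and>
     (\<forall>z. fst z \<le> - R \<longrightarrow> M1 z = 0) \<and> (\<forall>z. snd z \<le> - R \<longrightarrow> M2 z = 0) \<and>
     (\<forall>z. 0 \<le> M1 z) \<and> (\<forall>z. 0 \<le> M2 z)"

lemma density_continuous: "density R f M1 M2 \<Longrightarrow> continuous_on UNIV f"
  by (auto simp: density_def C1_def)

lemma density_measurable: "density R f M1 M2 \<Longrightarrow> f \<in> borel_measurable borel"
  by (intro borel_measurable_continuous_onI density_continuous)

lemma density_zero: "density 1 (\<lambda>_. 0) (\<lambda>_. 0) (\<lambda>_. 0)"
  unfolding density_def using C1_const[of 0] by auto

lemma density_add:
  assumes "density R f M1 M2" "density R' f' M1' M2'"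
  shows "density (max R R') (\<lambda>z. f z + f' z) (\<lambda>z. M1 z + M1' z) (\<lambda>z. M2 z + M2' z)"
proof -
  have "f z = 0" if "\<not> (\<bar>fst z\<bar> \<le> R \<and> \<bar>snd z\<bar> \<le> R)" for z
    using assms(1) that unfolding density_def by blast
  moreover have "f' z = 0" if "\<not> (\<bar>fst z\<bar> \<le> R' \<and> \<bar>snd z\<bar> \<le> R')" for z
    using assms(2) that unfolding density_def by blast
  ultimately have "\<bar>fst z\<bar> \<le> max R R' \<and> \<bar>snd z\<bar> \<le> max R R'" if "f z + f' z \<noteq> 0" for z
    using that by (metis add_0 le_max_iff_disj)
  then show ?thesis
    using assms C1_add unfolding density_def by (auto intro: C1_add)
qed

text \<open>The difference of two steps of width \<open>h\<close> that start at \<open>l\<close> and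
  \<open>r\<close>. The support is therefore [l, r + h] and not [l, r], which explains the
  asymmetric bounds below.\<close>

definition bump :: "real \<Rightarrow> real \<Rightarrow> real \<Rightarrow> real \<Rightarrow> real" where
  "bump h l r t = step ((t - l) / h) - step ((t - r) / h)"

definition ibump :: "real \<Rightarrow> real \<Rightarrow> real \<Rightarrow> real \<Rightarrow> real" where
  "ibump h l r t = h * (istep ((t - l) / h) - istep ((t - r) / h))"

definition dbump :: "real \<Rightarrow> real \<Rightarrow> real \<Rightarrow> real \<Rightarrow> real" where
  "dbump h l r t = (dstep ((t - l) / h) - dstep ((t - r) / h)) / h"

lemma continuous_bump:
  assumes "h > 0"
  shows "continuous_on UNIV (bump h l r)" "continuous_on UNIV (dbump h l r)"
proof -
  have "continuous_on UNIV (\<lambda>t. step ((t - c) / h))" "continuous_on UNIV (\<lambda>t. dstep ((t - c) / h))" for c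
    by (rule continuous_on_compose2[OF continuous_step] continuous_on_compose2[OF continuous_dstep];
        use assms in \<open>auto intro!: continuous_intros\<close>)+
  then show "continuous_on UNIV (bump h l r)" "continuous_on UNIV (dbump h l r)"
    unfolding bump_def[abs_def] dbump_def[abs_def] using assms by (auto intro!: continuous_on_diff continuous_on_divide)
qed

lemma DERIV_bump:
  assumes "h > 0"
  shows "(ibump h l r has_real_derivative bump h l r t) (at t)"
    and "(bump h l r has_real_derivative dbump h l r t) (at t)"
proof -
  have "((\<lambda>t. istep ((t - c) / h)) has_real_derivative step ((t - c) / h) / h) (at t)" for c
    by (rule DERIV_chain2[OF DERIV_istep, THEN DERIV_cong]) (use assms in \<open>auto intro!: derivative_eq_intros\<close>)
  from DERIV_cmult[OF DERIV_diff[OF this[of l] this[of r]], of h]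
  show "(ibump h l r has_real_derivative bump h l r t) (at t)"
    unfolding ibump_def[abs_def] bump_def using assms by (simp add: right_diff_distrib)
  have "((\<lambda>t. step ((t - c) / h)) has_real_derivative dstep ((t - c) / h) / h) (at t)" for c
    by (rule DERIV_chain2[OF DERIV_step, THEN DERIV_cong]) (use assms in \<open>auto intro!: derivative_eq_intros\<close>)
  from DERIV_diff[OF this[of l] this[of r]]
  show "(bump h l r has_real_derivative dbump h l r t) (at t)"
    unfolding bump_def[abs_def] dbump_def by (simp add: diff_divide_distrib)
qed

lemma bump_bounds:
  assumes "h > 0" "l \<le> r"
  shows "0 \<le> bump h l r t" "bump h l r t \<le> 1" "0 \<le> ibump h l r t"
proof -
  have "(t - r) / h \<le> (t - l) / h" using assms by (simp add: divide_right_mono)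
  then show "0 \<le> bump h l r t" "0 \<le> ibump h l r t"
    using assms by (simp_all add: bump_def ibump_def step_mono istep_mono)
  show "bump h l r t \<le> 1"
    unfolding bump_def using step_bounds[of "(t - l) / h"] step_bounds[of "(t - r) / h"] by linarith
qed

lemma bump_eq_0:
  assumes "h > 0" "l \<le> r"
  shows "t \<le> l \<or> t \<ge> r + h \<Longrightarrow> bump h l r t = 0" "t \<le> l \<Longrightarrow> ibump h l r t = 0"
proof -
  assume "t \<le> l \<or> t \<ge> r + h"
  then show "bump h l r t = 0"
  proof
    assume "t \<le> l"
    then show ?thesis using assms by (simp add: bump_def step_le_0 divide_le_0_iff)
  next
    assume "t \<ge> r + h"
    then have "1 \<le> (t - l) / h" "1 \<le> (t - r) / h" using assms by (simp_all add: field_simps)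
    then show ?thesis by (simp add: bump_def step_ge_1)
  qed
next
  assume "t \<le> l"
  then show "ibump h l r t = 0" using assms by (simp add: ibump_def istep_le_0 divide_le_0_iff)
qed

lemma density_box:
  assumes "h > 0" "l1 \<le> r1" "l2 \<le> r2"
  shows "\<exists>R. density R (\<lambda>z. bump h l1 r1 (fst z) * bump h l2 r2 (snd z))
           (\<lambda>z. ibump h l1 r1 (fst z) * bump h l2 r2 (snd z))
           (\<lambda>z. bump h l1 r1 (fst z) * ibump h l2 r2 (snd z))"
proof -
  \<comment> \<open>Large enough for both supports [l, r + h]; the entry 1 keeps \<open>R\<close>
    positive.\<close>
  define R where "R = max 1 (max (max (- l1) (- l2)) (max (r1 + h) (r2 + h)))"
  have R: "0 < R" "- R \<le> l1" "- R \<le> l2" "r1 + h \<le> R" "r2 + h \<le> R" unfolding R_def by auto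
  have u: "C1 (\<lambda>z. bump h l r (fst z)) (\<lambda>z. dbump h l r (fst z)) (\<lambda>_. 0)"
      "C1 (\<lambda>z. ibump h l r (fst z)) (\<lambda>z. bump h l r (fst z)) (\<lambda>_. 0)"
      "C1 (\<lambda>z. bump h l r (snd z)) (\<lambda>_. 0) (\<lambda>z. dbump h l r (snd z))"
      "C1 (\<lambda>z. ibump h l r (snd z)) (\<lambda>_. 0) (\<lambda>z. bump h l r (snd z))" for l r
    using C1_fst[of "bump h l r" "dbump h l r"] C1_fst[of "ibump h l r" "bump h l r"]
      C1_snd[of "bump h l r" "dbump h l r"] C1_snd[of "ibump h l r" "bump h l r"]
    by (simp_all add: DERIV_bump[OF assms(1)] continuous_bump[OF assms(1)])
  have a: "C1 (\<lambda>z. ibump h l1 r1 (fst z) * bump h l2 r2 (snd z))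
     (\<lambda>z. bump h l1 r1 (fst z) * bump h l2 r2 (snd z)) (\<lambda>z. ibump h l1 r1 (fst z) * dbump h l2 r2 (snd z))"
    using C1_mult[OF u(2)[of l1 r1] u(3)[of l2 r2]] by simp
  have b: "C1 (\<lambda>z. bump h l1 r1 (fst z) * ibump h l2 r2 (snd z))
     (\<lambda>z. dbump h l1 r1 (fst z) * ibump h l2 r2 (snd z)) (\<lambda>z. bump h l1 r1 (fst z) * bump h l2 r2 (snd z))"
    using C1_mult[OF u(1)[of l1 r1] u(4)[of l2 r2]] by simp
  have c: "\<bar>fst z\<bar> \<le> R \<and> \<bar>snd z\<bar> \<le> R"
    if "bump h l1 r1 (fst z) * bump h l2 r2 (snd z) \<noteq> 0" for z :: pt
  proof -
    have "bump h l1 r1 (fst z) \<noteq> 0" "bump h l2 r2 (snd z) \<noteq> 0" using that by auto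
    then have "\<not> (fst z \<le> l1 \<or> fst z \<ge> r1 + h)" "\<not> (snd z \<le> l2 \<or> snd z \<ge> r2 + h)"
      using bump_eq_0(1)[OF assms(1,2), of "fst z"] bump_eq_0(1)[OF assms(1,3), of "snd z"] by argo+
    then show ?thesis using R by (simp add: abs_le_iff)
  qed
  have "density R (\<lambda>z. bump h l1 r1 (fst z) * bump h l2 r2 (snd z))
           (\<lambda>z. ibump h l1 r1 (fst z) * bump h l2 r2 (snd z))
           (\<lambda>z. bump h l1 r1 (fst z) * ibump h l2 r2 (snd z))"
    unfolding density_def
  proof (intro conjI)
    show "\<exists>g. C1 (\<lambda>z. ibump h l1 r1 (fst z) * bump h l2 r2 (snd z)) (\<lambda>z. bump h l1 r1 (fst z) * bump h l2 r2 (snd z)) g"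
      by (rule exI[of _ "\<lambda>z. ibump h l1 r1 (fst z) * dbump h l2 r2 (snd z)"]) (rule a)
    show "\<exists>g. C1 (\<lambda>z. bump h l1 r1 (fst z) * ibump h l2 r2 (snd z)) g (\<lambda>z. bump h l1 r1 (fst z) * bump h l2 r2 (snd z))"
      by (rule exI[of _ "\<lambda>z. dbump h l1 r1 (fst z) * ibump h l2 r2 (snd z)"]) (rule b)
    show "\<forall>z::pt. 0 \<le> bump h l1 r1 (fst z) * bump h l2 r2 (snd z)"
      "\<forall>z::pt. 0 \<le> ibump h l1 r1 (fst z) * bump h l2 r2 (snd z)"
      "\<forall>z::pt. 0 \<le> bump h l1 r1 (fst z) * ibump h l2 r2 (snd z)"
      using bump_bounds[OF assms(1,2)] bump_bounds[OF assms(1,3)] by (intro allI mult_nonneg_nonneg; blast)+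
    show "\<forall>z::pt. fst z \<le> - R \<longrightarrow> ibump h l1 r1 (fst z) * bump h l2 r2 (snd z) = 0"
    proof (intro allI impI)
      fix z :: pt assume "fst z \<le> - R"
      then have "ibump h l1 r1 (fst z) = 0" by (intro bump_eq_0(2)[OF assms(1,2)] order_trans[OF _ R(2)])
      then show "ibump h l1 r1 (fst z) * bump h l2 r2 (snd z) = 0" by (simp only: mult_zero_left)
    qed
    show "\<forall>z::pt. snd z \<le> - R \<longrightarrow> bump h l1 r1 (fst z) * ibump h l2 r2 (snd z) = 0"
    proof (intro allI impI)
      fix z :: pt assume "snd z \<le> - R"
      then have "ibump h l2 r2 (snd z) = 0" by (intro bump_eq_0(2)[OF assms(1,3)] order_trans[OF _ R(3)])
      then show "bump h l1 r1 (fst z) * ibump h l2 r2 (snd z) = 0" by (simp only: mult_zero_right)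
    qed
    show "\<forall>z::pt. bump h l1 r1 (fst z) * bump h l2 r2 (snd z) \<noteq> 0 \<longrightarrow> \<bar>fst z\<bar> \<le> R \<and> \<bar>snd z\<bar> \<le> R"
      using c by blast
  qed (rule R)
  then show ?thesis by (rule exI[of _ R])
qed

text \<open>The profile \<open>m \<mapsto> 2 m / (m + \<eta>) - 1\<close> climbs from \<open>-1\<close> to almost \<open>1\<close> while the primitive of the
  density sweeps across a slice, so the corresponding vector field sees the full jump \<open>2\<close> of every
  slice of positive length.\<close>

lemma density_perimeter1:
  assumes D: "density R f M1 M2" and E: "E \<in> sets borel" "emeasure lborel E < \<infinity>" and \<eta>: "\<eta> > 0"
  shows "(\<integral>\<^sup>+z. ennreal (indicator E z * ((2 * \<eta> / (M1 z + \<eta>)\<^sup>2 + 2 * \<eta> / (M2 z + \<eta>)\<^sup>2) * f z)) \<partial>lborel)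
     \<le> perimeter1 E"
proof -
  obtain g1 g2 where C: "C1 M1 f g1" "C1 M2 g2 f" using D by (auto simp: density_def)
  have R: "R > 0" and f0: "\<And>z. 0 \<le> f z" and M0: "\<And>z. 0 \<le> M1 z" "\<And>z. 0 \<le> M2 z"
    and supp: "\<And>z. f z \<noteq> 0 \<Longrightarrow> \<bar>fst z\<bar> \<le> R \<and> \<bar>snd z\<bar> \<le> R"
    using D by (auto simp: density_def)
  define \<theta> where "\<theta> m = 2 * m / (m + \<eta>) - 1" for m
  define \<theta>' where "\<theta>' m = 2 * \<eta> / (m + \<eta>)\<^sup>2" for m
  have d\<theta>: "(\<theta> has_real_derivative \<theta>' m) (at m)" if "m \<ge> 0" for m
    unfolding \<theta>_def[abs_def] \<theta>'_def using that \<eta>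
    by (auto intro!: derivative_eq_intros simp: field_simps power2_eq_square)
  have \<theta>1: "\<bar>\<theta> m\<bar> \<le> 1" if "m \<ge> 0" for m
    using that \<eta> by (auto simp: \<theta>_def abs_le_iff field_simps)
  have \<theta>'0: "0 \<le> \<theta>' m" for m unfolding \<theta>'_def using \<eta> by simp
  have nz: "M1 z + \<eta> \<noteq> 0" "M2 z + \<eta> \<noteq> 0" for z using M0[of z] \<eta> by linarith+
  have c\<theta>: "continuous_on UNIV (\<lambda>z. \<theta>' (M1 z))" "continuous_on UNIV (\<lambda>z. \<theta>' (M2 z))"
    unfolding \<theta>'_def using nz by (auto intro!: continuous_intros C1_continuous[OF C(1)] C1_continuous[OF C(2)])
  have cf: "continuous_on UNIV f" using C by (simp add: C1_def)
  define F where "F z = (\<theta>' (M1 z) + \<theta>' (M2 z)) * f z" for z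
  have cF: "continuous_on UNIV F" unfolding F_def[abs_def] by (intro continuous_intros c\<theta> cf)
  have F0: "0 \<le> F z" for z unfolding F_def using \<theta>'0 f0 by simp
  have mE: "(\<lambda>z. indicator E z * h z) \<in> borel_measurable lborel" if "continuous_on UNIV h" for h :: "pt \<Rightarrow> real"
    using borel_measurable_continuous_onI[OF that] E by measurable
  have intF: "integrable lborel (\<lambda>z. indicator E z * F z)"
  proof -
    have "compact (cbox (-R, -R) (R, R))" by simp
    then have "bounded (F ` cbox (-R, -R) (R, R))"
      by (intro compact_imp_bounded compact_continuous_image continuous_on_subset[OF cF]) auto
    then obtain B where B: "\<And>z. z \<in> cbox (-R, -R) (R, R) \<Longrightarrow> \<bar>F z\<bar> \<le> B"
      by (auto simp: bounded_iff)
    have "\<bar>F z\<bar> \<le> max B 0" for z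
    proof (cases "f z = 0")
      case False
      then have "z \<in> cbox (-R, -R) (R, R)" using supp[of z] by (cases z) (auto simp: abs_le_iff cbox_Pair_eq)
      then show ?thesis using B[of z] by simp
    qed (simp add: F_def)
    moreover have "integrable lborel (\<lambda>z. indicator E z * max B 0)"
      using E by (intro integrable_mult_left) (simp add: integrable_indicator_iff)
    ultimately show ?thesis
      by (rule_tac Bochner_Integration.integrable_bound[where f = "\<lambda>z. indicator E z * max B 0"])
         (use mE[OF cF] in \<open>auto simp: indicator_def\<close>)
  qed
  define a where "a = measure lborel E"
  \<comment> \<open>\<open>\<theta> (M1 z)\<close> equals -1 wherever the primitive vanishes, so the
    field with components \<open>\<theta> (M1 z)\<close> and \<open>\<theta> (M2 z)\<close> lacks
    compact support. A cutoff at scale \<open>N > R\<close> repairs this: it is 1 where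
    \<open>f\<close> lives, and its own gradient costs at most \<open>8 / N\<close> per unit area of
    \<open>E\<close>, which disappears as \<open>N\<close> grows.\<close>
  have key: "ennreal (integral\<^sup>L lborel (\<lambda>z. indicator E z * F z) - 8 * a / N) \<le> perimeter1 E"
    if N: "N > R" for N
  proof -
    have N0: "N > 0" using N R by simp
    define k where "k z = cutoff (fst z / N) * cutoff (snd z / N)" for z :: pt
    have dc: "((\<lambda>t. cutoff (t / N)) has_real_derivative dcutoff (t / N) / N) (at t)" for t
      by (rule DERIV_chain2[OF DERIV_cutoff, THEN DERIV_cong]) (use N0 in \<open>auto intro!: derivative_eq_intros\<close>)
    have cc: "continuous_on UNIV (\<lambda>t. dcutoff (t / N) / N)"
      by (intro continuous_intros continuous_on_compose2[OF continuous_dcutoff] subset_UNIV) (use N0 in auto)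
    have Ck: "C1 k (\<lambda>z. dcutoff (fst z / N) / N * cutoff (snd z / N)) (\<lambda>z. cutoff (fst z / N) * (dcutoff (snd z / N) / N))"
      using C1_mult[OF C1_fst[OF dc cc] C1_snd[OF dc cc]] unfolding k_def[abs_def] by simp
    have X1: "C1 (\<lambda>z. k z * \<theta> (M1 z)) (\<lambda>z. dcutoff (fst z / N) / N * cutoff (snd z / N) * \<theta> (M1 z) + k z * (\<theta>' (M1 z) * f z))
       (\<lambda>z. cutoff (fst z / N) * (dcutoff (snd z / N) / N) * \<theta> (M1 z) + k z * (\<theta>' (M1 z) * g1 z))"
      by (rule C1_mult[OF Ck C1_compose[OF C(1) d\<theta>[OF M0(1)] c\<theta>(1)]])
    have X2: "C1 (\<lambda>z. k z * \<theta> (M2 z)) (\<lambda>z. dcutoff (fst z / N) / N * cutoff (snd z / N) * \<theta> (M2 z) + k z * (\<theta>' (M2 z) * g2 z))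
       (\<lambda>z. cutoff (fst z / N) * (dcutoff (snd z / N) / N) * \<theta> (M2 z) + k z * (\<theta>' (M2 z) * f z))"
      by (rule C1_mult[OF Ck C1_compose[OF C(2) d\<theta>[OF M0(2)] c\<theta>(2)]])
    have k01: "0 \<le> k z" "k z \<le> 1" for z unfolding k_def using cutoff_bounds by (auto intro: mult_le_one)
    have b1: "\<bar>k z * \<theta> (M1 z)\<bar> \<le> 1" "\<bar>k z * \<theta> (M2 z)\<bar> \<le> 1" for z
      unfolding abs_mult by (intro mult_le_one; simp add: k01 \<theta>1 M0)+
    have kz: "k z = 0" if "z \<notin> cbox (-2*N, -2*N) (2*N, 2*N)" for z
    proof -
      obtain s t where z: "z = (s, t)" by (cases z)
      with that have "\<bar>s / N\<bar> \<ge> 2 \<or> \<bar>t / N\<bar> \<ge> 2"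
        using N0 by (auto simp: cbox_Pair_eq field_simps)
      then show ?thesis using z by (auto simp: k_def cutoff_eq_0)
    qed
    have bd: "bounded {z. k z * h z \<noteq> 0}" for h :: "pt \<Rightarrow> real"
      by (rule bounded_subset[OF bounded_cbox[of "(-2*N, -2*N)" "(2*N, 2*N)"]]) (use kz in fastforce)
    define e where "e z = dcutoff (fst z / N) / N * cutoff (snd z / N) * \<theta> (M1 z)
        + cutoff (fst z / N) * (dcutoff (snd z / N) / N) * \<theta> (M2 z)" for z
    have kf: "k z * (\<theta>' (M1 z) * f z) + k z * (\<theta>' (M2 z) * f z) = F z" for z
    proof (cases "f z = 0")
      case False
      then have "\<bar>fst z / N\<bar> \<le> 1" "\<bar>snd z / N\<bar> \<le> 1" using supp[of z] N R by auto
      then show ?thesis by (simp add: k_def cutoff_eq_1 F_def algebra_simps)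
    qed (simp add: F_def)
    have e8: "\<bar>e z\<bar> \<le> 8 / N" for z
    proof -
      have "\<bar>dcutoff s / N * cutoff t * \<theta> m\<bar> \<le> 4 / N * 1 * 1" "\<bar>cutoff t * (dcutoff s / N) * \<theta> m\<bar> \<le> 1 * (4 / N) * 1"
        if "m \<ge> 0" for s t m
        unfolding abs_mult using dcutoff_bound[of s] cutoff_bounds[of t] \<theta>1[OF that] N0
        by (intro mult_mono; simp add: divide_right_mono)+
      from this(1)[OF M0(1)] this(2)[OF M0(2)]
      have "\<bar>dcutoff (fst z / N) / N * cutoff (snd z / N) * \<theta> (M1 z)\<bar> \<le> 4 / N"
         "\<bar>cutoff (fst z / N) * (dcutoff (snd z / N) / N) * \<theta> (M2 z)\<bar> \<le> 4 / N" by auto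
      then show ?thesis unfolding e_def by linarith
    qed
    \<comment> \<open>\<open>e\<close> is the full divergence minus \<open>F\<close>, so its
      continuity is inherited from the C1 certificates of the two components.\<close>
    have ce: "continuous_on UNIV e"
    proof -
      have "continuous_on UNIV (\<lambda>z. dcutoff (fst z / N) / N * cutoff (snd z / N) * \<theta> (M1 z) + k z * (\<theta>' (M1 z) * f z))"
        "continuous_on UNIV (\<lambda>z. cutoff (fst z / N) * (dcutoff (snd z / N) / N) * \<theta> (M2 z) + k z * (\<theta>' (M2 z) * f z))"
        using X1 X2 by (simp_all add: C1_def)
      from continuous_on_diff[OF continuous_on_add[OF this] cF] show ?thesis
        by (rule continuous_on_cong[THEN iffD1, rotated -1]) (auto simp: e_def kf[symmetric])
    qed
    have inte: "integrable lborel (\<lambda>z. indicator E z * e z)"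
    proof (rule Bochner_Integration.integrable_bound)
      show "integrable lborel (\<lambda>z. indicator E z * (8 / N))"
        using E by (intro integrable_mult_left) (simp add: integrable_indicator_iff)
      show "(\<lambda>z. indicator E z * e z) \<in> borel_measurable lborel"
        by (rule mE[OF ce])
      show "AE z in lborel. norm (indicat_real E z * e z) \<le> norm (indicat_real E z * (8 / N))"
        using e8 N0 by (auto simp: indicator_def)
    qed
    have "(LINT z|lborel. indicator E z * e z) \<ge> (LINT z|lborel. - (indicator E z * (8 / N)))"
    proof (rule integral_mono)
      show "integrable lborel (\<lambda>z. - (indicat_real E z * (8 / N)))"
        using E by (intro integrable_minus integrable_mult_left) (simp add: integrable_indicator_iff)
      show "- (indicat_real E z * (8 / N)) \<le> indicat_real E z * e z" for z
        using e8[of z] by (auto simp: indicator_def)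
    qed (rule inte)
    also have "(LINT z|lborel. - (indicator E z * (8 / N))) = - (8 * a / N)"
      unfolding a_def using E by simp
    finally have lo: "- (8 * a / N) \<le> (LINT z|lborel. indicator E z * e z)" .
    have eqi: "(LINT z|lebesgue. indicator E z *
        ((dcutoff (fst z / N) / N * cutoff (snd z / N) * \<theta> (M1 z) + k z * (\<theta>' (M1 z) * f z)) +
         (cutoff (fst z / N) * (dcutoff (snd z / N) / N) * \<theta> (M2 z) + k z * (\<theta>' (M2 z) * f z))))
      = (LINT z|lborel. indicator E z * F z + indicator E z * e z)"
    proof -
      have "(\<lambda>z. indicator E z * F z + indicator E z * e z) \<in> borel_measurable lborel"
        by (intro borel_measurable_add mE ce cF)
      from integral_completion[OF this] show ?thesis
        by (simp add: e_def kf[symmetric] algebra_simps)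
    qed
    have "ennreal (LINT z|lborel. indicator E z * F z + indicator E z * e z) \<le> perimeter1 E"
      using perimeter1_ge_C1[OF X1 X2 b1 bd bd, of E] unfolding eqi .
    moreover have "(LINT z|lborel. indicator E z * F z) - 8 * a / N
        \<le> (LINT z|lborel. indicator E z * F z + indicator E z * e z)"
      using Bochner_Integration.integral_add[OF intF inte] lo by simp
    ultimately show ?thesis by (meson ennreal_leI order_trans)
  qed
  have "ennreal (integral\<^sup>L lborel (\<lambda>z. indicator E z * F z)) \<le> perimeter1 E"
  proof (rule tendsto_upperbound)
    have "(\<lambda>N. integral\<^sup>L lborel (\<lambda>z. indicator E z * F z) - 8 * a / N) \<longlonglongrightarrow> integral\<^sup>L lborel (\<lambda>z. indicator E z * F z) - 0"
      by (intro tendsto_diff tendsto_const lim_const_over_n)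
    then show "(\<lambda>N. ennreal (integral\<^sup>L lborel (\<lambda>z. indicator E z * F z) - 8 * a / real N))
        \<longlonglongrightarrow> ennreal (integral\<^sup>L lborel (\<lambda>z. indicator E z * F z))"
      by (intro tendsto_ennrealI) simp
    show "\<forall>\<^sub>F N in sequentially. ennreal (integral\<^sup>L lborel (\<lambda>z. indicator E z * F z) - 8 * a / real N) \<le> perimeter1 E"
    proof -
      obtain n0 :: nat where "R < real n0" using reals_Archimedean2 by blast
      then show ?thesis by (intro eventually_sequentiallyI[of n0] key) auto
    qed
  qed auto
  moreover have "ennreal (integral\<^sup>L lborel (\<lambda>z. indicator E z * F z)) = (\<integral>\<^sup>+z. ennreal (indicator E z * F z) \<partial>lborel)"
    by (rule nn_integral_eq_integral[symmetric, OF intF]) (use F0 in auto)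
  ultimately show ?thesis unfolding F_def \<theta>'_def by simp
qed

section \<open>Slices and projections\<close>

lemma nn_integral_lborel_fst:
  fixes f :: "pt \<Rightarrow> ennreal"
  assumes "f \<in> borel_measurable borel"
  shows "(\<integral>\<^sup>+z. f z \<partial>lborel) = (\<integral>\<^sup>+s. \<integral>\<^sup>+t. f (s, t) \<partial>lborel \<partial>lborel)"
  using lborel.nn_integral_fst[of f "lborel :: real measure"] assms by (simp add: lborel_prod)

lemma nn_integral_lborel_snd:
  fixes f :: "pt \<Rightarrow> ennreal"
  assumes "f \<in> borel_measurable borel"
  shows "(\<integral>\<^sup>+z. f z \<partial>lborel) = (\<integral>\<^sup>+t. \<integral>\<^sup>+s. f (s, t) \<partial>lborel \<partial>lborel)"
  using lborel_pair.nn_integral_snd[of f] assms by (simp add: lborel_prod)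

lemma measurable_Pair_fst:
  fixes f :: "pt \<Rightarrow> 'a::topological_space"
  assumes "f \<in> borel_measurable borel"
  shows "(\<lambda>s. f (s, t)) \<in> borel_measurable borel" "(\<lambda>t. f (s, t)) \<in> borel_measurable borel"
  by (rule measurable_compose[OF _ assms], simp add: borel_prod[symmetric])+

lemma nn_integral_slice_measurable:
  fixes f :: "pt \<Rightarrow> ennreal"
  assumes "f \<in> borel_measurable borel"
  shows "(\<lambda>t. \<integral>\<^sup>+s. f (s, t) \<partial>lborel) \<in> borel_measurable borel"
    and "(\<lambda>s. \<integral>\<^sup>+t. f (s, t) \<partial>lborel) \<in> borel_measurable borel"
proof -
  have f: "f \<in> borel_measurable (borel \<Otimes>\<^sub>M borel)" using assms by (simp add: borel_prod)
  have "(\<lambda>(t, s). f (s, t)) \<in> borel_measurable (borel \<Otimes>\<^sub>M lborel)"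
    using measurable_compose[OF measurable_Pair[OF measurable_snd measurable_fst] f]
    by (simp add: case_prod_unfold cong: measurable_cong_sets)
  from lborel.borel_measurable_nn_integral[OF this]
  show "(\<lambda>t. \<integral>\<^sup>+s. f (s, t) \<partial>lborel) \<in> borel_measurable borel" by simp
  have "(\<lambda>(s, t). f (s, t)) \<in> borel_measurable (borel \<Otimes>\<^sub>M lborel)"
    using f by (simp add: case_prod_unfold cong: measurable_cong_sets)
  from lborel.borel_measurable_nn_integral[OF this]
  show "(\<lambda>s. \<integral>\<^sup>+t. f (s, t) \<partial>lborel) \<in> borel_measurable borel" by simp
qed

text \<open>The profile \<open>2 * m / (m + \<eta>)\<close> is increasing in \<open>m\<close>, and
  its slope never exceeds the value \<open>2 / \<eta>\<close> taken at 0.\<close>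

lemma saturation_diff_le:
  fixes u d \<eta> m :: real
  assumes "0 \<le> u" "0 \<le> d" "0 < \<eta>" "0 \<le> m" "m \<le> u + d"
  shows "2 * m / (m + \<eta>) \<le> 2 * u / (u + \<eta>) + 2 / \<eta> * d"
proof -
  have "2 * m / (m + \<eta>) \<le> 2 * (u + d) / (u + d + \<eta>)"
    using mult_left_mono[OF assms(5), of "2 * \<eta>"] assms by (simp add: field_simps)
  also have "\<dots> = 2 * u / (u + \<eta>) + 2 * \<eta> / ((u + d + \<eta>) * (u + \<eta>)) * d"
    using assms by (simp add: divide_simps) (simp add: algebra_simps)
  also have "2 * \<eta> / ((u + d + \<eta>) * (u + \<eta>)) \<le> 2 * \<eta> / (\<eta> * \<eta>)"
    using assms by (intro divide_left_mono mult_mono) auto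
  also have "2 * \<eta> / (\<eta> * \<eta>) = 2 / \<eta>" using assms by simp
  finally show ?thesis using assms by (auto simp: mult_right_mono)
qed

text \<open>By the chain rule \<open>2 * \<eta> / (M s + \<eta>)\<^sup>2 * \<phi> s\<close> is the
  derivative of \<open>2 * M s / (M s + \<eta>)\<close>, so over the whole line it integrates to the
  profile at the total mass of \<open>\<phi>\<close>. Restricting the integral to \<open>T\<close>
  and replacing the mass of \<open>\<phi>\<close> by the length of \<open>T\<close> each cost
  \<open>2 / \<eta>\<close> times the L1 distance between \<open>\<phi>\<close> and the indicator;
  hence the factor \<open>4 / \<eta>\<close>.\<close>

lemma slice_lower_bound:
  fixes \<phi> M :: "real \<Rightarrow> real"
  assumes \<phi>: "continuous_on UNIV \<phi>" "\<And>s. 0 \<le> \<phi> s" and M: "\<And>s. (M has_real_derivative \<phi> s) (at s)" "\<And>s. 0 \<le> M s"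
    and R: "R > 0" "M (- R) = 0" "\<And>s. \<phi> s \<noteq> 0 \<Longrightarrow> \<bar>s\<bar> \<le> R"
    and T: "T \<in> sets borel" and \<eta>: "\<eta> > 0"
  shows "ennreal (2 * measure lborel T / (measure lborel T + \<eta>))
      \<le> (\<integral>\<^sup>+s. ennreal (indicator T s * (2 * \<eta> / (M s + \<eta>)\<^sup>2 * \<phi> s)) \<partial>lborel)
        + ennreal (4 / \<eta>) * (\<integral>\<^sup>+s. ennreal \<bar>\<phi> s - indicator T s\<bar> \<partial>lborel)" (is "?L \<le> ?I + _ * ?d")
proof -
  define \<theta> where "\<theta> m = 2 * m / (m + \<eta>)" for m
  define \<theta>' where "\<theta>' m = 2 * \<eta> / (m + \<eta>)\<^sup>2" for m
  have nz: "M s + \<eta> \<noteq> 0" for s using M(2)[of s] \<eta> by linarith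
  have d\<theta>: "((\<lambda>s. \<theta> (M s)) has_real_derivative \<theta>' (M s) * \<phi> s) (at s)" for s
    unfolding \<theta>_def \<theta>'_def using nz[of s]
    by (auto intro!: derivative_eq_intros M(1) simp: field_simps power2_eq_square)
  have cM: "continuous_on UNIV M" by (meson M(1) DERIV_isCont continuous_at_imp_continuous_on)
  have m\<phi>: "\<phi> \<in> borel_measurable borel" by (rule borel_measurable_continuous_onI[OF \<phi>(1)])
  have m\<theta>: "(\<lambda>s. \<theta>' (M s) * \<phi> s) \<in> borel_measurable borel"
    unfolding \<theta>'_def using nz by (intro borel_measurable_continuous_onI continuous_intros cM \<phi>(1)) auto
  have \<theta>'0: "0 \<le> \<theta>' (M s)" for s unfolding \<theta>'_def using \<eta> by simp
  have \<theta>'le: "\<theta>' (M s) \<le> 2 / \<eta>" for s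
  proof -
    have "\<eta>\<^sup>2 \<le> (M s + \<eta>)\<^sup>2" using M(2)[of s] \<eta> by (intro power_mono) auto
    then have "\<theta>' (M s) \<le> 2 * \<eta> / \<eta>\<^sup>2" unfolding \<theta>'_def using \<eta> nz[of s] by (intro divide_left_mono) auto
    then show ?thesis using \<eta> by (simp add: power2_eq_square)
  qed
  have supp: "\<phi> s = 0" if "s \<notin> {-R..R}" for s
    using R(3)[of s] that by (cases "\<phi> s = 0") (simp_all add: abs_le_iff)
  have "(\<integral>\<^sup>+s. ennreal (\<phi> s) \<partial>lborel) = (\<integral>\<^sup>+s. ennreal (\<phi> s) * indicator {-R..R} s \<partial>lborel)"
    using supp by (intro nn_integral_cong) (auto simp: indicator_def)
  also have "\<dots> = M R - M (- R)"
    by (rule nn_integral_FTC_Icc) (use m\<phi> M(1) \<phi> R in auto)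
  finally have MR: "(\<integral>\<^sup>+s. ennreal (\<phi> s) \<partial>lborel) = ennreal (M R)" using R by simp
  have "(\<integral>\<^sup>+s. ennreal (\<theta>' (M s) * \<phi> s) \<partial>lborel) = (\<integral>\<^sup>+s. ennreal (\<theta>' (M s) * \<phi> s) * indicator {-R..R} s \<partial>lborel)"
    using supp by (intro nn_integral_cong) (auto simp: indicator_def)
  also have "\<dots> = \<theta> (M R) - \<theta> (M (- R))"
    by (rule nn_integral_FTC_Icc) (use m\<theta> d\<theta> \<phi> \<theta>'0 R in auto)
  finally have \<theta>R: "(\<integral>\<^sup>+s. ennreal (\<theta>' (M s) * \<phi> s) \<partial>lborel) = ennreal (\<theta> (M R))" using R by (simp add: \<theta>_def)
  have mT: "(\<lambda>s. \<bar>\<phi> s - indicator T s\<bar>) \<in> borel_measurable borel" using m\<phi> T by measurable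
  have mI: "(\<lambda>s. indicator T s * (\<theta>' (M s) * \<phi> s)) \<in> borel_measurable borel" using m\<theta> T by measurable
  have "(\<integral>\<^sup>+s. ennreal (\<theta>' (M s) * \<phi> s) \<partial>lborel)
      \<le> (\<integral>\<^sup>+s. ennreal (indicator T s * (\<theta>' (M s) * \<phi> s)) + ennreal (2 / \<eta>) * ennreal \<bar>\<phi> s - indicator T s\<bar> \<partial>lborel)"
  proof (rule nn_integral_mono)
    fix s
    \<comment> \<open>Off \<open>T\<close> the indicator is 0, so what is lost there is at most
      \<open>2 / \<eta>\<close> times \<open>\<phi> s\<close>, which coincides with the pointwise
      distance.\<close>
    have "\<theta>' (M s) * \<phi> s \<le> 2 / \<eta> * \<phi> s" using \<theta>'le[of s] \<phi>(2)[of s] by (rule mult_right_mono)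
    then have "\<theta>' (M s) * \<phi> s \<le> indicator T s * (\<theta>' (M s) * \<phi> s) + 2 / \<eta> * \<bar>\<phi> s - indicator T s\<bar>"
      using \<phi>(2)[of s] \<eta> by (auto simp: indicator_def)
    then show "ennreal (\<theta>' (M s) * \<phi> s) \<le> ennreal (indicator T s * (\<theta>' (M s) * \<phi> s)) + ennreal (2 / \<eta>) * ennreal \<bar>\<phi> s - indicator T s\<bar>"
      using \<phi>(2)[of s] \<theta>'0[of s] \<eta> by (simp flip: ennreal_mult ennreal_plus)
  qed
  also have "\<dots> = ?I + ennreal (2 / \<eta>) * ?d"
    using mI mT by (subst nn_integral_add) (simp_all add: nn_integral_cmult flip: \<theta>'_def)
  finally have 1: "ennreal (\<theta> (M R)) \<le> ?I + ennreal (2 / \<eta>) * ?d" unfolding \<theta>R .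
  show ?thesis
  \<comment> \<open>For \<open>T\<close> of infinite length \<open>measure\<close> returns 0 by
    convention and the left side vanishes; for infinite distance the right side is infinite.\<close>
  proof (cases "emeasure lborel T = \<infinity> \<or> ?d = \<infinity>")
    case True
    then show ?thesis
    proof
      assume "emeasure lborel T = \<infinity>"
      then show ?thesis by (simp add: measure_def)
    next
      assume "?d = \<infinity>"
      then show ?thesis using \<eta> by (simp add: ennreal_mult_top)
    qed
  next
    case False
    define d where "d = enn2real ?d"
    have d: "?d = ennreal d" "d \<ge> 0" using False by (auto simp: d_def less_top)
    have "emeasure lborel T = (\<integral>\<^sup>+s. ennreal (indicator T s) \<partial>lborel)"
      using T by (simp add: ennreal_indicator)
    also have "\<dots> \<le> (\<integral>\<^sup>+s. ennreal (\<phi> s) + ennreal \<bar>\<phi> s - indicator T s\<bar> \<partial>lborel)"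
      using \<phi>(2) by (intro nn_integral_mono) (auto simp: indicator_def simp flip: ennreal_plus)
    also have "\<dots> = ennreal (M R) + ennreal d"
      using m\<phi> mT d MR by (subst nn_integral_add) auto
    finally have "measure lborel T \<le> M R + d"
      using False M(2)[of R] d(2) by (simp add: emeasure_eq_ennreal_measure flip: ennreal_plus)
    then have "\<theta> (measure lborel T) \<le> \<theta> (M R) + 2 / \<eta> * d"
      unfolding \<theta>_def using M(2)[of R] d(2) \<eta> by (intro saturation_diff_le) auto
    then have "?L \<le> ennreal (\<theta> (M R)) + ennreal (2 / \<eta>) * ?d"
      unfolding d(1) \<theta>_def using M(2)[of R] d(2) \<eta> by (simp flip: ennreal_mult ennreal_plus)
    also have "\<dots> \<le> ?I + ennreal (2 / \<eta>) * ?d + ennreal (2 / \<eta>) * ?d" using 1 by (rule add_right_mono)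
    also have "\<dots> = ?I + ennreal (4 / \<eta>) * ?d"
    proof -
      have "ennreal (2 / \<eta>) + ennreal (2 / \<eta>) = ennreal (4 / \<eta>)" using \<eta> by (simp flip: ennreal_plus)
      then have "ennreal (4 / \<eta>) * ?d = ennreal (2 / \<eta>) * ?d + ennreal (2 / \<eta>) * ?d"
        by (simp only: distrib_right[symmetric])
      then show ?thesis by (simp only: add.assoc)
    qed
    finally show ?thesis .
  qed
qed


lemma C1_partials:
  assumes "C1 f f1 f2"
  shows "((\<lambda>s. f (s, t)) has_real_derivative f1 (s, t)) (at s)"
    and "((\<lambda>t. f (s, t)) has_real_derivative f2 (s, t)) (at t)"
proof -
  have d: "(f has_derivative (\<lambda>h. f1 z * fst h + f2 z * snd h)) (at z)" for z
    using assms unfolding C1_def by blast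
  have "((\<lambda>s. f (s, t)) has_derivative (\<lambda>h. f1 (s, t) * fst (h, 0::real) + f2 (s, t) * snd (h, 0::real))) (at s)"
    by (rule has_derivative_compose[where f = "\<lambda>s. (s, t)", OF _ d]) (auto intro!: derivative_eq_intros)
  then show "((\<lambda>s. f (s, t)) has_real_derivative f1 (s, t)) (at s)"
    by (simp add: has_field_derivative_def)
  have "((\<lambda>t. f (s, t)) has_derivative (\<lambda>h. f1 (s, t) * fst (0::real, h) + f2 (s, t) * snd (0::real, h))) (at t)"
    by (rule has_derivative_compose[where f = "\<lambda>t. (s, t)", OF _ d]) (auto intro!: derivative_eq_intros)
  then show "((\<lambda>t. f (s, t)) has_real_derivative f2 (s, t)) (at t)"
    by (simp add: has_field_derivative_def)
qed

lemma slice_in_borel: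
  assumes "E \<in> sets (borel :: pt measure)"
  shows "{s. (s, t) \<in> E} \<in> sets borel" "{t. (s, t) \<in> E} \<in> sets borel"
proof -
  have 1: "(\<lambda>s. (s, t)) \<in> borel_measurable borel" "(\<lambda>t. (s, t)) \<in> borel_measurable borel"
    by (intro borel_measurable_continuous_onI continuous_intros)+
  show "{s. (s, t) \<in> E} \<in> sets borel" using measurable_sets[OF 1(1) assms] by (simp add: vimage_def)
  show "{t. (s, t) \<in> E} \<in> sets borel" using measurable_sets[OF 1(2) assms] by (simp add: vimage_def)
qed

lemma nn_integral_indicator_slice:
  assumes "E \<in> sets (borel :: pt measure)"
  shows "(\<integral>\<^sup>+s. indicator E (s, t) \<partial>lborel) = emeasure lborel {s. (s, t) \<in> E}"
    and "(\<integral>\<^sup>+t. indicator E (s, t) \<partial>lborel) = emeasure lborel {t. (s, t) \<in> E}"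
proof -
  have "(\<integral>\<^sup>+s. indicator E (s, t) \<partial>lborel) = (\<integral>\<^sup>+s. indicator {s. (s, t) \<in> E} s \<partial>lborel)"
    by (intro nn_integral_cong) (simp add: indicator_def)
  also have "\<dots> = emeasure lborel {s. (s, t) \<in> E}"
    using slice_in_borel[OF assms] by (intro nn_integral_indicator) simp
  finally show "(\<integral>\<^sup>+s. indicator E (s, t) \<partial>lborel) = emeasure lborel {s. (s, t) \<in> E}" .
  have "(\<integral>\<^sup>+t. indicator E (s, t) \<partial>lborel) = (\<integral>\<^sup>+t. indicator {t. (s, t) \<in> E} t \<partial>lborel)"
    by (intro nn_integral_cong) (simp add: indicator_def)
  also have "\<dots> = emeasure lborel {t. (s, t) \<in> E}"
    using slice_in_borel[OF assms] by (intro nn_integral_indicator) simp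
  finally show "(\<integral>\<^sup>+t. indicator E (s, t) \<partial>lborel) = emeasure lborel {t. (s, t) \<in> E}" .
qed

text \<open>\<open>measure\<close> gives 0 to slices of infinite length. For a set of finite area
  these slices form a null family, which is taken care of in
  \<open>AE_in_projections\<close>.\<close>

definition row :: "pt set \<Rightarrow> real \<Rightarrow> real" where
  "row E t = measure lborel {s. (s, t) \<in> E}"

definition col :: "pt set \<Rightarrow> real \<Rightarrow> real" where
  "col E s = measure lborel {t. (s, t) \<in> E}"

lemma measurable_row_col:
  assumes "E \<in> sets (borel :: pt measure)"
  shows "row E \<in> borel_measurable borel" "col E \<in> borel_measurable borel"
proof -
  have i: "(indicator E :: pt \<Rightarrow> ennreal) \<in> borel_measurable borel" using assms by simp
  have "row E t = enn2real (\<integral>\<^sup>+s. indicator E (s, t) \<partial>lborel)" for t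
    by (simp add: row_def measure_def nn_integral_indicator_slice[OF assms])
  then show "row E \<in> borel_measurable borel"
    using measurable_compose[OF nn_integral_slice_measurable(1)[OF i] borel_measurable_enn2real]
    by (simp add: fun_eq_iff[symmetric] cong: measurable_cong)
  have "col E s = enn2real (\<integral>\<^sup>+t. indicator E (s, t) \<partial>lborel)" for s
    by (simp add: col_def measure_def nn_integral_indicator_slice[OF assms])
  then show "col E \<in> borel_measurable borel"
    using measurable_compose[OF nn_integral_slice_measurable(2)[OF i] borel_measurable_enn2real]
    by (simp add: fun_eq_iff[symmetric] cong: measurable_cong)
qed

lemma row_col_nonneg [simp]: "0 \<le> row E t" "0 \<le> col E s"
  by (simp_all add: row_def col_def)

text \<open>The two summands of the divergence are treated separately: \<open>F1\<close> is
  integrated along rows first, \<open>F2\<close> along columns first, and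
  \<open>slice_lower_bound\<close> applies on each line. The slice errors add up by Fubini to the L1
  distance in the plane, once per direction, which gives 4 + 4 = 8.\<close>

lemma density_slices:
  assumes D: "density R f M1 M2" and E: "E \<in> sets borel" "emeasure lborel E < \<infinity>" and \<eta>: "\<eta> > 0"
  shows "(\<integral>\<^sup>+t. ennreal (2 * row E t / (row E t + \<eta>)) \<partial>lborel)
       + (\<integral>\<^sup>+s. ennreal (2 * col E s / (col E s + \<eta>)) \<partial>lborel)
     \<le> perimeter1 E + ennreal (8 / \<eta>) * (\<integral>\<^sup>+z. ennreal \<bar>f z - indicator E z\<bar> \<partial>lborel)"
    (is "?A + ?B \<le> _ + _ * ?d")
proof -
  obtain g1 g2 where C: "C1 M1 f g1" "C1 M2 g2 f" using D by (auto simp: density_def)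
  have R: "R > 0" and f0: "\<And>z. 0 \<le> f z" and M0: "\<And>z. 0 \<le> M1 z" "\<And>z. 0 \<le> M2 z"
    and supp: "\<And>z. f z \<noteq> 0 \<Longrightarrow> \<bar>fst z\<bar> \<le> R \<and> \<bar>snd z\<bar> \<le> R"
    and MR: "\<And>t. M1 (- R, t) = 0" "\<And>s. M2 (s, - R) = 0"
    using D by (auto simp: density_def)
  have cf: "continuous_on UNIV f" using C by (simp add: C1_def)
  have cfs: "continuous_on UNIV (\<lambda>s. f (s, t))" "continuous_on UNIV (\<lambda>t. f (s, t))" for s t
    by (rule continuous_on_compose2[OF cf]; auto intro!: continuous_intros)+
  have nz: "M1 z + \<eta> \<noteq> 0" "M2 z + \<eta> \<noteq> 0" for z using M0[of z] \<eta> by linarith+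
  define F1 where "F1 z = indicator E z * (2 * \<eta> / (M1 z + \<eta>)\<^sup>2 * f z)" for z
  define F2 where "F2 z = indicator E z * (2 * \<eta> / (M2 z + \<eta>)\<^sup>2 * f z)" for z
  have c: "continuous_on UNIV (\<lambda>z. 2 * \<eta> / (M1 z + \<eta>)\<^sup>2 * f z)" "continuous_on UNIV (\<lambda>z. 2 * \<eta> / (M2 z + \<eta>)\<^sup>2 * f z)"
    using nz by (auto intro!: continuous_intros C1_continuous[OF C(1)] C1_continuous[OF C(2)] cf)
  have mF: "F1 \<in> borel_measurable borel" "F2 \<in> borel_measurable borel"
    unfolding F1_def F2_def using borel_measurable_continuous_onI[OF c(1)] borel_measurable_continuous_onI[OF c(2)] E
    by measurable
  have md: "(\<lambda>z. \<bar>f z - indicator E z\<bar>) \<in> borel_measurable borel"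
    using density_measurable[OF D] E by measurable
  have F0: "0 \<le> F1 z" "0 \<le> F2 z" for z unfolding F1_def F2_def using f0 \<eta> by simp_all
  have "?A \<le> (\<integral>\<^sup>+t. (\<integral>\<^sup>+s. ennreal (F1 (s, t)) \<partial>lborel) + ennreal (4 / \<eta>) * (\<integral>\<^sup>+s. ennreal \<bar>f (s, t) - indicator E (s, t)\<bar> \<partial>lborel) \<partial>lborel)"
  proof (rule nn_integral_mono)
    fix t
    have "ennreal (2 * row E t / (row E t + \<eta>))
        \<le> (\<integral>\<^sup>+s. ennreal (indicator {s. (s, t) \<in> E} s * (2 * \<eta> / (M1 (s, t) + \<eta>)\<^sup>2 * f (s, t))) \<partial>lborel)
         + ennreal (4 / \<eta>) * (\<integral>\<^sup>+s. ennreal \<bar>f (s, t) - indicator {s. (s, t) \<in> E} s\<bar> \<partial>lborel)"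
      unfolding row_def
    proof (rule slice_lower_bound[OF cfs(1) _ C1_partials(1)[OF C(1)] _ R])
      show "f (s, t) \<noteq> 0 \<Longrightarrow> \<bar>s\<bar> \<le> R" for s using supp[of "(s, t)"] by simp
    qed (use f0 M0 MR slice_in_borel[OF E(1)] \<eta> in auto)
    then show "ennreal (2 * row E t / (row E t + \<eta>)) \<le> (\<integral>\<^sup>+s. ennreal (F1 (s, t)) \<partial>lborel) + ennreal (4 / \<eta>) * (\<integral>\<^sup>+s. ennreal \<bar>f (s, t) - indicator E (s, t)\<bar> \<partial>lborel)"
      by (simp add: F1_def indicator_def)
  qed
  also have "\<dots> = (\<integral>\<^sup>+z. ennreal (F1 z) \<partial>lborel) + ennreal (4 / \<eta>) * ?d"
    using mF md by (simp add: nn_integral_add nn_integral_cmult nn_integral_slice_measurable nn_integral_lborel_snd)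
  finally have A: "?A \<le> (\<integral>\<^sup>+z. ennreal (F1 z) \<partial>lborel) + ennreal (4 / \<eta>) * ?d" .
  have "?B \<le> (\<integral>\<^sup>+s. (\<integral>\<^sup>+t. ennreal (F2 (s, t)) \<partial>lborel) + ennreal (4 / \<eta>) * (\<integral>\<^sup>+t. ennreal \<bar>f (s, t) - indicator E (s, t)\<bar> \<partial>lborel) \<partial>lborel)"
  proof (rule nn_integral_mono)
    fix s
    have "ennreal (2 * col E s / (col E s + \<eta>))
        \<le> (\<integral>\<^sup>+t. ennreal (indicator {t. (s, t) \<in> E} t * (2 * \<eta> / (M2 (s, t) + \<eta>)\<^sup>2 * f (s, t))) \<partial>lborel)
         + ennreal (4 / \<eta>) * (\<integral>\<^sup>+t. ennreal \<bar>f (s, t) - indicator {t. (s, t) \<in> E} t\<bar> \<partial>lborel)"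
      unfolding col_def
    proof (rule slice_lower_bound[OF cfs(2) _ C1_partials(2)[OF C(2)] _ R])
      show "f (s, t) \<noteq> 0 \<Longrightarrow> \<bar>t\<bar> \<le> R" for t using supp[of "(s, t)"] by simp
    qed (use f0 M0 MR slice_in_borel[OF E(1)] \<eta> in auto)
    then show "ennreal (2 * col E s / (col E s + \<eta>)) \<le> (\<integral>\<^sup>+t. ennreal (F2 (s, t)) \<partial>lborel) + ennreal (4 / \<eta>) * (\<integral>\<^sup>+t. ennreal \<bar>f (s, t) - indicator E (s, t)\<bar> \<partial>lborel)"
      by (simp add: F2_def indicator_def)
  qed
  also have "\<dots> = (\<integral>\<^sup>+z. ennreal (F2 z) \<partial>lborel) + ennreal (4 / \<eta>) * ?d"
    using mF md by (simp add: nn_integral_add nn_integral_cmult nn_integral_slice_measurable nn_integral_lborel_fst)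
  finally have B: "?B \<le> (\<integral>\<^sup>+z. ennreal (F2 z) \<partial>lborel) + ennreal (4 / \<eta>) * ?d" .
  have "(\<integral>\<^sup>+z. ennreal (F1 z) \<partial>lborel) + (\<integral>\<^sup>+z. ennreal (F2 z) \<partial>lborel) = (\<integral>\<^sup>+z. ennreal (F1 z + F2 z) \<partial>lborel)"
    using mF F0 by (subst nn_integral_add[symmetric]) simp_all
  also have "\<dots>
      = (\<integral>\<^sup>+z. ennreal (indicator E z * ((2 * \<eta> / (M1 z + \<eta>)\<^sup>2 + 2 * \<eta> / (M2 z + \<eta>)\<^sup>2) * f z)) \<partial>lborel)"
    by (simp add: F1_def F2_def distrib_left distrib_right)
  also have "\<dots> \<le> perimeter1 E" by (rule density_perimeter1[OF D E \<eta>])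
  finally have P: "(\<integral>\<^sup>+z. ennreal (F1 z) \<partial>lborel) + (\<integral>\<^sup>+z. ennreal (F2 z) \<partial>lborel) \<le> perimeter1 E" .
  have "ennreal (4 / \<eta>) + ennreal (4 / \<eta>) = ennreal (8 / \<eta>)" using \<eta> by (simp flip: ennreal_plus)
  then have e: "ennreal (8 / \<eta>) * ?d = ennreal (4 / \<eta>) * ?d + ennreal (4 / \<eta>) * ?d" by (simp only: distrib_right[symmetric])
  have "?A + ?B \<le> ((\<integral>\<^sup>+z. ennreal (F1 z) \<partial>lborel) + ennreal (4 / \<eta>) * ?d) + ((\<integral>\<^sup>+z. ennreal (F2 z) \<partial>lborel) + ennreal (4 / \<eta>) * ?d)"
    by (rule add_mono[OF A B])
  also have "\<dots> = ((\<integral>\<^sup>+z. ennreal (F1 z) \<partial>lborel) + (\<integral>\<^sup>+z. ennreal (F2 z) \<partial>lborel)) + ennreal (8 / \<eta>) * ?d"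
    unfolding e by (simp only: ac_simps)
  also have "\<dots> \<le> perimeter1 E + ennreal (8 / \<eta>) * ?d" by (rule add_right_mono[OF P])
  finally show ?thesis .
qed

section \<open>L1 approximation of sets of finite area by smooth densities\<close>

definition approximable :: "(pt \<Rightarrow> real) \<Rightarrow> bool" where
  "approximable g \<longleftrightarrow> g \<in> borel_measurable borel \<and>
     (\<forall>\<delta>>0. \<exists>R f M1 M2. density R f M1 M2 \<and> (\<integral>\<^sup>+z. ennreal \<bar>f z - g z\<bar> \<partial>lborel) < ennreal \<delta>)"

lemma nn_integral_abs_triangle:
  fixes f g h :: "pt \<Rightarrow> real"
  assumes [measurable]: "f \<in> borel_measurable borel" "g \<in> borel_measurable borel" "h \<in> borel_measurable borel"
  shows "(\<integral>\<^sup>+z. ennreal \<bar>f z - h z\<bar> \<partial>lborel)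
     \<le> (\<integral>\<^sup>+z. ennreal \<bar>f z - g z\<bar> \<partial>lborel) + (\<integral>\<^sup>+z. ennreal \<bar>g z - h z\<bar> \<partial>lborel)"
proof -
  have "(\<integral>\<^sup>+z. ennreal \<bar>f z - h z\<bar> \<partial>lborel) \<le> (\<integral>\<^sup>+z. ennreal \<bar>f z - g z\<bar> + ennreal \<bar>g z - h z\<bar> \<partial>lborel)"
    by (intro nn_integral_mono) (simp flip: ennreal_plus)
  also have "\<dots> = (\<integral>\<^sup>+z. ennreal \<bar>f z - g z\<bar> \<partial>lborel) + (\<integral>\<^sup>+z. ennreal \<bar>g z - h z\<bar> \<partial>lborel)"
    by (rule nn_integral_add) measurable
  finally show ?thesis .
qed

lemma ennreal_half_add:
  assumes "a < ennreal (\<delta> / 2)" "b < ennreal (\<delta> / 2)" "\<delta> > 0"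
  shows "a + b < ennreal \<delta>"
  using assms by (cases a; cases b) (auto simp: ennreal_less_iff simp flip: ennreal_plus)

text \<open>Closedness in L1 is what allows the passage from boxes to bounded sets and from these to
  sets of finite area.\<close>

lemma approximable_limit:
  assumes g: "g \<in> borel_measurable borel"
    and *: "\<And>\<delta>. \<delta> > 0 \<Longrightarrow> \<exists>g'. approximable g' \<and> (\<integral>\<^sup>+z. ennreal \<bar>g' z - g z\<bar> \<partial>lborel) < ennreal \<delta>"
  shows "approximable g"
  unfolding approximable_def
proof (intro conjI allI impI g)
  fix \<delta> :: real assume \<delta>: "\<delta> > 0"
  then have \<delta>2: "\<delta> / 2 > 0" by simp
  obtain g' where g': "approximable g'" "(\<integral>\<^sup>+z. ennreal \<bar>g' z - g z\<bar> \<partial>lborel) < ennreal (\<delta> / 2)"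
    using *[OF \<delta>2] by blast
  then obtain R f M1 M2 where f: "density R f M1 M2" "(\<integral>\<^sup>+z. ennreal \<bar>f z - g' z\<bar> \<partial>lborel) < ennreal (\<delta> / 2)"
    unfolding approximable_def using \<delta>2 by blast
  have "(\<integral>\<^sup>+z. ennreal \<bar>f z - g z\<bar> \<partial>lborel) < ennreal \<delta>"
    by (rule le_less_trans[OF nn_integral_abs_triangle[of f g' g] ennreal_half_add[OF f(2) g'(2) \<delta>]])
       (use density_measurable[OF f(1)] g g'(1) in \<open>auto simp: approximable_def\<close>)
  with f(1) show "\<exists>R f M1 M2. density R f M1 M2 \<and> (\<integral>\<^sup>+z. ennreal \<bar>f z - g z\<bar> \<partial>lborel) < ennreal \<delta>"
    by blast
qed

lemma approximable_zero: "approximable (\<lambda>_. 0)"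
  unfolding approximable_def using density_zero by (intro conjI allI impI exI[of _ 1] exI[of _ "\<lambda>_. 0"]) auto

lemma approximable_add:
  assumes "approximable g" "approximable h"
  shows "approximable (\<lambda>z. g z + h z)"
  unfolding approximable_def
proof (intro conjI allI impI)
  have m: "g \<in> borel_measurable borel" "h \<in> borel_measurable borel"
    using assms by (auto simp: approximable_def)
  then show "(\<lambda>z. g z + h z) \<in> borel_measurable borel" by measurable
  fix \<delta> :: real assume \<delta>: "\<delta> > 0"
  then have \<delta>2: "\<delta> / 2 > 0" by simp
  obtain R f M1 M2 where f: "density R f M1 M2" "(\<integral>\<^sup>+z. ennreal \<bar>f z - g z\<bar> \<partial>lborel) < ennreal (\<delta> / 2)"
    using assms(1) \<delta>2 unfolding approximable_def by blast
  obtain R' f' M1' M2' where f': "density R' f' M1' M2'" "(\<integral>\<^sup>+z. ennreal \<bar>f' z - h z\<bar> \<partial>lborel) < ennreal (\<delta> / 2)"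
    using assms(2) \<delta>2 unfolding approximable_def by blast
  have mf: "f \<in> borel_measurable borel" "f' \<in> borel_measurable borel"
    using density_measurable f(1) f'(1) by blast+
  have "(\<integral>\<^sup>+z. ennreal \<bar>f z + f' z - (g z + h z)\<bar> \<partial>lborel)
      \<le> (\<integral>\<^sup>+z. ennreal \<bar>f z - g z\<bar> + ennreal \<bar>f' z - h z\<bar> \<partial>lborel)"
    by (intro nn_integral_mono) (simp flip: ennreal_plus)
  also have "\<dots> = (\<integral>\<^sup>+z. ennreal \<bar>f z - g z\<bar> \<partial>lborel) + (\<integral>\<^sup>+z. ennreal \<bar>f' z - h z\<bar> \<partial>lborel)"
    using m mf by (intro nn_integral_add) auto
  also have "\<dots> < ennreal \<delta>" by (rule ennreal_half_add[OF f(2) f'(2) \<delta>])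
  finally show "\<exists>R f M1 M2. density R f M1 M2 \<and> (\<integral>\<^sup>+z. ennreal \<bar>f z - (g z + h z)\<bar> \<partial>lborel) < ennreal \<delta>"
    using density_add[OF f(1) f'(1)] by blast
qed

lemma approximable_sum:
  assumes "finite F" "\<And>K. K \<in> F \<Longrightarrow> approximable (g K)"
  shows "approximable (\<lambda>z. \<Sum>K\<in>F. g K z)"
  using assms by (induction F) (auto intro: approximable_zero approximable_add)

text \<open>Starting the first step at \<open>l - h\<close> makes the bump exactly 1 on the closed
  interval, and every point outside leaves the support [l - h, r + h] once \<open>h\<close> is
  small. So the values are eventually constant, endpoints included.\<close>

lemma bump_tendsto_indicator:
  assumes "l \<le> r"
  shows "(\<lambda>n. bump (1 / real (Suc n)) (l - 1 / real (Suc n)) r t) \<longlonglongrightarrow> indicator {l..r} t"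
proof (rule tendsto_eventually)
  consider "t < l" | "l \<le> t" "t \<le> r" | "r < t" by linarith
  then show "\<forall>\<^sub>F n in sequentially. bump (1 / real (Suc n)) (l - 1 / real (Suc n)) r t = indicator {l..r} t"
  proof cases
    case 1
    then obtain n0 where "inverse (real (Suc n0)) < l - t" using reals_Archimedean[of "l - t"] by auto
    then have n0: "1 / real (Suc n0) < l - t" by (simp add: inverse_eq_divide)
    show ?thesis
    proof (intro eventually_sequentiallyI[of n0])
      fix n assume "n0 \<le> n"
      then have "1 / real (Suc n) \<le> 1 / real (Suc n0)" by (intro divide_left_mono) auto
      with n0 have "t \<le> l - 1 / real (Suc n)" by linarith
      moreover have "l - 1 / real (Suc n) \<le> r" using assms zero_le_divide_1_iff[of "real (Suc n)"] by linarith
      ultimately show "bump (1 / real (Suc n)) (l - 1 / real (Suc n)) r t = indicator {l..r} t"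
        using 1 by (subst bump_eq_0(1)) auto
    qed
  next
    case 2
    then have "bump h (l - h) r t = 1" if "h > 0" for h
      using that by (simp add: bump_def step_ge_1 step_le_0 divide_le_0_iff field_simps)
    then show ?thesis using 2 by (auto simp: indicator_def)
  next
    case 3
    then obtain n0 where "inverse (real (Suc n0)) < t - r" using reals_Archimedean[of "t - r"] by auto
    then have n0: "1 / real (Suc n0) < t - r" by (simp add: inverse_eq_divide)
    show ?thesis
    proof (intro eventually_sequentiallyI[of n0])
      fix n assume "n0 \<le> n"
      then have "1 / real (Suc n) \<le> 1 / real (Suc n0)" by (intro divide_left_mono) auto
      with n0 have "t \<ge> r + 1 / real (Suc n)" by linarith
      moreover have "l - 1 / real (Suc n) \<le> r" using assms zero_le_divide_1_iff[of "real (Suc n)"] by linarith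
      ultimately show "bump (1 / real (Suc n)) (l - 1 / real (Suc n)) r t = indicator {l..r} t"
        using 3 by (subst bump_eq_0(1)) auto
    qed
  qed
qed

lemma approximable_cbox: "approximable (indicator (cbox (l1, l2) (r1, r2)))"
proof (cases "l1 \<le> r1 \<and> l2 \<le> r2")
  case False
  then have "cbox (l1, l2) (r1, r2) = {}" by (auto simp: cbox_Pair_eq)
  then have "indicator (cbox (l1, l2) (r1, r2)) = (\<lambda>_. 0 :: real)" by (simp add: fun_eq_iff)
  then show ?thesis using approximable_zero by metis
next
  case True
  show ?thesis unfolding approximable_def
  proof (intro conjI allI impI)
    fix \<delta> :: real assume \<delta>: "\<delta> > 0"
    define h where "h n = 1 / real (Suc n)" for n
    define f where "f n z = bump (h n) (l1 - h n) r1 (fst z) * bump (h n) (l2 - h n) r2 (snd z)" for n and z :: pt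
    have h: "h n > 0" "h n \<le> 1" for n by (simp_all add: h_def)
    have lr: "l1 - h n \<le> r1" "l2 - h n \<le> r2" for n using True h(1)[of n] by auto
    have dens: "\<exists>R M1 M2. density R (f n) M1 M2" for n
      using density_box[OF h(1) lr] unfolding f_def[abs_def] by blast
    have mf: "f n \<in> borel_measurable borel" for n using dens density_measurable by blast
    have "(\<lambda>n. \<integral>\<^sup>+z. ennreal \<bar>f n z - indicator (cbox (l1, l2) (r1, r2)) z\<bar> \<partial>lborel) \<longlonglongrightarrow> (\<integral>\<^sup>+(z::pt). 0 \<partial>lborel)"
    \<comment> \<open>Since \<open>h n \<le> 1\<close>, all supports lie in the box enlarged by 1,
      whose indicator is an integrable majorant.\<close>
    proof (rule nn_integral_dominated_convergence[where w = "\<lambda>z. indicator (cbox (l1 - 1, l2 - 1) (r1 + 1, r2 + 1)) z"])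
      show "(\<lambda>z. ennreal \<bar>f n z - indicator (cbox (l1, l2) (r1, r2)) z\<bar>) \<in> borel_measurable lborel" for n
        using mf[of n] by measurable
      show "(\<integral>\<^sup>+z. indicator (cbox (l1 - 1, l2 - 1) (r1 + 1, r2 + 1)) z \<partial>(lborel :: pt measure)) < \<infinity>"
        using emeasure_bounded_finite[OF bounded_cbox[of "(l1 - 1, l2 - 1)" "(r1 + 1, r2 + 1)"]] by simp
      show "AE z in lborel. ennreal \<bar>f n z - indicator (cbox (l1, l2) (r1, r2)) z\<bar>
          \<le> indicator (cbox (l1 - 1, l2 - 1) (r1 + 1, r2 + 1)) z" for n
      proof (rule AE_I2)
        fix z :: pt
        obtain s t where z: "z = (s, t)" by (cases z)
        show "ennreal \<bar>f n z - indicator (cbox (l1, l2) (r1, r2)) z\<bar> \<le> indicator (cbox (l1 - 1, l2 - 1) (r1 + 1, r2 + 1)) z"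
        proof (cases "z \<in> cbox (l1 - 1, l2 - 1) (r1 + 1, r2 + 1)")
          case True
          have "0 \<le> f n z" "f n z \<le> 1"
            unfolding f_def using bump_bounds[OF h(1) lr(1)] bump_bounds[OF h(1) lr(2)] by (auto intro: mult_le_one)
          then have "\<bar>f n z - indicator (cbox (l1, l2) (r1, r2)) z\<bar> \<le> 1" by (auto simp: indicator_def)
          then show ?thesis using True by simp
        next
          case False
          then have "s < l1 - 1 \<or> s > r1 + 1 \<or> t < l2 - 1 \<or> t > r2 + 1" by (auto simp: z cbox_Pair_eq)
          then have "s \<le> l1 - h n \<or> s \<ge> r1 + h n \<or> t \<le> l2 - h n \<or> t \<ge> r2 + h n" using h(2)[of n] by linarith
          then have "f n z = 0"
            unfolding f_def z using bump_eq_0(1)[OF h(1) lr(1)] bump_eq_0(1)[OF h(1) lr(2)] by auto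
          moreover have "z \<notin> cbox (l1, l2) (r1, r2)" using False by (auto simp: z cbox_Pair_eq)
          ultimately show ?thesis by simp
        qed
      qed
      show "AE z in lborel. (\<lambda>n. ennreal \<bar>f n z - indicator (cbox (l1, l2) (r1, r2)) z\<bar>) \<longlonglongrightarrow> 0"
      proof (rule AE_I2)
        fix z :: pt
        have "(\<lambda>n. f n z) \<longlonglongrightarrow> indicator {l1..r1} (fst z) * indicator {l2..r2} (snd z)"
          unfolding f_def h_def using True by (intro tendsto_mult bump_tendsto_indicator) auto
        also have "indicator {l1..r1} (fst z) * indicator {l2..r2} (snd z) = (indicator (cbox (l1, l2) (r1, r2)) z :: real)"
          by (cases z) (auto simp: indicator_def cbox_Pair_eq)
        finally have "(\<lambda>n. \<bar>f n z - indicator (cbox (l1, l2) (r1, r2)) z\<bar>) \<longlonglongrightarrow> 0"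
          by (simp add: tendsto_rabs_zero LIM_zero)
        then show "(\<lambda>n. ennreal \<bar>f n z - indicator (cbox (l1, l2) (r1, r2)) z\<bar>) \<longlonglongrightarrow> 0"
          using tendsto_ennrealI by fastforce
      qed
    qed auto
    then have "(\<lambda>n. \<integral>\<^sup>+z. ennreal \<bar>f n z - indicator (cbox (l1, l2) (r1, r2)) z\<bar> \<partial>lborel) \<longlonglongrightarrow> 0" by simp
    then have "\<forall>\<^sub>F n in sequentially. (\<integral>\<^sup>+z. ennreal \<bar>f n z - indicator (cbox (l1, l2) (r1, r2)) z\<bar> \<partial>lborel) < ennreal \<delta>"
      by (rule order_tendstoD) (use \<delta> in simp)
    then obtain n where "(\<integral>\<^sup>+z. ennreal \<bar>f n z - indicator (cbox (l1, l2) (r1, r2)) z\<bar> \<partial>lborel) < ennreal \<delta>"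
      unfolding eventually_sequentially by blast
    then show "\<exists>R f M1 M2. density R f M1 M2 \<and> (\<integral>\<^sup>+z. ennreal \<bar>f z - indicator (cbox (l1, l2) (r1, r2)) z\<bar> \<partial>lborel) < ennreal \<delta>"
      using dens[of n] by blast
  qed simp
qed


lemma frontier_cbox_null: "frontier (cbox a (b::pt)) \<in> null_sets lborel"
proof -
  have "frontier (cbox a b) \<in> null_sets (completion lborel)"
    using negligible_convex_frontier[OF convex_box(1)] by (simp add: negligible_iff_null_sets)
  then show ?thesis by (subst (asm) null_sets_completion_iff) (auto simp: borel_closed)
qed

text \<open>Boxes with disjoint interiors can share only frontier points, and the frontiers are
  null.\<close>

lemma sum_indicator_nonoverlapping:
  assumes "finite F" "\<And>K. K \<in> F \<Longrightarrow> \<exists>c d. K = cbox c (d::pt)"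
    and "pairwise (\<lambda>A B. interior A \<inter> interior B = {}) F"
  shows "AE z in lborel. (\<Sum>K\<in>F. indicator K z) = (indicator (\<Union>F) z :: real)"
proof -
  have "(\<Union>K\<in>F. frontier K) \<in> null_sets lborel"
  proof (rule null_sets_UN')
    show "countable F" using assms(1) by (rule countable_finite)
    show "frontier K \<in> null_sets lborel" if "K \<in> F" for K
      using assms(2)[OF that] frontier_cbox_null by blast
  qed
  then have "AE z in lborel. z \<notin> (\<Union>K\<in>F. frontier K)" by (rule AE_not_in)
  then show ?thesis
  proof (rule AE_mp, intro AE_I2 impI)
    fix z assume z: "z \<notin> (\<Union>K\<in>F. frontier K)"
    have int: "z \<in> interior K" if "K \<in> F" "z \<in> K" for K
      using z that closure_subset unfolding frontier_def by blast
    show "(\<Sum>K\<in>F. indicator K z) = (indicator (\<Union>F) z :: real)"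
    proof (cases "\<exists>K\<in>F. z \<in> K")
      case True
      then obtain K where K: "K \<in> F" "z \<in> K" by blast
      have "z \<notin> K'" if "K' \<in> F" "K' \<noteq> K" for K'
        using assms(3) int[OF K] int[OF that(1)] that K unfolding pairwise_def by blast
      then have "(\<Sum>K\<in>F. indicator K z) = (\<Sum>K'\<in>F. if K' = K then 1 else 0 :: real)"
        using K by (intro sum.cong) auto
      then show ?thesis using K assms(1) by (auto simp: indicator_def)
    qed auto
  qed
qed

lemma emeasure_Diff_real:
  fixes A B :: "'a::euclidean_space set"
  assumes "A \<in> sets borel" "B \<in> sets borel" "A \<subseteq> B" "emeasure lborel B < \<infinity>"
  shows "emeasure lborel (B - A) = ennreal (measure lborel B - measure lborel A)"
proof -
  have "emeasure lborel (B - A) \<le> emeasure lborel B" "emeasure lborel A \<le> emeasure lborel B"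
    using assms by (auto intro!: emeasure_mono)
  then have "emeasure lborel (B - A) \<noteq> \<infinity>" "emeasure lborel A \<noteq> \<infinity>" "emeasure lborel B \<noteq> \<infinity>"
    using assms(4) by (auto simp: top_unique)
  then show ?thesis
    using measure_Diff[of lborel B A] assms by (simp add: emeasure_eq_ennreal_measure)
qed

text \<open>Outer approximation covers \<open>E\<close> by countably many nonoverlapping boxes with
  excess at most \<delta>/3, and finitely many of them carry all but \<delta>/3 of the covered area.
  The finite sum of box indicators is thus within 2 \<delta>/3 of the indicator of
  \<open>E\<close>.\<close>

lemma approximable_bounded:
  assumes E: "E \<in> sets borel" "E \<subseteq> cbox a b"
  shows "approximable (indicator E)"
proof (rule approximable_limit)
  show "indicator E \<in> borel_measurable borel" using E by simp
  fix \<delta> :: real assume \<delta>: "\<delta> > 0"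
  have E': "E \<in> lmeasurable"
    using E bounded_subset[OF bounded_cbox E(2)] by (intro bounded_set_imp_lmeasurable) auto
  have "\<delta> / 3 > 0" using \<delta> by simp
  from measurable_outer_intervals_bounded[OF E' E(2) this]
  obtain D where D: "countable D" "\<And>K. K \<in> D \<Longrightarrow> K \<subseteq> cbox a b \<and> K \<noteq> {} \<and> (\<exists>c d. K = cbox c d)"
      "pairwise (\<lambda>A B. interior A \<inter> interior B = {}) D"
      "E \<subseteq> \<Union>D" "\<Union>D \<in> lmeasurable" "measure lebesgue (\<Union>D) \<le> measure lebesgue E + \<delta> / 3" by metis
  have lm: "d \<in> lmeasurable" if "d \<in> D" for d using D(2)[OF that] by auto
  have "measure lebesgue (\<Union>D') \<le> measure lebesgue (\<Union>D)" if "D' \<subseteq> D" "finite D'" for D'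
    using D(5) that lm by (intro measure_mono_fmeasurable) auto
  from measure_countable_Union_approachable[OF D(1) \<open>\<delta> / 3 > 0\<close> lm this]
  obtain F where F: "F \<subseteq> D" "finite F" "measure lebesgue (\<Union>D) - \<delta> / 3 < measure lebesgue (\<Union>F)" by metis
  have F2: "\<exists>c d. K = cbox c d" if "K \<in> F" for K using D(2) F(1) that by blast
  have "K \<in> sets borel" if "K \<in> D" for K using D(2)[OF that] by (metis borel_closed closed_cbox)
  then have bD: "\<Union>D \<in> sets borel" "\<Union>F \<in> sets borel"
    using D(1) F(1,2) by (auto intro!: sets.countable_Union countable_finite)
  have m: "measure lebesgue X = measure lborel X" if "X \<in> sets borel" for X :: "pt set"
    using that by (simp add: measure_completion)
  have fin: "emeasure lborel (\<Union>D) < \<infinity>" using D(5) bD by (simp add: fmeasurable_def)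
  let ?g = "\<lambda>z. \<Sum>K\<in>F. indicator K z :: real"
  have "approximable ?g"
    using F(2) F2 approximable_cbox by (intro approximable_sum) (metis surj_pair)+
  moreover have "(\<integral>\<^sup>+z. ennreal \<bar>?g z - indicator E z\<bar> \<partial>lborel) < ennreal \<delta>"
  proof -
    have "AE z in lborel. ?g z = indicator (\<Union>F) z"
      using F D(3) F2 by (intro sum_indicator_nonoverlapping) (auto intro: pairwise_subset)
    then have "(\<integral>\<^sup>+z. ennreal \<bar>?g z - indicator E z\<bar> \<partial>lborel) = (\<integral>\<^sup>+z. ennreal \<bar>indicator (\<Union>F) z - indicator E z\<bar> \<partial>lborel)"
      by (intro nn_integral_cong_AE) auto
    also have "\<dots> \<le> (\<integral>\<^sup>+z. indicator (\<Union>D - \<Union>F) z + indicator (\<Union>D - E) z \<partial>lborel)"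
      using F(1) D(4) by (intro nn_integral_mono) (auto simp: indicator_def)
    also have "\<dots> = emeasure lborel (\<Union>D - \<Union>F) + emeasure lborel (\<Union>D - E)"
      using bD E by (subst nn_integral_add) auto
    also have "emeasure lborel (\<Union>D - \<Union>F) = ennreal (measure lborel (\<Union>D) - measure lborel (\<Union>F))"
      using F(1) bD fin by (intro emeasure_Diff_real) auto
    also have "emeasure lborel (\<Union>D - E) = ennreal (measure lborel (\<Union>D) - measure lborel E)"
      using D(4) bD fin E by (intro emeasure_Diff_real) auto
    also have "ennreal (measure lborel (\<Union>D) - measure lborel (\<Union>F)) + ennreal (measure lborel (\<Union>D) - measure lborel E)
        \<le> ennreal (\<delta> / 3) + ennreal (\<delta> / 3)"
      using F(3) D(6) bD E by (intro add_mono ennreal_leI) (auto simp: m)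
    also have "\<dots> < ennreal \<delta>" using \<delta> by (simp add: ennreal_less_iff flip: ennreal_plus)
    finally show ?thesis .
  qed
  ultimately show "\<exists>g'. approximable g' \<and> (\<integral>\<^sup>+z. ennreal \<bar>g' z - indicator E z\<bar> \<partial>lborel) < ennreal \<delta>" by blast
qed

lemma approximable_finite_measure:
  assumes E: "E \<in> sets borel" "emeasure lborel E < \<infinity>"
  shows "approximable (indicator E)"
proof (rule approximable_limit)
  show "indicator E \<in> borel_measurable borel" using E by simp
  fix \<delta> :: real assume \<delta>: "\<delta> > 0"
  define C :: "nat \<Rightarrow> pt set" where "C n = cbox (- real n, - real n) (real n, real n)" for n
  have "(\<lambda>n. \<integral>\<^sup>+z. ennreal \<bar>indicator (E \<inter> C n) z - indicator E z\<bar> \<partial>lborel) \<longlonglongrightarrow> (\<integral>\<^sup>+(z::pt). 0 \<partial>lborel)"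
  proof (rule nn_integral_dominated_convergence[where w = "indicator E"])
    show "(\<lambda>z. ennreal \<bar>indicator (E \<inter> C n) z - indicator E z\<bar>) \<in> borel_measurable lborel" for n
    proof -
      have "C n \<in> sets borel" by (simp add: C_def)
      with E show ?thesis by measurable
    qed
    show "AE z in lborel. (\<lambda>n. ennreal \<bar>indicator (E \<inter> C n) z - indicator E z\<bar>) \<longlonglongrightarrow> 0"
    proof (rule AE_I2, rule tendsto_eventually)
      fix z :: pt
      obtain n0 :: nat where n0: "\<bar>fst z\<bar> + \<bar>snd z\<bar> < real n0" using reals_Archimedean2 by blast
      show "\<forall>\<^sub>F n in sequentially. ennreal \<bar>indicator (E \<inter> C n) z - indicator E z\<bar> = 0"
      proof (rule eventually_sequentiallyI[of n0])
        fix n assume "n0 \<le> n"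
        then have "real n0 \<le> real n" by simp
        then have "z \<in> C n" unfolding C_def using n0 by (cases z) (auto simp: cbox_Pair_eq)
        then show "ennreal \<bar>indicator (E \<inter> C n) z - indicator E z\<bar> = 0" by (simp add: indicator_def)
      qed
    qed
    show "(\<integral>\<^sup>+z. indicator E z \<partial>lborel) < \<infinity>" using E by simp
    show "AE z in lborel. ennreal \<bar>indicator (E \<inter> C n) z - indicator E z\<bar> \<le> indicator E z" for n
      by (auto simp: indicator_def)
  qed (use E in auto)
  then have "(\<lambda>n. \<integral>\<^sup>+z. ennreal \<bar>indicator (E \<inter> C n) z - indicator E z\<bar> \<partial>lborel) \<longlonglongrightarrow> 0" by simp
  then have "\<forall>\<^sub>F n in sequentially. (\<integral>\<^sup>+z. ennreal \<bar>indicator (E \<inter> C n) z - indicator E z\<bar> \<partial>lborel) < ennreal \<delta>"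
    by (rule order_tendstoD) (use \<delta> in simp)
  then obtain n where "(\<integral>\<^sup>+z. ennreal \<bar>indicator (E \<inter> C n) z - indicator E z\<bar> \<partial>lborel) < ennreal \<delta>"
    unfolding eventually_sequentially by blast
  moreover have "approximable (indicator (E \<inter> C n))"
    by (rule approximable_bounded) (use E in \<open>auto simp: C_def\<close>)
  ultimately show "\<exists>g'. approximable g' \<and> (\<integral>\<^sup>+z. ennreal \<bar>g' z - indicator E z\<bar> \<partial>lborel) < ennreal \<delta>" by blast
qed

section \<open>From saturated slices to essential projections\<close>

lemma saturated_slices_le_perimeter1:
  assumes E: "E \<in> sets borel" "emeasure lborel E < \<infinity>" and \<eta>: "\<eta> > 0"
  shows "(\<integral>\<^sup>+t. ennreal (2 * row E t / (row E t + \<eta>)) \<partial>lborel)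
       + (\<integral>\<^sup>+s. ennreal (2 * col E s / (col E s + \<eta>)) \<partial>lborel) \<le> perimeter1 E"
proof (rule ennreal_le_epsilon)
  fix e :: real assume e: "0 < e"
  \<comment> \<open>The tolerance is chosen so that the factor \<open>8 / \<eta>\<close> of
    \<open>density_slices\<close> turns it into \<open>e\<close>; \<open>\<eta>\<close> stays fixed
    while the density improves.\<close>
  then have "e * \<eta> / 8 > 0" using \<eta> by simp
  then obtain R f M1 M2 where f: "density R f M1 M2" "(\<integral>\<^sup>+z. ennreal \<bar>f z - indicator E z\<bar> \<partial>lborel) < ennreal (e * \<eta> / 8)"
    using approximable_finite_measure[OF E] unfolding approximable_def by blast
  have "(\<integral>\<^sup>+t. ennreal (2 * row E t / (row E t + \<eta>)) \<partial>lborel)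
       + (\<integral>\<^sup>+s. ennreal (2 * col E s / (col E s + \<eta>)) \<partial>lborel)
     \<le> perimeter1 E + ennreal (8 / \<eta>) * (\<integral>\<^sup>+z. ennreal \<bar>f z - indicator E z\<bar> \<partial>lborel)"
    by (rule density_slices[OF f(1) E \<eta>])
  also have "\<dots> \<le> perimeter1 E + ennreal (8 / \<eta>) * ennreal (e * \<eta> / 8)"
    by (intro add_left_mono mult_left_mono less_imp_le[OF f(2)]) simp
  also have "ennreal (8 / \<eta>) * ennreal (e * \<eta> / 8) = ennreal e"
    using \<eta> e by (simp flip: ennreal_mult)
  finally show "(\<integral>\<^sup>+t. ennreal (2 * row E t / (row E t + \<eta>)) \<partial>lborel)
       + (\<integral>\<^sup>+s. ennreal (2 * col E s / (col E s + \<eta>)) \<partial>lborel) \<le> perimeter1 E + ennreal e" .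
qed

text \<open>As the saturation parameter decreases to 0 the integrands increase to 2 on slices of
  positive length and remain 0 elsewhere, so monotone convergence applies even if the limit is
  infinite.\<close>

lemma saturation_limit:
  assumes m: "m \<in> borel_measurable borel" and m0: "\<And>t. 0 \<le> m t"
  shows "(\<lambda>n. \<integral>\<^sup>+t. ennreal (2 * m t / (m t + 1 / real (Suc n))) \<partial>lborel)
     \<longlonglongrightarrow> 2 * emeasure lborel {t::real. 0 < m t}"
proof -
  have S: "{t. 0 < m t} \<in> sets borel" using m by measurable
  have "(\<lambda>n. \<integral>\<^sup>+t. ennreal (2 * m t / (m t + 1 / real (Suc n))) \<partial>lborel)
     \<longlonglongrightarrow> (\<integral>\<^sup>+t. 2 * indicator {t. 0 < m t} t \<partial>lborel)"
  proof (rule nn_integral_LIMSEQ)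
    show "incseq (\<lambda>n t. ennreal (2 * m t / (m t + 1 / real (Suc n))))"
    proof (intro incseq_SucI le_funI ennreal_leI)
      fix n t
      show "2 * m t / (m t + 1 / real (Suc n)) \<le> 2 * m t / (m t + 1 / real (Suc (Suc n)))"
        using m0[of t] by (intro divide_left_mono add_left_mono mult_pos_pos add_nonneg_pos) (auto simp: divide_simps)
    qed
    show "(\<lambda>t. ennreal (2 * m t / (m t + 1 / real (Suc n)))) \<in> borel_measurable lborel" for n
      using m by measurable
    fix t
    show "(\<lambda>n. ennreal (2 * m t / (m t + 1 / real (Suc n)))) \<longlonglongrightarrow> 2 * indicator {t. 0 < m t} t"
    proof (cases "m t = 0")
      case False
      have "(\<lambda>n. 1 / real (Suc n)) \<longlonglongrightarrow> 0" by (rule LIMSEQ_Suc[OF lim_1_over_n])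
      then have "(\<lambda>n. 2 * m t / (m t + 1 / real (Suc n))) \<longlonglongrightarrow> 2 * m t / (m t + 0)"
        using False by (intro tendsto_intros) auto
      then have "(\<lambda>n. ennreal (2 * m t / (m t + 1 / real (Suc n)))) \<longlonglongrightarrow> ennreal 2"
        using False by (intro tendsto_ennrealI) simp
      moreover have "0 < m t" using False m0[of t] by simp
      ultimately show ?thesis by simp
    qed simp
  qed
  also have "(\<integral>\<^sup>+t. 2 * indicator {t. 0 < m t} t \<partial>lborel) = 2 * emeasure lborel {t. 0 < m t}"
    using S by (subst nn_integral_cmult) auto
  finally show ?thesis .
qed

lemma projections_le_perimeter1:
  assumes E: "E \<in> sets borel" "emeasure lborel E < \<infinity>"
  shows "2 * emeasure lborel {t. 0 < row E t} + 2 * emeasure lborel {s. 0 < col E s} \<le> perimeter1 E"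
proof (rule LIMSEQ_le_const2)
  show "(\<lambda>n. (\<integral>\<^sup>+t. ennreal (2 * row E t / (row E t + 1 / real (Suc n))) \<partial>lborel)
      + (\<integral>\<^sup>+s. ennreal (2 * col E s / (col E s + 1 / real (Suc n))) \<partial>lborel))
    \<longlonglongrightarrow> 2 * emeasure lborel {t. 0 < row E t} + 2 * emeasure lborel {s. 0 < col E s}"
    by (intro tendsto_add saturation_limit measurable_row_col E row_col_nonneg)
  show "\<exists>N. \<forall>n\<ge>N. (\<integral>\<^sup>+t. ennreal (2 * row E t / (row E t + 1 / real (Suc n))) \<partial>lborel)
      + (\<integral>\<^sup>+s. ennreal (2 * col E s / (col E s + 1 / real (Suc n))) \<partial>lborel) \<le> perimeter1 E"
    using saturated_slices_le_perimeter1[OF E] by simp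
qed

text \<open>By Fubini, the part of \<open>E\<close> lying over columns or rows of zero length is
  null. This is what places \<open>E\<close> inside the product of its essential
  projections.\<close>

lemma AE_in_projections:
  assumes E: "E \<in> sets borel" "emeasure lborel E < \<infinity>"
  shows "AE z in lborel. z \<in> E \<longrightarrow> 0 < col E (fst z) \<and> 0 < row E (snd z)"
proof -
  define X where "X = {z \<in> E. \<not> 0 < col E (fst z)}"
  define Y where "Y = {z \<in> E. \<not> 0 < row E (snd z)}"
  note [measurable] = measurable_row_col[OF E(1)] E(1)
  have [measurable]: "(fst :: pt \<Rightarrow> real) \<in> borel_measurable borel" "(snd :: pt \<Rightarrow> real) \<in> borel_measurable borel"
    by (auto intro!: borel_measurable_continuous_onI continuous_intros)
  have XY: "X \<in> sets borel" "Y \<in> sets borel" unfolding X_def Y_def by measurable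
  have i: "(indicator E :: pt \<Rightarrow> ennreal) \<in> borel_measurable borel"
    "(indicator X :: pt \<Rightarrow> ennreal) \<in> borel_measurable borel" "(indicator Y :: pt \<Rightarrow> ennreal) \<in> borel_measurable borel"
    using E XY by auto
  note sl = nn_integral_indicator_slice[OF E(1)]
  have "(\<integral>\<^sup>+s. \<integral>\<^sup>+t. indicator E (s, t) \<partial>lborel \<partial>lborel) < \<infinity>" "(\<integral>\<^sup>+t. \<integral>\<^sup>+s. indicator E (s, t) \<partial>lborel \<partial>lborel) < \<infinity>"
    using E nn_integral_lborel_fst[OF i(1)] nn_integral_lborel_snd[OF i(1)] by auto
  then have n: "(\<integral>\<^sup>+s. emeasure lborel {t. (s, t) \<in> E} \<partial>lborel) \<noteq> \<infinity>" "(\<integral>\<^sup>+t. emeasure lborel {s. (s, t) \<in> E} \<partial>lborel) \<noteq> \<infinity>"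
    unfolding sl by auto
  have m: "(\<lambda>s. emeasure lborel {t. (s, t) \<in> E}) \<in> borel_measurable lborel" "(\<lambda>t. emeasure lborel {s. (s, t) \<in> E}) \<in> borel_measurable lborel"
    using nn_integral_slice_measurable[OF i(1)] unfolding sl by simp_all
  \<comment> \<open>Almost every slice is finite, so for those a value 0 of \<open>col\<close> or
    \<open>row\<close> really means a null slice and is not the default value of
    \<open>measure\<close>.\<close>
  have fin: "AE s in lborel. emeasure lborel {t. (s, t) \<in> E} \<noteq> \<infinity>" "AE t in lborel. emeasure lborel {s. (s, t) \<in> E} \<noteq> \<infinity>"
    by (rule nn_integral_PInf_AE[OF m(1) n(1)], rule nn_integral_PInf_AE[OF m(2) n(2)])
  have "emeasure lborel X = (\<integral>\<^sup>+s. \<integral>\<^sup>+t. indicator X (s, t) \<partial>lborel \<partial>lborel)"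
    using nn_integral_lborel_fst[OF i(2)] XY by simp
  also have "\<dots> = (\<integral>\<^sup>+(s::real). 0 \<partial>lborel)"
  proof (rule nn_integral_cong_AE, use fin(1) in eventually_elim)
    fix s assume s: "emeasure lborel {t. (s, t) \<in> E} \<noteq> \<infinity>"
    show "(\<integral>\<^sup>+t. indicator X (s, t) \<partial>lborel) = 0"
    proof (cases "0 < col E s")
      case True then show ?thesis by (simp add: X_def)
    next
      case False
      have "(\<integral>\<^sup>+t. indicator X (s, t) \<partial>lborel) \<le> (\<integral>\<^sup>+t. indicator E (s, t) \<partial>lborel)"
        by (intro nn_integral_mono) (auto simp: X_def indicator_def)
      also have "\<dots> = ennreal (col E s)" unfolding sl col_def using s by (simp add: emeasure_eq_ennreal_measure)
      also have "\<dots> = 0" using False row_col_nonneg(2)[of E s] by (simp add: ennreal_eq_0_iff)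
      finally show ?thesis by simp
    qed
  qed
  finally have X0: "X \<in> null_sets lborel" using XY by auto
  have "emeasure lborel Y = (\<integral>\<^sup>+t. \<integral>\<^sup>+s. indicator Y (s, t) \<partial>lborel \<partial>lborel)"
    using nn_integral_lborel_snd[OF i(3)] XY by simp
  also have "\<dots> = (\<integral>\<^sup>+(t::real). 0 \<partial>lborel)"
  proof (rule nn_integral_cong_AE, use fin(2) in eventually_elim)
    fix t assume t: "emeasure lborel {s. (s, t) \<in> E} \<noteq> \<infinity>"
    show "(\<integral>\<^sup>+s. indicator Y (s, t) \<partial>lborel) = 0"
    proof (cases "0 < row E t")
      case True then show ?thesis by (simp add: Y_def)
    next
      case False
      have "(\<integral>\<^sup>+s. indicator Y (s, t) \<partial>lborel) \<le> (\<integral>\<^sup>+s. indicator E (s, t) \<partial>lborel)"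
        by (intro nn_integral_mono) (auto simp: Y_def indicator_def)
      also have "\<dots> = ennreal (row E t)" unfolding sl row_def using t by (simp add: emeasure_eq_ennreal_measure)
      also have "\<dots> = 0" using False row_col_nonneg(1)[of E t] by (simp add: ennreal_eq_0_iff)
      finally show ?thesis by simp
    qed
  qed
  finally have Y0: "Y \<in> null_sets lborel" using XY by auto
  from AE_not_in[OF X0] AE_not_in[OF Y0] show ?thesis
    by eventually_elim (auto simp: X_def Y_def)
qed

section \<open>The perimeter of rectangles and the signed distance to a rectangle\<close>

lemma rect_eq_cbox: "rect a b = cbox (- a / 2, - b / 2) (a / 2, b / 2)"
  by (simp add: rect_def cbox_Pair_eq)

lemma rect_in_borel [measurable]: "rect a b \<in> sets borel"
  by (simp add: rect_eq_cbox)

lemma rect_in_lebesgue [simp]: "rect a b \<in> sets lebesgue"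
  by (simp add: rect_eq_cbox)

lemma emeasure_rect:
  assumes "0 \<le> a" "0 \<le> b"
  shows "emeasure lborel (rect a b) = ennreal (a * b)"
proof -
  have "rect a b = {- a / 2..a / 2} \<times> {- b / 2..b / 2}" by (simp add: rect_def)
  then have "emeasure lborel (rect a b) = emeasure (lborel \<Otimes>\<^sub>M lborel) ({- a / 2..a / 2} \<times> {- b / 2..b / 2})"
    by (simp add: lborel_prod)
  also have "\<dots> = emeasure lborel {- a / 2..a / 2} * emeasure lborel {- b / 2..b / 2}"
    by (rule lborel.emeasure_pair_measure_Times) auto
  also have "\<dots> = ennreal (a * b)" using assms by (simp add: ennreal_mult)
  finally show ?thesis .
qed

text \<open>Integrating the partial derivative first along its own direction leaves, on each line
  that meets the rectangle, a difference of two values of \<open>G\<close>, which is at most 2. The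
  transversal side then measures the set of these lines.\<close>

lemma rect_integral_partial_le:
  fixes p G :: "pt \<Rightarrow> real"
  assumes p: "continuous_on UNIV p" and G: "\<And>z. \<bar>G z\<bar> \<le> 1" and ab: "0 \<le> a" "0 \<le> b"
  shows "(\<And>s t. ((\<lambda>s. G (s, t)) has_real_derivative p (s, t)) (at s)) \<Longrightarrow>
      (LINT z|lborel. indicator (rect a b) z * p z) \<le> 2 * b"
    and "(\<And>s t. ((\<lambda>t. G (s, t)) has_real_derivative p (s, t)) (at t)) \<Longrightarrow>
      (LINT z|lborel. indicator (rect a b) z * p z) \<le> 2 * a"
proof -
  have int: "integrable (lborel \<Otimes>\<^sub>M lborel) (\<lambda>(s, t). indicator (rect a b) (s, t) * p (s, t))"
    using borel_integrable_compact[of "rect a b" p] continuous_on_subset[OF p, of "rect a b"]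
    by (simp add: rect_eq_cbox lborel_prod case_prod_unfold)
  have ps: "isCont (\<lambda>s. p (s, t)) s" "isCont (\<lambda>t. p (s, t)) t" for s t
    by (rule continuous_on_interior[of UNIV]; auto intro!: continuous_on_compose2[OF p] continuous_intros)+
  have ind: "indicator (rect a b) (s, t) = (indicator {- a / 2..a / 2} s * indicator {- b / 2..b / 2} t :: real)" for s t
    by (simp add: rect_def indicator_def)
  {
    assume d: "\<And>s t. ((\<lambda>s. G (s, t)) has_real_derivative p (s, t)) (at s)"
    have inner: "(LINT s|lborel. indicator (rect a b) (s, t) * p (s, t)) = indicator {- b / 2..b / 2} t * (G (a / 2, t) - G (- a / 2, t))" for t
    proof -
      have "(LINT s|lborel. indicator (rect a b) (s, t) * p (s, t)) = (LINT s|lborel. indicator {- b / 2..b / 2} t * (p (s, t) * indicator {- a / 2..a / 2} s))"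
        by (simp add: ind ac_simps)
      also have "\<dots> = indicator {- b / 2..b / 2} t * (LINT s|lborel. p (s, t) * indicator {- a / 2..a / 2} s)" by simp
      also have "(LINT s|lborel. p (s, t) * indicator {- a / 2..a / 2} s) = G (a / 2, t) - G (- a / 2, t)"
        by (rule integral_FTC_Icc_real) (use ab d ps in auto)
      finally show ?thesis .
    qed
    have "(LINT z|lborel. indicator (rect a b) z * p z) = (LINT t|lborel. LINT s|lborel. indicator (rect a b) (s, t) * p (s, t))"
      using lborel_pair.integral_snd[OF int] by (simp add: lborel_prod case_prod_unfold)
    also have "\<dots> \<le> (LINT t|lborel. indicator {- b / 2..b / 2} t * 2)"
    proof (rule integral_mono)
      show "integrable lborel (\<lambda>t. LINT s|lborel. indicator (rect a b) (s, t) * p (s, t))"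
        using lborel_pair.integrable_snd[OF int] by simp
      show "(LINT s|lborel. indicator (rect a b) (s, t) * p (s, t)) \<le> indicator {- b / 2..b / 2} t * 2" for t
      proof -
        have "G (a / 2, t) - G (- a / 2, t) \<le> 2" using G[of "(a / 2, t)"] G[of "(- a / 2, t)"] by linarith
        then show ?thesis unfolding inner by (rule mult_left_mono) simp
      qed
      show "integrable lborel (\<lambda>t. indicator {- b / 2..b / 2} t * (2::real))"
        by (intro integrable_mult_left integrable_real_indicator) (auto simp: emeasure_lborel_Icc_eq)
    qed
    also have "\<dots> = 2 * b" using ab by simp
    finally show "(LINT z|lborel. indicator (rect a b) z * p z) \<le> 2 * b" .
  }
  {
    assume d: "\<And>s t. ((\<lambda>t. G (s, t)) has_real_derivative p (s, t)) (at t)"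
    have inner: "(LINT t|lborel. indicator (rect a b) (s, t) * p (s, t)) = indicator {- a / 2..a / 2} s * (G (s, b / 2) - G (s, - b / 2))" for s
    proof -
      have "(LINT t|lborel. indicator (rect a b) (s, t) * p (s, t)) = (LINT t|lborel. indicator {- a / 2..a / 2} s * (p (s, t) * indicator {- b / 2..b / 2} t))"
        by (simp add: ind ac_simps)
      also have "\<dots> = indicator {- a / 2..a / 2} s * (LINT t|lborel. p (s, t) * indicator {- b / 2..b / 2} t)" by simp
      also have "(LINT t|lborel. p (s, t) * indicator {- b / 2..b / 2} t) = G (s, b / 2) - G (s, - b / 2)"
        by (rule integral_FTC_Icc_real) (use ab d ps in auto)
      finally show ?thesis .
    qed
    have "(LINT z|lborel. indicator (rect a b) z * p z) = (LINT s|lborel. LINT t|lborel. indicator (rect a b) (s, t) * p (s, t))"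
      using lborel_pair.integral_fst[OF int] by (simp add: lborel_prod case_prod_unfold)
    also have "\<dots> \<le> (LINT s|lborel. indicator {- a / 2..a / 2} s * 2)"
    proof (rule integral_mono)
      show "integrable lborel (\<lambda>s. LINT t|lborel. indicator (rect a b) (s, t) * p (s, t))"
        using lborel_pair.integrable_fst[OF int] by simp
      show "(LINT t|lborel. indicator (rect a b) (s, t) * p (s, t)) \<le> indicator {- a / 2..a / 2} s * 2" for s
      proof -
        have "G (s, b / 2) - G (s, - b / 2) \<le> 2" using G[of "(s, b / 2)"] G[of "(s, - b / 2)"] by linarith
        then show ?thesis unfolding inner by (rule mult_left_mono) simp
      qed
      show "integrable lborel (\<lambda>s. indicator {- a / 2..a / 2} s * (2::real))"
        by (intro integrable_mult_left integrable_real_indicator) (auto simp: emeasure_lborel_Icc_eq)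
    qed
    also have "\<dots> = 2 * a" using ab by simp
    finally show "(LINT z|lborel. indicator (rect a b) z * p z) \<le> 2 * a" .
  }
qed

text \<open>The upper bound matching \<open>projections_le_perimeter1\<close>: the first component
  of any test field contributes at most \<open>2 * b\<close> and the second at most
  \<open>2 * a\<close>.\<close>

lemma perimeter1_rect_le:
  assumes ab: "0 \<le> a" "0 \<le> b"
  shows "perimeter1 (rect a b) \<le> ennreal (2 * a + 2 * b)"
  unfolding perimeter1_def
proof (rule SUP_least)
  fix g assume "g \<in> {g. perim_test g}"
  then have g: "\<And>z. g differentiable (at z)" "\<And>v. continuous_on UNIV (\<lambda>z. frechet_derivative g (at z) v)"
    "\<And>z. norm_inf (g z) \<le> 1" by (auto simp: perim_test_def)
  define p where "p z = fst (frechet_derivative g (at z) (1, 0))" for z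
  define q where "q z = snd (frechet_derivative g (at z) (0, 1))" for z
  have D: "(g has_derivative frechet_derivative g (at z)) (at z)" for z
    by (rule frechet_derivative_works[THEN iffD1, OF g(1)])
  have lin: "linear (frechet_derivative g (at z))" for z
    by (rule has_derivative_linear[OF D])
  have cp: "continuous_on UNIV p" "continuous_on UNIV q" unfolding p_def q_def by (intro continuous_intros g(2))+
  have G: "\<bar>fst (g z)\<bar> \<le> 1" "\<bar>snd (g z)\<bar> \<le> 1" for z using g(3)[of z] by (auto simp: norm_inf_def)
  have dp: "((\<lambda>s. fst (g (s, t))) has_real_derivative p (s, t)) (at s)" for s t
  proof -
    have "((\<lambda>s. g (s, t)) has_derivative (\<lambda>h. frechet_derivative g (at (s, t)) (h, 0))) (at s)"
      by (rule has_derivative_compose[where f = "\<lambda>s. (s, t)", OF _ D]) (auto intro!: derivative_eq_intros)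
    then have "((\<lambda>s. fst (g (s, t))) has_derivative (\<lambda>h. fst (frechet_derivative g (at (s, t)) (h, 0)))) (at s)"
      by (rule has_derivative_fst)
    moreover have "(\<lambda>h. fst (frechet_derivative g (at (s, t)) (h, 0))) = (\<lambda>h. p (s, t) * h)"
    proof
      fix h
      have "frechet_derivative g (at (s, t)) (h *\<^sub>R (1, 0)) = h *\<^sub>R frechet_derivative g (at (s, t)) (1, 0)"
        by (rule linear_scale[OF lin])
      then show "fst (frechet_derivative g (at (s, t)) (h, 0)) = p (s, t) * h" by (simp add: p_def)
    qed
    ultimately show ?thesis by (simp add: has_field_derivative_def)
  qed
  have dq: "((\<lambda>t. snd (g (s, t))) has_real_derivative q (s, t)) (at t)" for s t
  proof -
    have "((\<lambda>t. g (s, t)) has_derivative (\<lambda>h. frechet_derivative g (at (s, t)) (0, h))) (at t)"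
      by (rule has_derivative_compose[where f = "\<lambda>t. (s, t)", OF _ D]) (auto intro!: derivative_eq_intros)
    then have "((\<lambda>t. snd (g (s, t))) has_derivative (\<lambda>h. snd (frechet_derivative g (at (s, t)) (0, h)))) (at t)"
      by (rule has_derivative_snd)
    moreover have "(\<lambda>h. snd (frechet_derivative g (at (s, t)) (0, h))) = (\<lambda>h. q (s, t) * h)"
    proof
      fix h
      have "frechet_derivative g (at (s, t)) (h *\<^sub>R (0, 1)) = h *\<^sub>R frechet_derivative g (at (s, t)) (0, 1)"
        by (rule linear_scale[OF lin])
      then show "snd (frechet_derivative g (at (s, t)) (0, h)) = q (s, t) * h" by (simp add: q_def)
    qed
    ultimately show ?thesis by (simp add: has_field_derivative_def)
  qed
  have int: "integrable lborel (\<lambda>z. indicator (rect a b) z * p z)" "integrable lborel (\<lambda>z. indicator (rect a b) z * q z)"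
    using borel_integrable_compact[of "rect a b" p] borel_integrable_compact[of "rect a b" q]
      continuous_on_subset[OF cp(1), of "rect a b"] continuous_on_subset[OF cp(2), of "rect a b"]
    by (simp_all add: rect_eq_cbox)
  have "(LINT z|lebesgue. indicator (rect a b) z * divergence g z)
      = (LINT z|lebesgue. indicator (rect a b) z * p z + indicator (rect a b) z * q z)"
    by (simp add: divergence_def p_def q_def distrib_left)
  also have "\<dots> = (LINT z|lborel. indicator (rect a b) z * p z + indicator (rect a b) z * q z)"
    by (rule integral_completion) (use int in \<open>auto intro: borel_measurable_integrable\<close>)
  also have "\<dots> = (LINT z|lborel. indicator (rect a b) z * p z) + (LINT z|lborel. indicator (rect a b) z * q z)"
    by (rule Bochner_Integration.integral_add[OF int])
  also have "\<dots> \<le> 2 * b + 2 * a"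
    by (intro add_mono rect_integral_partial_le(1)[OF cp(1) G(1) ab dp] rect_integral_partial_le(2)[OF cp(2) G(2) ab dq])
  finally show "ennreal (LINT z|lebesgue. indicator (rect a b) z * divergence g z) \<le> ennreal (2 * a + 2 * b)"
    by (intro ennreal_leI) simp
qed


section \<open>Signed distance and essential boundary of a rectangle\<close>

definition sd :: "real \<Rightarrow> real \<Rightarrow> pt \<Rightarrow> real" where
  "sd a b z = max (\<bar>fst z\<bar> - a / 2) (\<bar>snd z\<bar> - b / 2)"

lemma continuous_sd: "continuous_on UNIV (sd a b)"
  unfolding sd_def[abs_def] by (intro continuous_intros)

lemma measurable_sd [measurable]: "sd a b \<in> borel_measurable borel"
  by (rule borel_measurable_continuous_onI[OF continuous_sd])

lemma mem_rect_iff_sd: "z \<in> rect a b \<longleftrightarrow> sd a b z \<le> 0"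
  by (cases z) (auto simp: rect_def sd_def abs_le_iff)

text \<open>The rectangle is star-shaped about the origin: for a point \<open>z\<close> of the zero
  set, the dilates of \<open>z\<close> by \<open>1 - e\<close> and \<open>1 + e\<close> lie in the
  open interior and in the open exterior, arbitrarily close to \<open>z\<close>, and nonempty open
  sets have positive measure.\<close>

lemma ess_boundary_rect:
  assumes ab: "0 < a" "0 < b"
  shows "ess_boundary (rect a b) = {z. sd a b z = 0}"
proof (intro set_eqI iffI)
  fix z assume z: "z \<in> ess_boundary (rect a b)"
  have o: "open {z. sd a b z < 0}" "open {z. 0 < sd a b z}"
    by (intro open_Collect_less continuous_sd continuous_intros)+
  have "\<not> sd a b z < 0"
  proof
    assume "sd a b z < 0"
    then obtain r where r: "r > 0" "ball z r \<subseteq> {z. sd a b z < 0}" using o(1) open_contains_ball by blast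
    then have e: "ball z r - rect a b = {}" by (auto simp: mem_rect_iff_sd)
    have "0 < emeasure lebesgue (ball z r - rect a b)" using z r(1) by (simp add: ess_boundary_def)
    then show False unfolding e by simp
  qed
  moreover have "\<not> 0 < sd a b z"
  proof
    assume "0 < sd a b z"
    then obtain r where r: "r > 0" "ball z r \<subseteq> {z. 0 < sd a b z}" using o(2) open_contains_ball by blast
    then have e: "rect a b \<inter> ball z r = {}" by (auto simp: mem_rect_iff_sd)
    have "0 < emeasure lebesgue (rect a b \<inter> ball z r)" using z r(1) by (simp add: ess_boundary_def)
    then show False unfolding e by simp
  qed
  ultimately show "z \<in> {z. sd a b z = 0}" by simp
next
  fix z assume "z \<in> {z. sd a b z = 0}"
  then have z: "sd a b z = 0" by simp
  have pos: "0 < emeasure lebesgue U" if "open U" "w \<in> U" for U :: "pt set" and w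
  proof -
    have "\<not> negligible U" using that open_not_negligible by blast
    then show ?thesis using that(1)
      by (simp add: negligible_iff_null_sets null_sets_def zero_less_iff_neq_zero)
  qed
  show "z \<in> ess_boundary (rect a b)"
    unfolding ess_boundary_def
  proof (intro CollectI allI impI conjI)
    fix r :: real assume r: "0 < r"
    obtain n where n: "n = norm z" "0 \<le> n" by simp
    \<comment> \<open>Chosen so that \<open>e * norm z < r\<close>; the summand 1 in the denominator
      avoids a case distinction on the norm.\<close>
    define e where "e = min (1/2) (r / (2 * (n + 1)))"
    have e: "0 < e" "e < 1" unfolding e_def using r n(2) by auto
    have "e * n \<le> r / (2 * (n + 1)) * n" unfolding e_def by (intro mult_right_mono n) auto
    also have "\<dots> = r * (n / (2 * (n + 1)))" by simp
    also have "\<dots> < r * 1" using n(2) by (intro mult_strict_left_mono r) simp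
    finally have en: "e * norm z < r" using n(1) by simp
    have d: "dist z (c *\<^sub>R z) < r" if "\<bar>1 - c\<bar> = e" for c
    proof -
      have "dist z (c *\<^sub>R z) = norm ((1 - c) *\<^sub>R z)" by (simp add: dist_norm scaleR_diff_left)
      then show ?thesis using en that by simp
    qed
    have le: "\<bar>fst z\<bar> \<le> a / 2" "\<bar>snd z\<bar> \<le> b / 2" using z by (auto simp: sd_def max_def split: if_splits)
    have shrink: "(1 - e) * u < c" if "u \<le> c" "0 < c" for u c :: real
    proof -
      have "(1 - e) * u \<le> (1 - e) * c" using that e by (intro mult_left_mono) auto
      also have "\<dots> < 1 * c" using that e by (intro mult_strict_right_mono) auto
      finally show ?thesis by simp
    qed
    have "(1 - e) * \<bar>fst z\<bar> < a / 2" "(1 - e) * \<bar>snd z\<bar> < b / 2"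
      using shrink[OF le(1)] shrink[OF le(2)] ab by auto
    then have "sd a b ((1 - e) *\<^sub>R z) < 0" using e by (simp add: sd_def abs_mult)
    moreover have "(1 - e) *\<^sub>R z \<in> ball z r" using d[of "1 - e"] e by simp
    ultimately have "0 < emeasure lebesgue ({z. sd a b z < 0} \<inter> ball z r)"
      by (intro pos[where w = "(1 - e) *\<^sub>R z"] open_Int open_Collect_less continuous_sd continuous_intros) auto
    also have "\<dots> \<le> emeasure lebesgue (rect a b \<inter> ball z r)"
      by (intro emeasure_mono) (auto simp: mem_rect_iff_sd)
    finally show "0 < emeasure lebesgue (rect a b \<inter> ball z r)" .
    have "\<bar>fst z\<bar> = a / 2 \<or> \<bar>snd z\<bar> = b / 2" using z by (auto simp: sd_def max_def split: if_splits)
    then have "(1 + e) * \<bar>fst z\<bar> > a / 2 \<or> (1 + e) * \<bar>snd z\<bar> > b / 2"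
      using ab e by (auto simp: distrib_right)
    then have "0 < sd a b ((1 + e) *\<^sub>R z)" using e by (auto simp: sd_def abs_mult less_max_iff_disj)
    moreover have "(1 + e) *\<^sub>R z \<in> ball z r" using d[of "1 + e"] e by simp
    ultimately have "0 < emeasure lebesgue ({z. 0 < sd a b z} \<inter> ball z r)"
      by (intro pos[where w = "(1 + e) *\<^sub>R z"] open_Int open_Collect_less continuous_sd continuous_intros) auto
    also have "\<dots> \<le> emeasure lebesgue (ball z r - rect a b)"
      by (intro emeasure_mono) (auto simp: mem_rect_iff_sd)
    finally show "0 < emeasure lebesgue (ball z r - rect a b)" .
  qed
qed

text \<open>In the maximum norm one formula serves inside and outside. For the lower bound,
  \<open>sd\<close> is 1-Lipschitz in this norm and vanishes on the boundary; for the upper bound a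
  nearest boundary point is written down.\<close>

lemma dist_inf_bd_rect:
  assumes ab: "0 < a" "0 < b"
  shows "dist_inf_bd z (rect a b) = ennreal \<bar>sd a b z\<bar>"
  unfolding dist_inf_bd_def ess_boundary_rect[OF ab]
proof (rule antisym)
  show "ennreal \<bar>sd a b z\<bar> \<le> (INF w\<in>{w. sd a b w = 0}. ennreal (norm_inf (z - w)))"
  proof (rule INF_greatest, rule ennreal_leI)
    fix w assume "w \<in> {w. sd a b w = 0}"
    then have "sd a b w = 0" by simp
    then show "\<bar>sd a b z\<bar> \<le> norm_inf (z - w)" unfolding sd_def norm_inf_def
      by (simp add: max_def abs_le_iff split: if_splits) linarith+
  qed
  have "\<exists>w. sd a b w = 0 \<and> norm_inf (z - w) \<le> \<bar>sd a b z\<bar>"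
  proof -
    obtain s t where z: "z = (s, t)" by (cases z)
    \<comment> \<open>Outside the rectangle a nearest boundary point arises by clamping each
      coordinate to its interval.\<close>
    define cl where "cl c u = max (- c / 2) (min (c / 2) u)" for c u :: real
    have cl: "\<bar>cl c u\<bar> \<le> c / 2" "\<bar>u - cl c u\<bar> = max 0 (\<bar>u\<bar> - c / 2)" "c / 2 < \<bar>u\<bar> \<Longrightarrow> \<bar>cl c u\<bar> = c / 2"
      if "c > 0" for c u
    proof -
      consider "u < - c / 2" | "- c / 2 \<le> u" "u \<le> c / 2" | "c / 2 < u" by linarith
      then have "\<bar>cl c u\<bar> \<le> c / 2 \<and> \<bar>u - cl c u\<bar> = max 0 (\<bar>u\<bar> - c / 2) \<and> (c / 2 < \<bar>u\<bar> \<longrightarrow> \<bar>cl c u\<bar> = c / 2)"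
      proof cases
        case 1
        then have "cl c u = - c / 2" using that unfolding cl_def by linarith
        then show ?thesis using 1 that by simp
      next
        case 2
        then have "cl c u = u" using that unfolding cl_def by linarith
        moreover have "\<bar>u\<bar> \<le> c / 2" using 2 by (intro abs_leI) linarith+
        ultimately show ?thesis by simp
      next
        case 3
        then have "cl c u = c / 2" using that unfolding cl_def by linarith
        then show ?thesis using 3 that by simp
      qed
      then show "\<bar>cl c u\<bar> \<le> c / 2" "\<bar>u - cl c u\<bar> = max 0 (\<bar>u\<bar> - c / 2)" "c / 2 < \<bar>u\<bar> \<Longrightarrow> \<bar>cl c u\<bar> = c / 2"
        by blast+
    qed
    \<comment> \<open>Inside, only the coordinate closer to its side is moved, to the side of the
      same sign.\<close>
    define sg where "sg c u = (if 0 \<le> u then c / 2 else - c / 2)" for c u :: real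
    have sg: "\<bar>sg c u\<bar> = c / 2" "\<bar>u\<bar> \<le> c / 2 \<Longrightarrow> \<bar>u - sg c u\<bar> = c / 2 - \<bar>u\<bar>"
      if "c > 0" for c u using that unfolding sg_def by (cases "0 \<le> u"; simp)+
    show ?thesis
    proof (cases "sd a b z \<le> 0")
      case False
      then have "a / 2 < \<bar>s\<bar> \<or> b / 2 < \<bar>t\<bar>" by (auto simp: z sd_def)
      then have "sd a b (cl a s, cl b t) = 0"
        using cl(1,3)[OF ab(1), of s] cl(1,3)[OF ab(2), of t] by (auto simp: sd_def max_def)
      moreover have "norm_inf (z - (cl a s, cl b t)) \<le> \<bar>sd a b z\<bar>"
      proof -
        have m: "max (max 0 p) (max 0 q) \<le> \<bar>max p q\<bar>" if "\<not> max p q \<le> 0" for p q :: real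
          using that by (cases "p \<le> q") (simp_all only: max_def abs_if, simp_all split: if_splits)
        have "norm_inf (z - (cl a s, cl b t)) = max (max 0 (\<bar>s\<bar> - a / 2)) (max 0 (\<bar>t\<bar> - b / 2))"
          by (simp only: z norm_inf_def fst_conv snd_conv diff_Pair cl(2)[OF ab(1)] cl(2)[OF ab(2)])
        also have "\<dots> \<le> \<bar>sd a b z\<bar>"
          using False unfolding z sd_def fst_conv snd_conv by (rule m)
        finally show ?thesis .
      qed
      ultimately show ?thesis by (intro exI[of _ "(cl a s, cl b t)"] conjI)
    next
      case True
      then have le: "\<bar>s\<bar> \<le> a / 2" "\<bar>t\<bar> \<le> b / 2" by (simp_all add: z sd_def)
      show ?thesis
      proof (cases "\<bar>t\<bar> - b / 2 \<le> \<bar>s\<bar> - a / 2")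
        case h: True
        have "sd a b (sg a s, t) = 0" unfolding sd_def fst_conv snd_conv sg(1)[OF ab(1)] diff_self
          using le(2) by (simp only: max_absorb1 diff_le_0_iff_le)
        moreover have "norm_inf (z - (sg a s, t)) \<le> \<bar>sd a b z\<bar>"
        proof -
          have "norm_inf (z - (sg a s, t)) = max \<bar>s - sg a s\<bar> 0" by (simp only: z norm_inf_def diff_Pair fst_conv snd_conv diff_self abs_zero)
          also have "\<dots> = a / 2 - \<bar>s\<bar>" using sg(2)[OF ab(1) le(1)] le(1) by (simp only: max_absorb1 diff_ge_0_iff_ge)
          also have "a / 2 - \<bar>s\<bar> = \<bar>sd a b z\<bar>" 
            unfolding z sd_def fst_conv snd_conv max_absorb1[OF h] using le(1)
            by (subst abs_of_nonpos) (simp_all only: diff_le_0_iff_le minus_diff_eq)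
          finally show ?thesis by (rule eq_refl)
        qed
        ultimately show ?thesis by (intro exI[of _ "(sg a s, t)"] conjI)
      next
        case h: False
        have "sd a b (s, sg b t) = 0" unfolding sd_def fst_conv snd_conv sg(1)[OF ab(2)] diff_self
          using le(1) by (simp only: max_absorb2 diff_le_0_iff_le)
        moreover have "norm_inf (z - (s, sg b t)) \<le> \<bar>sd a b z\<bar>"
        proof -
          have "norm_inf (z - (s, sg b t)) = max 0 \<bar>t - sg b t\<bar>" by (simp only: z norm_inf_def diff_Pair fst_conv snd_conv diff_self abs_zero)
          also have "\<dots> = b / 2 - \<bar>t\<bar>" using sg(2)[OF ab(2) le(2)] le(2) by (simp only: max_absorb2 diff_ge_0_iff_ge)
          also have "b / 2 - \<bar>t\<bar> = \<bar>sd a b z\<bar>" 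
            unfolding z sd_def fst_conv snd_conv max_absorb2[OF less_imp_le[OF h[unfolded not_le]]] using le(2)
            by (subst abs_of_nonpos) (simp_all only: diff_le_0_iff_le minus_diff_eq)
          finally show ?thesis by (rule eq_refl)
        qed
        ultimately show ?thesis by (intro exI[of _ "(s, sg b t)"] conjI)
      qed
    qed
  qed
  then obtain w where w: "sd a b w = 0" "norm_inf (z - w) \<le> \<bar>sd a b z\<bar>" by blast
  then show "(INF w\<in>{w. sd a b w = 0}. ennreal (norm_inf (z - w))) \<le> ennreal \<bar>sd a b z\<bar>"
    by (intro INF_lower2[of w] ennreal_leI) auto
qed

section \<open>Invariance of the energy under changes on null sets\<close>

lemma ae_eq_iff_AE:
  assumes "A \<in> sets lebesgue" "B \<in> sets lebesgue"
  shows "ae_eq A B \<longleftrightarrow> (AE z in lebesgue. z \<in> A \<longleftrightarrow> z \<in> B)"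
proof -
  have "symdiff A B \<in> sets lebesgue" using assms by (simp add: symdiff_def)
  then have "ae_eq A B \<longleftrightarrow> (AE z in lebesgue. z \<notin> symdiff A B)"
    unfolding ae_eq_def by (subst AE_iff_null_sets) auto
  also have "\<dots> \<longleftrightarrow> (AE z in lebesgue. z \<in> A \<longleftrightarrow> z \<in> B)"
    by (intro AE_cong) (auto simp: symdiff_def)
  finally show ?thesis .
qed

lemma ae_eq_refl: "ae_eq A A"
  by (simp add: ae_eq_def symdiff_def)

lemma ae_eq_sym: "ae_eq A B \<Longrightarrow> ae_eq B A"
  by (simp add: ae_eq_def symdiff_def Un_commute)

lemma ae_eq_trans:
  assumes "ae_eq A B" "ae_eq B C"
  shows "ae_eq A C"
proof -
  have "symdiff A B \<union> symdiff B C \<in> null_sets lebesgue" using assms by (auto simp: ae_eq_def)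
  then show ?thesis unfolding ae_eq_def
    by (rule null_sets_completion_subset[rotated]) (auto simp: symdiff_def)
qed

lemma ae_eq_in_lebesgue:
  assumes "ae_eq A B" "B \<in> sets lebesgue"
  shows "A \<in> sets lebesgue"
proof -
  have n: "symdiff A B \<in> null_sets lebesgue" using assms(1) by (simp add: ae_eq_def)
  have "A - B \<in> sets lebesgue" "B - A \<in> sets lebesgue"
    by (rule null_setsD2, rule null_sets_completion_subset[OF _ n], auto simp: symdiff_def)+
  then have "(B - (B - A)) \<union> (A - B) \<in> sets lebesgue" using assms(2) by blast
  moreover have "(B - (B - A)) \<union> (A - B) = A" by blast
  ultimately show ?thesis by simp
qed

lemma perimeter1_cong:
  assumes "ae_eq A B" "B \<in> sets lebesgue"
  shows "perimeter1 A = perimeter1 B"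
proof -
  have A: "A \<in> sets lebesgue" by (rule ae_eq_in_lebesgue[OF assms])
  have ae: "AE z in lebesgue. z \<in> A \<longleftrightarrow> z \<in> B" using assms ae_eq_iff_AE[OF A assms(2)] by simp
  show ?thesis unfolding perimeter1_def
  proof (intro SUP_cong refl arg_cong[where f = ennreal])
    fix g assume "g \<in> {g. perim_test g}"
    then have c: "continuous_on UNIV (divergence g)"
      unfolding divergence_def[abs_def] perim_test_def by (auto intro!: continuous_intros)
    have "divergence g \<in> borel_measurable lebesgue"
      using borel_measurable_continuous_onI[OF c] by (intro measurable_completion) simp
    then show "(LINT z|lebesgue. indicator A z * divergence g z) = (LINT z|lebesgue. indicator B z * divergence g z)"
      using A assms(2) ae by (intro integral_cong_AE borel_measurable_times borel_measurable_indicator) (auto simp: indicator_def)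
  qed
qed

text \<open>Both measures in the definition are insensitive to null sets, so the distance in the
  dissipation is a function of the class of the set.\<close>

lemma ess_boundary_cong:
  assumes "ae_eq A B" "B \<in> sets lebesgue"
  shows "ess_boundary A = ess_boundary B"
proof -
  have A: "A \<in> sets lebesgue" by (rule ae_eq_in_lebesgue[OF assms])
  have ae: "AE z in lebesgue. z \<in> A \<longleftrightarrow> z \<in> B" using assms ae_eq_iff_AE[OF A assms(2)] by simp
  have b: "ball x r \<in> sets lebesgue" for x :: pt and r by simp
  have e: "emeasure lebesgue (A \<inter> ball x r) = emeasure lebesgue (B \<inter> ball x r)"
    "emeasure lebesgue (ball x r - A) = emeasure lebesgue (ball x r - B)" for x r
    using ae A assms(2) b by (intro emeasure_eq_AE; auto)+
  show ?thesis unfolding ess_boundary_def e ..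
qed

lemma Ftau_cong:
  assumes E: "ae_eq E E'" "E' \<in> sets lebesgue" and F: "ae_eq F F'" "F' \<in> sets lebesgue"
  shows "Ftau \<tau> E F = Ftau \<tau> E' F'"
proof -
  have "E \<in> sets lebesgue" "F \<in> sets lebesgue" using ae_eq_in_lebesgue assms by blast+
  then have "AE z in lebesgue. z \<in> E \<longleftrightarrow> z \<in> E'" "AE z in lebesgue. z \<in> F \<longleftrightarrow> z \<in> F'"
    using assms ae_eq_iff_AE by blast+
  then have "AE z in lebesgue. indicator (symdiff E F) z * dist_inf_bd z F = indicator (symdiff E' F') z * dist_inf_bd z F'"
    by eventually_elim (auto simp: indicator_def symdiff_def dist_inf_bd_def ess_boundary_cong[OF F])
  then have "Dfun E F = Dfun E' F'" unfolding Dfun_def by (rule nn_integral_cong_AE)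
  then show ?thesis by (simp add: Ftau_def perimeter1_cong[OF E])
qed

lemma borel_representative:
  assumes "E \<in> sets lebesgue"
  obtains E' where "E' \<in> sets borel" "ae_eq E (E' :: pt set)"
proof -
  obtain S N N' where "E = S \<union> N" "N \<subseteq> N'" "N' \<in> null_sets lborel" "S \<in> sets lborel"
    using sets_completionE[OF assms] by metis
  moreover then have "ae_eq E S" unfolding ae_eq_def
    by (intro null_sets_completion_subset[OF _ null_sets_completionI, of _ N']) (auto simp: symdiff_def)
  ultimately show ?thesis using that by auto
qed

text \<open>On \<open>E\<close> minus the rectangle \<open>sd\<close> is positive, on the rectangle
  minus \<open>E\<close> it is nonpositive. The signed difference of indicators thus removes the
  absolute value, and the dissipation becomes affine in the indicator of \<open>E\<close>.\<close>

lemma Dfun_rect: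
  assumes ab: "0 < a" "0 < b" and E: "E \<in> sets borel"
  shows "Dfun E (rect a b) = (\<integral>\<^sup>+z. ennreal ((indicator E z - indicator (rect a b) z) * sd a b z) \<partial>lborel)"
proof -
  have "Dfun E (rect a b) = (\<integral>\<^sup>+z. ennreal ((indicator E z - indicator (rect a b) z) * sd a b z) \<partial>lebesgue)"
    unfolding Dfun_def dist_inf_bd_rect[OF ab]
  proof (rule nn_integral_cong)
    fix z
    have r1: "\<bar>sd a b z\<bar> = - sd a b z" if "z \<in> rect a b"
      using that[unfolded mem_rect_iff_sd] by (rule abs_of_nonpos)
    have r2: "\<bar>sd a b z\<bar> = sd a b z" if "z \<notin> rect a b"
      using that[unfolded mem_rect_iff_sd not_le] by (rule abs_of_pos)
    show "indicator (symdiff E (rect a b)) z * ennreal \<bar>sd a b z\<bar> = ennreal ((indicator E z - indicator (rect a b) z) * sd a b z)"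
      by (cases "z \<in> E"; cases "z \<in> rect a b") (simp_all add: r1 r2 symdiff_def)
  qed
  moreover have "(\<lambda>z. ennreal ((indicator E z - indicator (rect a b) z) * sd a b z)) \<in> borel_measurable lborel"
  proof -
    have "(\<lambda>z. (indicator E z - indicator (rect a b) z) * sd a b z) \<in> borel_measurable borel"
      using E by (intro borel_measurable_times borel_measurable_diff measurable_sd borel_measurable_indicator rect_in_borel)
    then show ?thesis by simp
  qed
  ultimately show ?thesis by (simp only: nn_integral_completion)
qed

section \<open>The minimization problem of one time step\<close>

lemma AE_eq_of_AE_subset:
  fixes S T :: "'a::euclidean_space set"
  assumes ST: "S \<in> sets borel" "T \<in> sets borel" and sub: "AE z in lborel. z \<in> S \<longrightarrow> z \<in> T"
    and m: "emeasure lborel S = emeasure lborel T" "emeasure lborel T < \<infinity>"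
  shows "AE z in lborel. z \<in> S \<longleftrightarrow> z \<in> T"
proof -
  have e: "emeasure lborel (S \<inter> T) = emeasure lborel T"
    unfolding m(1)[symmetric] by (rule emeasure_eq_AE) (use ST sub in auto)
  have "emeasure lborel (T - S \<inter> T) = ennreal (measure lborel T - measure lborel (S \<inter> T))"
    by (rule emeasure_Diff_real) (use ST m in auto)
  also have "\<dots> = 0" by (simp add: measure_def e)
  finally have "T - S \<inter> T \<in> null_sets lborel" using ST by auto
  from AE_not_in[OF this] sub show ?thesis by eventually_elim blast
qed

text \<open>With the level \<open>c = f (\<alpha> / 2)\<close>, the product of \<open>f - c\<close>
  and the difference of the two indicators is nonnegative everywhere, and the contribution of
  \<open>c\<close> integrates to 0 because both sets have measure \<alpha>. Equality makes the
  product vanish almost everywhere, and strict decrease beyond the interval then excludes points of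
  \<open>S\<close> there.\<close>

lemma bathtub:
  fixes f :: "real \<Rightarrow> real"
  assumes f: "integrable lborel f" "\<And>s s'. \<bar>s\<bar> \<le> \<bar>s'\<bar> \<Longrightarrow> f s' \<le> f s"
    and S: "S \<in> sets borel" "emeasure lborel S = ennreal \<alpha>" "0 \<le> \<alpha>"
  shows "(LINT s|lborel. indicator S s * f s) \<le> (LINT s|lborel. indicator {- \<alpha> / 2..\<alpha> / 2} s * f s)"
    and "(\<And>s. \<alpha> / 2 < \<bar>s\<bar> \<Longrightarrow> f s < f (\<alpha> / 2)) \<Longrightarrow>
      (LINT s|lborel. indicator S s * f s) = (LINT s|lborel. indicator {- \<alpha> / 2..\<alpha> / 2} s * f s) \<Longrightarrow>
      AE s in lborel. s \<in> S \<longleftrightarrow> s \<in> {- \<alpha> / 2..\<alpha> / 2}"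
proof -
  define I where "I = {- \<alpha> / 2..\<alpha> / 2}"
  define c where "c = f (\<alpha> / 2)"
  define g where "g s = (indicator I s * f s - indicator S s * f s) - c * (indicator I s - indicator S s)" for s
  have I: "I \<in> sets borel" "emeasure lborel I = ennreal \<alpha>" using S(3) by (auto simp: I_def)
  have mI: "s \<in> I \<longleftrightarrow> \<bar>s\<bar> \<le> \<alpha> / 2" for s by (auto simp: I_def abs_le_iff)
  have int: "integrable lborel (\<lambda>s. indicator I s * f s)" "integrable lborel (\<lambda>s. indicator S s * f s)"
    using integrable_mult_indicator[of I lborel f] integrable_mult_indicator[of S lborel f] f I S by simp_all
  have inti: "integrable lborel (indicator I :: real \<Rightarrow> real)" "integrable lborel (indicator S :: real \<Rightarrow> real)"
    using I S by (auto intro!: integrable_real_indicator)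
  have intg: "integrable lborel g"
    unfolding g_def by (intro Bochner_Integration.integrable_diff integrable_mult_right int inti)
  have mm: "measure lborel I = \<alpha>" "measure lborel S = \<alpha>" using I(2) S(2,3) by (simp_all add: measure_def)
  have "integral\<^sup>L lborel g = (LINT s|lborel. indicator I s * f s) - (LINT s|lborel. indicator S s * f s)
      - c * (measure lborel I - measure lborel S)"
    unfolding g_def using int inti I(1) S(1) by simp
  then have ig: "integral\<^sup>L lborel g = (LINT s|lborel. indicator I s * f s) - (LINT s|lborel. indicator S s * f s)"
    using mm by simp
  have \<alpha>2: "\<bar>\<alpha> / 2\<bar> = \<alpha> / 2" using S(3) by simp
  have fI: "c \<le> f s" if "s \<in> I" for s unfolding c_def by (rule f(2)) (use that mI \<alpha>2 in simp)
  have fO: "f s \<le> c" if "s \<notin> I" for s unfolding c_def by (rule f(2)) (use that mI \<alpha>2 in simp)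
  have g0: "0 \<le> g s" for s
  proof (cases "s \<in> I")
    case True
    then show ?thesis using fI[OF True] by (cases "s \<in> S") (simp_all add: g_def)
  next
    case False
    then show ?thesis using fO[OF False] by (cases "s \<in> S") (simp_all add: g_def)
  qed
  have "0 \<le> integral\<^sup>L lborel g" by (rule Bochner_Integration.integral_nonneg) (rule g0)
  then show "(LINT s|lborel. indicator S s * f s) \<le> (LINT s|lborel. indicator {- \<alpha> / 2..\<alpha> / 2} s * f s)"
    unfolding ig I_def[symmetric] by simp
  assume strict: "\<And>s. \<alpha> / 2 < \<bar>s\<bar> \<Longrightarrow> f s < f (\<alpha> / 2)"
    and eq: "(LINT s|lborel. indicator S s * f s) = (LINT s|lborel. indicator {- \<alpha> / 2..\<alpha> / 2} s * f s)"
  have "integral\<^sup>L lborel g = 0" unfolding ig using eq by (simp add: I_def)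
  then have "AE s in lborel. g s = 0"
    using integral_nonneg_eq_0_iff_AE[OF intg] g0 by simp
  then have "AE s in lborel. s \<in> S \<longrightarrow> s \<in> I"
  proof eventually_elim
    fix s assume 0: "g s = 0"
    show "s \<in> S \<longrightarrow> s \<in> I"
    proof (rule impI, rule ccontr)
      assume s: "s \<in> S" "s \<notin> I"
      then have "f s < c" unfolding c_def using mI strict by simp
      then show False using 0 s by (simp add: g_def)
    qed
  qed
  then show "AE s in lborel. s \<in> S \<longleftrightarrow> s \<in> {- \<alpha> / 2..\<alpha> / 2}"
    unfolding I_def[symmetric] by (rule AE_eq_of_AE_subset[OF S(1) I(1)]) (use I(2) S(2) in simp_all)
qed

lemma annulus:
  fixes l r :: real
  assumes "0 \<le> l" "l \<le> r"
  shows "{s. l < \<bar>s\<bar> \<and> \<bar>s\<bar> \<le> r} \<in> sets borel"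
    and "emeasure lborel {s. l < \<bar>s\<bar> \<and> \<bar>s\<bar> \<le> r} = ennreal (2 * (r - l))"
proof -
  have eq: "{s. l < \<bar>s\<bar> \<and> \<bar>s\<bar> \<le> r} = {- r..<- l} \<union> {l<..r}"
  proof (rule set_eqI)
    fix s show "s \<in> {s. l < \<bar>s\<bar> \<and> \<bar>s\<bar> \<le> r} \<longleftrightarrow> s \<in> {- r..<- l} \<union> {l<..r}"
      using assms by (cases "0 \<le> s") auto
  qed
  show "{s. l < \<bar>s\<bar> \<and> \<bar>s\<bar> \<le> r} \<in> sets borel" unfolding eq by simp
  have "emeasure lborel ({- r..<- l} \<union> {l<..r}) = emeasure lborel {- r..<- l} + emeasure lborel {l<..r}"
    using assms by (intro plus_emeasure[symmetric]) auto
  also have "\<dots> = ennreal (2 * (r - l))" using assms by (simp flip: ennreal_plus)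
  finally show "emeasure lborel {s. l < \<bar>s\<bar> \<and> \<bar>s\<bar> \<le> r} = ennreal (2 * (r - l))" unfolding eq .
qed

text \<open>Adds the three estimates for one competitor: \<open>v\<close> is the weight of the
  product set, \<open>p\<close> the perimeter, \<open>d\<close> the scaled dissipation. If the sum
  is tight, the estimate for the product set is tight.\<close>

lemma energy_arith:
  fixes v v0 u0 p d A B \<alpha> \<beta> :: real
  assumes "v \<le> v0 + 2 * (\<alpha> - A) + 2 * (\<beta> - B)" "2 * \<beta> + 2 * \<alpha> \<le> p" "u0 \<le> d + v"
  shows "2 * A + 2 * B + (u0 - v0) \<le> p + d"
    and "p + d \<le> 2 * A + 2 * B + (u0 - v0) \<Longrightarrow> v = v0 + 2 * (\<alpha> - A) + 2 * (\<beta> - B)"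
proof -
  show "2 * A + 2 * B + (u0 - v0) \<le> p + d"
    using add_mono[OF add_mono[OF assms(1,2)] assms(3)] by (simp add: algebra_simps)
  assume "p + d \<le> 2 * A + 2 * B + (u0 - v0)"
  from add_mono[OF add_mono[OF assms(2,3)] this] have "v0 + 2 * (\<alpha> - A) + 2 * (\<beta> - B) \<le> v"
    by (simp add: algebra_simps)
  with assms(1) show "v = v0 + 2 * (\<alpha> - A) + 2 * (\<beta> - B)" by (rule antisym)
qed

text \<open>One implicit Euler step: \<open>x\<close> and \<open>y\<close> are the inward and outward displacements of the sides, and
  \<open>\<mu>\<close> is the Lagrange multiplier of the area constraint. The assumption \<open>EL\<close> says that
  \<open>\<mu> - sd / \<tau>\<close> has integral \<open>2\<close> along each vertical side of the new rectangle; on the horizontal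
  sides the same holds by the choice of \<open>\<mu>\<close>.\<close>

locale euler_step =
  fixes a b \<tau> x y A B \<mu> :: real
  assumes b: "0 < b" and x: "0 < x" "4 * x \<le> b" and y: "0 < y" and \<tau>: "0 < \<tau>" "20 * \<tau> \<le> b"
    and A: "A = a - 2 * x" "1 \<le> A" and B: "B = b + 2 * y" and AB: "A * B = 1"
    and ab: "a * b = 1"
    and lam: "\<mu> = 2 / A + y / \<tau>"
    and EL: "2 * \<tau> * (1 - B\<^sup>2) = b * (x + y) + y\<^sup>2 - x\<^sup>2"
begin

definition w :: "pt \<Rightarrow> real" where "w z = max 0 (\<mu> - sd a b z / \<tau>)"

text \<open>The value of \<open>w\<close> on the vertical sides of the new rectangle away from the
  corners, where \<open>sd = - x\<close>. Since \<open>w\<close> decays at rate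
  \<open>1 / \<tau>\<close>, it is 0 beyond the distance \<open>K * \<tau>\<close> from these
  sides.\<close>

definition K :: real where "K = \<mu> + x / \<tau>"

lemma a_half: "a / 2 = A / 2 + x" and b_half: "b / 2 = B / 2 - y"
  unfolding A(1) B by (simp_all add: diff_divide_distrib add_divide_distrib)

lemma A_pos: "0 < A" and B_pos: "0 < B" and a_pos: "0 < a"
  using A B b x y by simp_all

lemma lam_pos: "0 < \<mu>"
  unfolding lam by (intro add_pos_pos divide_pos_pos A_pos y \<tau>) simp

lemma K_pos: "0 < K"
  unfolding K_def by (intro add_pos_pos divide_pos_pos lam_pos x \<tau>)

lemma b_le_1: "b \<le> 1"
proof -
  have "B \<le> A * B" using mult_right_mono[OF A(2), of B] B_pos by simp
  then show ?thesis using AB B y by simp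
qed

lemma w_nonneg: "0 \<le> w z" by (simp add: w_def)

lemma w_ge: "\<mu> - sd a b z / \<tau> \<le> w z" by (simp add: w_def)

lemma w_eq: "sd a b z \<le> \<mu> * \<tau> \<Longrightarrow> w z = \<mu> - sd a b z / \<tau>"
  using \<tau>(1) unfolding w_def by (intro max_absorb2) (simp add: field_simps)

lemma w_eq_0: "\<mu> * \<tau> \<le> sd a b z \<Longrightarrow> w z = 0"
  using \<tau>(1) unfolding w_def by (intro max_absorb1) (simp add: field_simps)

lemma w_le:
  assumes "c \<le> sd a b z" "0 \<le> \<mu> - c / \<tau>"
  shows "w z \<le> \<mu> - c / \<tau>"
  unfolding w_def using assms \<tau>(1) by (intro max.boundedI diff_left_mono divide_right_mono) auto

lemma w_mono: "\<bar>s'\<bar> \<le> \<bar>s\<bar> \<Longrightarrow> \<bar>t'\<bar> \<le> \<bar>t\<bar> \<Longrightarrow> w (s, t) \<le> w (s', t')"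
  unfolding w_def sd_def fst_conv snd_conv using \<tau>(1)
  by (intro max.mono order_refl diff_left_mono divide_right_mono diff_right_mono) auto

lemma continuous_w: "continuous_on UNIV w"
  unfolding w_def[abs_def] by (intro continuous_intros continuous_sd) (use \<tau> in auto)

lemma measurable_w [measurable]: "w \<in> borel_measurable borel"
  by (rule borel_measurable_continuous_onI[OF continuous_w])

definition Wmax :: real where "Wmax = \<mu> + b / (2 * \<tau>)"

lemma w_le_Wmax: "w z \<le> Wmax"
proof -
  have "- (b / 2) \<le> sd a b z" unfolding sd_def by (intro max.coboundedI2) simp
  moreover have "0 \<le> \<mu> - - (b / 2) / \<tau>" using lam_pos b \<tau>(1) by simp
  ultimately have "w z \<le> \<mu> - - (b / 2) / \<tau>" by (rule w_le)
  then show ?thesis by (simp add: Wmax_def)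
qed

lemma w_far_fst: "A / 2 + K * \<tau> < \<bar>s\<bar> \<Longrightarrow> w (s, t) = 0"
proof (rule w_eq_0)
  assume "A / 2 + K * \<tau> < \<bar>s\<bar>"
  moreover have "K * \<tau> = \<mu> * \<tau> + x" using \<tau>(1) by (simp add: K_def distrib_right)
  ultimately have "\<mu> * \<tau> \<le> \<bar>s\<bar> - a / 2" unfolding a_half by linarith
  then show "\<mu> * \<tau> \<le> sd a b (s, t)" unfolding sd_def fst_conv by (rule max.coboundedI1)
qed

lemma w_far_snd: "B / 2 + 2 * \<tau> / A < \<bar>t\<bar> \<Longrightarrow> w (s, t) = 0"
proof (rule w_eq_0)
  assume "B / 2 + 2 * \<tau> / A < \<bar>t\<bar>"
  moreover have "\<mu> * \<tau> = 2 * \<tau> / A + y" using \<tau>(1) by (simp add: lam distrib_right)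
  ultimately have "\<mu> * \<tau> \<le> \<bar>t\<bar> - b / 2" unfolding b_half by linarith
  then show "\<mu> * \<tau> \<le> sd a b (s, t)" unfolding sd_def snd_conv by (rule max.coboundedI2)
qed

text \<open>\<open>w\<close> vanishes outside the box with half sides \<open>L1\<close> and
  \<open>L2\<close>, which supplies an integrable majorant for all weighted integrals.\<close>

definition L1 :: real where "L1 = A / 2 + K * \<tau>"
definition L2 :: real where "L2 = B / 2 + 2 * \<tau> / A"

lemma weighted_bound:
  fixes p q :: "real \<Rightarrow> real"
  assumes "\<And>s. \<bar>p s\<bar> \<le> 1" "\<And>t. \<bar>q t\<bar> \<le> 1"
  shows "\<bar>p s * (q t * w (s, t))\<bar> \<le> Wmax * (indicator {-L1..L1} s * indicator {-L2..L2} t)"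
proof (cases "L1 < \<bar>s\<bar> \<or> L2 < \<bar>t\<bar>")
  case True
  then have "w (s, t) = 0" using w_far_fst w_far_snd by (auto simp: L1_def L2_def)
  moreover have "0 \<le> Wmax" using w_nonneg[of "(0, 0)"] w_le_Wmax[of "(0, 0)"] by linarith
  ultimately show ?thesis by simp
next
  case False
  have "\<bar>p s\<bar> * (\<bar>q t\<bar> * w (s, t)) \<le> 1 * (1 * Wmax)"
    by (intro mult_mono assms w_le_Wmax mult_nonneg_nonneg w_nonneg) simp_all
  moreover have "s \<in> {-L1..L1}" "t \<in> {-L2..L2}" using False by (auto simp: not_less abs_le_iff)
  ultimately show ?thesis by (simp add: abs_mult abs_of_nonneg[OF w_nonneg])
qed

text \<open>Stated for signed weights bounded by 1, so that it covers indicators as well as the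
  differences of indicators that describe a perturbed rectangle.\<close>

lemma weighted_fubini:
  fixes p q :: "real \<Rightarrow> real"
  assumes [measurable]: "p \<in> borel_measurable borel" "q \<in> borel_measurable borel"
    and bd: "\<And>s. \<bar>p s\<bar> \<le> 1" "\<And>t. \<bar>q t\<bar> \<le> 1"
  shows "integrable lborel (\<lambda>z. p (fst z) * (q (snd z) * w z))"
    and "integrable lborel (\<lambda>s. p s * (LINT t|lborel. q t * w (s, t)))"
    and "integrable lborel (\<lambda>t. q t * (LINT s|lborel. p s * w (s, t)))"
    and "(LINT z|lborel. p (fst z) * (q (snd z) * w z)) = (LINT s|lborel. p s * (LINT t|lborel. q t * w (s, t)))"
    and "(LINT z|lborel. p (fst z) * (q (snd z) * w z)) = (LINT t|lborel. q t * (LINT s|lborel. p s * w (s, t)))"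
proof -
  have [measurable]: "(fst :: pt \<Rightarrow> real) \<in> borel_measurable borel" "(snd :: pt \<Rightarrow> real) \<in> borel_measurable borel"
    by (auto intro!: borel_measurable_continuous_onI continuous_intros)
  show i: "integrable lborel (\<lambda>z. p (fst z) * (q (snd z) * w z))"
  proof (rule Bochner_Integration.integrable_bound)
    have "emeasure lborel (cbox (-L1, -L2) (L1, L2)) < \<infinity>" by (rule emeasure_bounded_finite[OF bounded_cbox])
    then show "integrable lborel (\<lambda>z. Wmax * indicator (cbox (-L1, -L2) (L1, L2)) z)"
      by (intro integrable_mult_right integrable_real_indicator) auto
    show "(\<lambda>z. p (fst z) * (q (snd z) * w z)) \<in> borel_measurable lborel" by measurable
    show "AE z in lborel. norm (p (fst z) * (q (snd z) * w z)) \<le> norm (Wmax * indicator (cbox (-L1, -L2) (L1, L2)) z)"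
    proof (rule AE_I2)
      fix z :: pt
      have "\<bar>p (fst z) * (q (snd z) * w (fst z, snd z))\<bar> \<le> Wmax * (indicator {-L1..L1} (fst z) * indicator {-L2..L2} (snd z))"
        by (rule weighted_bound[OF bd])
      also have "indicator {-L1..L1} (fst z) * indicator {-L2..L2} (snd z) = (indicator (cbox (-L1, -L2) (L1, L2)) z :: real)"
        by (cases z) (simp add: indicator_def cbox_Pair_eq)
      finally show "norm (p (fst z) * (q (snd z) * w z)) \<le> norm (Wmax * indicator (cbox (-L1, -L2) (L1, L2)) z)"
        unfolding real_norm_def prod.collapse by (rule order_trans[OF _ abs_ge_self])
    qed
  qed
  have i2: "integrable (lborel \<Otimes>\<^sub>M lborel) (\<lambda>(s, t). p s * (q t * w (s, t)))"
    using i by (simp add: lborel_prod case_prod_unfold)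
  have e1: "(LINT t|lborel. p s * (q t * w (s, t))) = p s * (LINT t|lborel. q t * w (s, t))" for s by simp
  have e2: "(LINT s|lborel. p s * (q t * w (s, t))) = q t * (LINT s|lborel. p s * w (s, t))" for t
    by (simp add: mult.left_commute[of "p _"])
  show "integrable lborel (\<lambda>s. p s * (LINT t|lborel. q t * w (s, t)))"
    using lborel_pair.integrable_fst[OF i2] unfolding e1 .
  show "integrable lborel (\<lambda>t. q t * (LINT s|lborel. p s * w (s, t)))"
    using lborel_pair.integrable_snd[OF i2] unfolding e2 .
  show "(LINT z|lborel. p (fst z) * (q (snd z) * w z)) = (LINT s|lborel. p s * (LINT t|lborel. q t * w (s, t)))"
    using lborel_pair.integral_fst[OF i2] unfolding e1 by (simp add: lborel_prod case_prod_unfold)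
  show "(LINT z|lborel. p (fst z) * (q (snd z) * w z)) = (LINT t|lborel. q t * (LINT s|lborel. p s * w (s, t)))"
    using lborel_pair.integral_snd[OF i2] unfolding e2 by (simp add: lborel_prod case_prod_unfold)
qed

lemma weighted_slices:
  fixes p q :: "real \<Rightarrow> real"
  assumes "p \<in> borel_measurable borel" "q \<in> borel_measurable borel"
    and bd: "\<And>s. \<bar>p s\<bar> \<le> 1" "\<And>t. \<bar>q t\<bar> \<le> 1"
  shows "integrable lborel (\<lambda>t. q t * w (s, t))" "integrable lborel (\<lambda>s. p s * w (s, t))"
proof -
  have m: "(\<lambda>t. w (s, t)) \<in> borel_measurable borel" "(\<lambda>s. w (s, t)) \<in> borel_measurable borel"
    by (rule measurable_Pair_fst[OF measurable_w])+
  show "integrable lborel (\<lambda>t. q t * w (s, t))"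
  proof (rule Bochner_Integration.integrable_bound)
    show "integrable lborel (\<lambda>t. Wmax * indicator {-L2..L2} t)"
      by (intro integrable_mult_right integrable_real_indicator) (auto simp: emeasure_lborel_Icc_eq)
    show "(\<lambda>t. q t * w (s, t)) \<in> borel_measurable lborel" using m assms(2) by simp
    show "AE t in lborel. norm (q t * w (s, t)) \<le> norm (Wmax * indicator {-L2..L2} t)"
    proof (rule AE_I2)
      fix t
      have 0: "0 \<le> Wmax" using w_nonneg[of "(0, 0)"] w_le_Wmax[of "(0, 0)"] by linarith
      have "\<bar>1 * (q t * w (s, t))\<bar> \<le> Wmax * (indicator {-L1..L1} s * indicator {-L2..L2} t)"
        by (rule weighted_bound[of "\<lambda>_. 1" q]) (use bd in simp_all)
      also have "\<dots> \<le> Wmax * (1 * indicator {-L2..L2} t)"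
        by (intro mult_left_mono mult_right_mono 0) (simp_all add: indicator_def)
      finally show "norm (q t * w (s, t)) \<le> norm (Wmax * indicator {-L2..L2} t)"
        unfolding real_norm_def mult_1 by (rule order_trans[OF _ abs_ge_self])
    qed
  qed
  show "integrable lborel (\<lambda>s. p s * w (s, t))"
  proof (rule Bochner_Integration.integrable_bound)
    show "integrable lborel (\<lambda>s. Wmax * indicator {-L1..L1} s)"
      by (intro integrable_mult_right integrable_real_indicator) (auto simp: emeasure_lborel_Icc_eq)
    show "(\<lambda>s. p s * w (s, t)) \<in> borel_measurable lborel" using m assms(1) by simp
    show "AE s in lborel. norm (p s * w (s, t)) \<le> norm (Wmax * indicator {-L1..L1} s)"
    proof (rule AE_I2)
      fix s
      have 0: "0 \<le> Wmax" using w_nonneg[of "(0, 0)"] w_le_Wmax[of "(0, 0)"] by linarith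
      have "\<bar>p s * (1 * w (s, t))\<bar> \<le> Wmax * (indicator {-L1..L1} s * indicator {-L2..L2} t)"
        by (rule weighted_bound[of p "\<lambda>_. 1"]) (use bd in simp_all)
      also have "\<dots> \<le> Wmax * (indicator {-L1..L1} s * 1)"
        by (intro mult_left_mono 0) (simp_all add: indicator_def)
      finally show "norm (p s * w (s, t)) \<le> norm (Wmax * indicator {-L1..L1} s)"
        unfolding real_norm_def mult_1 mult_1_right by (rule order_trans[OF _ abs_ge_self])
    qed
  qed
qed

lemma indicator_weights:
  fixes S :: "real set"
  assumes "S \<in> sets borel"
  shows "(indicator S :: real \<Rightarrow> real) \<in> borel_measurable borel" "\<And>s. \<bar>indicator S s :: real\<bar> \<le> 1"
  using assms by (auto simp: indicator_def)

section \<open>Averages of the weight along the sides of the new rectangle\<close>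

definition U :: "real set \<Rightarrow> real set \<Rightarrow> real" where
  "U S T = (LINT z|lborel. indicator S (fst z) * (indicator T (snd z) * w z))"

definition I :: "real set" where "I = {- A / 2..A / 2}"
definition J :: "real set" where "J = {- B / 2..B / 2}"
text \<open>The first variations of \<open>U\<close> at the pair \<open>I\<close>, \<open>J\<close>:
  \<open>\<omega>1 s\<close> is the gain from adding a column at \<open>s\<close>,
  \<open>\<omega>2 t\<close> the gain from adding a row at \<open>t\<close>. Each is to be compared
  with the perimeter price 2 of one more line.\<close>

definition \<omega>1 :: "real \<Rightarrow> real" where "\<omega>1 s = (LINT t|lborel. indicator J t * w (s, t))"
definition \<omega>2 :: "real \<Rightarrow> real" where "\<omega>2 t = (LINT s|lborel. indicator I s * w (s, t))"

lemma I_borel [measurable, simp]: "I \<in> sets borel" and J_borel [measurable, simp]: "J \<in> sets borel"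
  by (simp_all add: I_def J_def)

lemma mem_I: "s \<in> I \<longleftrightarrow> \<bar>s\<bar> \<le> A / 2" and mem_J: "t \<in> J \<longleftrightarrow> \<bar>t\<bar> \<le> B / 2"
  by (auto simp: I_def J_def abs_le_iff)

lemma slice_integral_mono:
  assumes S: "S \<in> sets borel"
  shows "\<bar>t'\<bar> \<le> \<bar>t\<bar> \<Longrightarrow> (LINT s|lborel. indicator S s * w (s, t)) \<le> (LINT s|lborel. indicator S s * w (s, t'))"
    and "\<bar>s'\<bar> \<le> \<bar>s\<bar> \<Longrightarrow> (LINT t|lborel. indicator S t * w (s, t)) \<le> (LINT t|lborel. indicator S t * w (s', t))"
  using weighted_slices[OF indicator_weights(1)[OF S] indicator_weights(1)[OF S] indicator_weights(2)[OF S] indicator_weights(2)[OF S]]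
  by (auto intro!: integral_mono mult_left_mono w_mono)

lemma \<omega>1_mono: "\<bar>s'\<bar> \<le> \<bar>s\<bar> \<Longrightarrow> \<omega>1 s \<le> \<omega>1 s'"
  unfolding \<omega>1_def by (rule slice_integral_mono(2)) simp_all

lemma \<omega>2_mono: "\<bar>t'\<bar> \<le> \<bar>t\<bar> \<Longrightarrow> \<omega>2 t \<le> \<omega>2 t'"
  unfolding \<omega>2_def by (rule slice_integral_mono(1)) simp_all

lemma sd_le_y: "\<bar>s\<bar> \<le> A / 2 \<Longrightarrow> \<bar>t\<bar> \<le> B / 2 + u \<Longrightarrow> 0 \<le> u \<Longrightarrow> sd a b (s, t) \<le> y + u"
  unfolding sd_def fst_conv snd_conv a_half b_half using x y by (intro max.boundedI) linarith+

lemma y_le: "y \<le> \<mu> * \<tau>"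
proof -
  have "\<mu> * \<tau> = 2 * \<tau> / A + y" using \<tau>(1) by (simp add: lam distrib_right)
  then show ?thesis using A_pos \<tau>(1) by simp
qed

text \<open>Along a vertical side \<open>sd\<close> is constantly \<open>- x\<close> up to distance
  \<open>x + y\<close> from the corners and then rises linearly to \<open>y\<close>. The integral of
  \<open>w\<close> is therefore \<open>\<mu> * B + (x * B - (x + y)\<^sup>2) / \<tau>\<close>, and
  \<open>EL\<close> is the statement that this equals 2.\<close>

lemma \<omega>1_side:
  assumes s: "\<bar>s\<bar> = A / 2"
  shows "\<omega>1 s = 2"
proof -
  \<comment> \<open>\<open>max (- x) (\<bar>t\<bar> - b / 2)\<close> is rewritten as
    \<open>- x\<close> plus two positive parts, at most one of which is nonzero since
    \<open>x < b / 2\<close>. This form has the explicit primitive \<open>F\<close>.\<close>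
  define f where "f t = \<mu> - (- x + pos_part (t - b / 2 + x) + pos_part (- t - b / 2 + x)) / \<tau>" for t
  define F where "F t = \<mu> * t - (- x * t + pos_part (t - b / 2 + x) ^ 2 / 2 - pos_part (- t - b / 2 + x) ^ 2 / 2) / \<tau>" for t
  have bx: "x < b / 2" using x b by linarith
  have wf: "w (s, t) = f t" if "t \<in> J" for t
  proof -
    have "sd a b (s, t) \<le> y" using sd_le_y[of s t 0] s that mem_J by simp
    then have "w (s, t) = \<mu> - sd a b (s, t) / \<tau>" using y_le by (intro w_eq) linarith
    also have "sd a b (s, t) = max (- x) (\<bar>t\<bar> - b / 2)" unfolding sd_def fst_conv snd_conv s a_half by simp
    also have "\<dots> = - x + pos_part (t - b / 2 + x) + pos_part (- t - b / 2 + x)"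
    proof (cases "0 \<le> t")
      case True
      then have "pos_part (- t - b / 2 + x) = 0" using bx by (simp add: pos_part_def)
      then show ?thesis using True by (simp add: pos_part_def max_def)
    next
      case False
      then have "pos_part (t - b / 2 + x) = 0" using bx by (simp add: pos_part_def)
      then show ?thesis using False by (simp add: pos_part_def max_def)
    qed
    finally show ?thesis by (simp only: f_def)
  qed
  have d1: "((\<lambda>t. pos_part (t - b / 2 + x) ^ 2) has_real_derivative 2 * pos_part (t - b / 2 + x)) (at t)" for t
    by (rule DERIV_chain2[where g = "\<lambda>t. t - b / 2 + x", OF DERIV_pos_part_power, THEN DERIV_cong])
       (auto intro!: derivative_eq_intros)
  have d2: "((\<lambda>t. pos_part (- t - b / 2 + x) ^ 2) has_real_derivative - 2 * pos_part (- t - b / 2 + x)) (at t)" for t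
  proof -
    have "((\<lambda>t. - t - b / 2 + x) has_real_derivative - 1) (at t)" by (auto intro!: derivative_eq_intros)
    from DERIV_chain2[OF DERIV_pos_part_power[of 2 "- t - b / 2 + x"] this] show ?thesis by simp
  qed
  have dF: "(F has_real_derivative f t) (at t)" for t
  proof -
    have "(F has_real_derivative \<mu> * 1 - (- x * 1 + 2 * pos_part (t - b / 2 + x) / 2 - - 2 * pos_part (- t - b / 2 + x) / 2) / \<tau>) (at t)"
      unfolding F_def[abs_def]
      by (intro DERIV_diff DERIV_cmult DERIV_ident DERIV_cdivide DERIV_add d1 d2)
    then show ?thesis by (simp add: f_def)
  qed
  have cf: "continuous_on UNIV f" unfolding f_def[abs_def] by (intro continuous_intros) (use \<tau> in auto)
  have "\<omega>1 s = (LINT t|lborel. f t * indicator {- B / 2..B / 2} t)"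
    unfolding \<omega>1_def by (intro Bochner_Integration.integral_cong) (auto simp: indicator_def wf J_def)
  also have "\<dots> = F (B / 2) - F (- B / 2)"
    by (rule integral_FTC_Icc_real) (use B_pos dF cf in \<open>auto simp: continuous_on_eq_continuous_at\<close>)
  also have "F (B / 2) = \<mu> * (B / 2) - (- x * (B / 2) + (x + y)\<^sup>2 / 2) / \<tau>"
  proof -
    have "B / 2 - b / 2 + x = x + y" "- (B / 2) - b / 2 + x \<le> 0" using b_half bx B_pos by linarith+
    then show ?thesis using x y unfolding F_def by (simp add: pos_part_def)
  qed
  also have "F (- B / 2) = - (\<mu> * (B / 2)) - (x * (B / 2) - (x + y)\<^sup>2 / 2) / \<tau>"
  proof -
    have "- (- B / 2) - b / 2 + x = x + y" "- B / 2 - b / 2 + x \<le> 0" using b_half bx B_pos by linarith+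
    then show ?thesis using x y unfolding F_def by (simp add: pos_part_def)
  qed
  also have "\<mu> * (B / 2) - (- x * (B / 2) + (x + y)\<^sup>2 / 2) / \<tau> - (- (\<mu> * (B / 2)) - (x * (B / 2) - (x + y)\<^sup>2 / 2) / \<tau>)
      = \<mu> * B + (x * B - (x + y)\<^sup>2) / \<tau>" by (simp add: diff_divide_distrib add_divide_distrib)
  also have "\<dots> = 2"
  proof -
    have "2 / A = 2 * B" using AB A_pos by (simp add: field_simps)
    then have "\<mu> * B = 2 * B\<^sup>2 + y * B / \<tau>" by (simp add: lam distrib_right power2_eq_square)
    then have "(\<mu> * B + (x * B - (x + y)\<^sup>2) / \<tau>) * \<tau> = 2 * \<tau> * B\<^sup>2 + y * B + x * B - (x + y)\<^sup>2"
      using \<tau>(1) by (simp add: distrib_right)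
    \<comment> \<open>The origin of the right side of \<open>EL\<close>: with
      \<open>B = b + 2 * y\<close> one has
      \<open>(x + y) * B - (x + y)\<^sup>2 = (x + y) * (b + y - x)\<close>.\<close>
    also have "\<dots> = 2 * \<tau> * B\<^sup>2 + (b * (x + y) + y\<^sup>2 - x\<^sup>2)" unfolding B by (simp add: power2_eq_square algebra_simps)
    also have "\<dots> = 2 * \<tau>" unfolding EL[symmetric] by (simp add: algebra_simps)
    finally show ?thesis using \<tau>(1) by simp
  qed
  finally show ?thesis .
qed

lemma \<omega>1_bounds: "\<bar>s\<bar> \<le> A / 2 \<Longrightarrow> 2 \<le> \<omega>1 s" "A / 2 \<le> \<bar>s\<bar> \<Longrightarrow> \<omega>1 s \<le> 2"
proof -
  have h: "\<bar>A / 2\<bar> = A / 2" using A_pos by simp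
  show "\<bar>s\<bar> \<le> A / 2 \<Longrightarrow> 2 \<le> \<omega>1 s" using \<omega>1_mono[of s "A / 2"] \<omega>1_side[OF h] h by simp
  show "A / 2 \<le> \<bar>s\<bar> \<Longrightarrow> \<omega>1 s \<le> 2" using \<omega>1_mono[of "A / 2" s] \<omega>1_side[OF h] h by simp
qed

text \<open>Moving outward by \<open>u\<close> lowers \<open>w\<close> by at least
  \<open>u / \<tau>\<close> on the flat middle part of the side, and monotonicity suffices near the
  corners. The bound \<open>u \<le> K * \<tau>\<close> ensures that the truncation of
  \<open>w\<close> at 0 does not cut off the drop.\<close>

lemma \<omega>1_drop:
  assumes s: "\<bar>s\<bar> = A / 2 + u" and u: "0 \<le> u" "u \<le> K * \<tau>"
  shows "\<omega>1 s \<le> 2 - 10 * u"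
proof -
  \<comment> \<open>The part of the side where \<open>sd = - x\<close>. Its length
    \<open>b - 2 * x\<close> is at least \<open>10 * \<tau>\<close> because
    \<open>4 * x \<le> b\<close> and \<open>20 * \<tau> \<le> b\<close>; this is the source of the
    rate 10.\<close>
  define M where "M = {- (b / 2 - x)..b / 2 - x}"
  have bx: "0 \<le> b / 2 - x" using x b by linarith
  have h: "\<bar>A / 2\<bar> = A / 2" using A_pos by simp
  have pt: "indicator J t * w (s, t) \<le> indicator J t * w (A / 2, t) - u / \<tau> * indicator M t" for t
  proof (cases "t \<in> M")
    case False
    then show ?thesis using w_mono[of "A / 2" s t t] s u h by (auto simp: indicator_def)
  next
    case True
    then have t: "\<bar>t\<bar> - b / 2 \<le> - x" by (auto simp: M_def abs_le_iff)
    then have tJ: "t \<in> J" using mem_J b_half x y by simp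
    have "sd a b (A / 2, t) = max (- x) (\<bar>t\<bar> - b / 2)" unfolding sd_def fst_conv snd_conv h a_half by simp
    also have "\<dots> = - x" using t by (rule max_absorb1)
    finally have "sd a b (A / 2, t) = - x" .
    moreover have "- x \<le> \<mu> * \<tau>" using y_le x y by linarith
    ultimately have w1: "w (A / 2, t) = K" using w_eq[of "(A / 2, t)"] by (simp add: K_def)
    have "u - x \<le> sd a b (s, t)" unfolding sd_def fst_conv snd_conv s a_half by (intro max.coboundedI1) simp
    moreover have e: "\<mu> - (u - x) / \<tau> = K - u / \<tau>" by (simp add: K_def diff_divide_distrib)
    moreover have "0 \<le> K - u / \<tau>" using u \<tau>(1) by (simp add: field_simps)
    ultimately have "w (s, t) \<le> K - u / \<tau>" using w_le[of "u - x" "(s, t)"] by simp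
    then show ?thesis using w1 tJ True by simp
  qed
  have iM: "integrable lborel (\<lambda>t. u / \<tau> * indicator M t :: real)"
    unfolding M_def by (intro integrable_mult_right integrable_real_indicator) (auto simp: emeasure_lborel_Icc_eq)
  have iJ: "integrable lborel (\<lambda>t. indicator J t * w (r, t))" for r
    by (rule weighted_slices(1)[of "indicator J" "indicator J"]) (rule indicator_weights[OF J_borel])+
  have "\<omega>1 s \<le> (LINT t|lborel. indicator J t * w (A / 2, t) - u / \<tau> * indicator M t)"
    unfolding \<omega>1_def by (intro integral_mono Bochner_Integration.integrable_diff iM iJ pt)
  also have "\<dots> = \<omega>1 (A / 2) - u / \<tau> * (b - 2 * x)"
  proof -
    have "(LINT t|lborel. u / \<tau> * indicator M t) = u / \<tau> * (b - 2 * x)" using bx by (simp add: M_def)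
    then show ?thesis unfolding \<omega>1_def Bochner_Integration.integral_diff[OF iJ iM] by simp
  qed
  also have "\<dots> \<le> 2 - 10 * u"
  proof -
    have "10 * \<tau> \<le> b - 2 * x" using \<tau>(2) x by linarith
    then have "u / \<tau> * (10 * \<tau>) \<le> u / \<tau> * (b - 2 * x)" using u \<tau>(1) by (intro mult_left_mono) auto
    moreover have "u / \<tau> * (10 * \<tau>) = 10 * u" using \<tau>(1) by simp
    ultimately show ?thesis using \<omega>1_side[OF h] by linarith
  qed
  finally show ?thesis .
qed

text \<open>The horizontal sides move outward, to a height where the vertical excess dominates:
  \<open>sd = y + u\<close> for every \<open>s\<close> in \<open>I\<close>. So \<open>w\<close> is
  constant along the segment, and the choice of \<open>\<mu>\<close> makes the average 2 at
  \<open>u = 0\<close>.\<close>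

lemma \<omega>2_eq:
  assumes t: "\<bar>t\<bar> = B / 2 + u" and u: "0 \<le> u" "u \<le> 2 * \<tau> / A"
  shows "\<omega>2 t = 2 - A * u / \<tau>"
proof -
  have w: "w (s, t) = 2 / A - u / \<tau>" if "s \<in> I" for s
  proof -
    have "\<bar>s\<bar> - a / 2 \<le> y + u" using that mem_I[of s] a_half x y u by linarith
    then have "sd a b (s, t) = y + u" unfolding sd_def fst_conv snd_conv t b_half by (simp add: max_def)
    moreover have "y + u \<le> \<mu> * \<tau>" using u(2) \<tau>(1) by (simp add: lam distrib_right)
    ultimately show ?thesis using w_eq[of "(s, t)"] by (simp add: lam add_divide_distrib)
  qed
  have "\<omega>2 t = (LINT s|lborel. indicator I s * (2 / A - u / \<tau>))"
    unfolding \<omega>2_def by (intro Bochner_Integration.integral_cong) (auto simp: indicator_def w)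
  also have "\<dots> = A * (2 / A - u / \<tau>)" using A_pos by (simp add: I_def)
  also have "\<dots> = 2 - A * u / \<tau>" using A_pos by (simp add: right_diff_distrib)
  finally show ?thesis .
qed

lemma \<omega>2_side: "\<bar>t\<bar> = B / 2 \<Longrightarrow> \<omega>2 t = 2"
  using \<omega>2_eq[of t 0] A_pos \<tau>(1) by simp

lemma \<omega>2_bounds: "\<bar>t\<bar> \<le> B / 2 \<Longrightarrow> 2 \<le> \<omega>2 t" "B / 2 \<le> \<bar>t\<bar> \<Longrightarrow> \<omega>2 t \<le> 2"
proof -
  have h: "\<bar>B / 2\<bar> = B / 2" using B_pos by simp
  show "\<bar>t\<bar> \<le> B / 2 \<Longrightarrow> 2 \<le> \<omega>2 t" using \<omega>2_mono[of t "B / 2"] \<omega>2_side[OF h] h by simp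
  show "B / 2 \<le> \<bar>t\<bar> \<Longrightarrow> \<omega>2 t \<le> 2" using \<omega>2_mono[of "B / 2" t] \<omega>2_side[OF h] h by simp
qed

text \<open>The slope is \<open>A / \<tau>\<close>, and
  \<open>A \<ge> 1 \<ge> b \<ge> 20 * \<tau>\<close> leaves ample room for the same rate 10.\<close>

lemma \<omega>2_drop:
  assumes t: "\<bar>t\<bar> = B / 2 + u" and u: "0 \<le> u" "u \<le> 2 * \<tau> / A"
  shows "\<omega>2 t \<le> 2 - 10 * u"
proof -
  have "10 * \<tau> \<le> A" using \<tau> b_le_1 A(2) by linarith
  then have "10 * u * \<tau> \<le> A * u" using mult_right_mono[OF \<open>10 * \<tau> \<le> A\<close> u(1)] by (simp add: ac_simps)
  then have "10 * u \<le> A * u / \<tau>" using \<tau>(1) by (simp add: pos_le_divide_eq)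
  then show ?thesis unfolding \<omega>2_eq[OF assms] by simp
qed

text \<open>Monotonicity reduces a distant point to a nearer one at which the drop estimates are
  valid; hence the minimum in the choice of \<open>u\<close>.\<close>

lemma \<omega>_strict: "A / 2 < \<bar>s\<bar> \<Longrightarrow> \<omega>1 s < 2" "B / 2 < \<bar>t\<bar> \<Longrightarrow> \<omega>2 t < 2"
proof -
  assume s: "A / 2 < \<bar>s\<bar>"
  define u where "u = min (\<bar>s\<bar> - A / 2) (K * \<tau>)"
  have u: "0 < u" "u \<le> K * \<tau>" "A / 2 + u \<le> \<bar>s\<bar>" using s K_pos \<tau>(1) by (auto simp: u_def)
  have h: "\<bar>A / 2 + u\<bar> = A / 2 + u" using u A_pos by simp
  have "\<omega>1 s \<le> \<omega>1 (A / 2 + u)" using u h by (intro \<omega>1_mono) simp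
  also have "\<dots> \<le> 2 - 10 * u" using u by (intro \<omega>1_drop h) auto
  finally show "\<omega>1 s < 2" using u by simp
next
  assume t: "B / 2 < \<bar>t\<bar>"
  define u where "u = min (\<bar>t\<bar> - B / 2) (2 * \<tau> / A)"
  have u: "0 < u" "u \<le> 2 * \<tau> / A" "B / 2 + u \<le> \<bar>t\<bar>" using t A_pos \<tau>(1) by (auto simp: u_def)
  have h: "\<bar>B / 2 + u\<bar> = B / 2 + u" using u B_pos by simp
  have "\<omega>2 t \<le> \<omega>2 (B / 2 + u)" using u h by (intro \<omega>2_mono) simp
  also have "\<dots> \<le> 2 - 10 * u" using u by (intro \<omega>2_drop h) auto
  finally show "\<omega>2 t < 2" using u by simp
qed

text \<open>At and beyond the height of the horizontal sides \<open>w\<close> is at most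
  \<open>2 / A\<close>, and \<open>A \<ge> 1\<close>.\<close>

lemma w_corner: "B / 2 \<le> \<bar>t\<bar> \<Longrightarrow> w (s, t) \<le> 2"
proof -
  assume t: "B / 2 \<le> \<bar>t\<bar>"
  have "y \<le> sd a b (s, t)" unfolding sd_def fst_conv snd_conv b_half using t by (intro max.coboundedI2) linarith
  moreover have "\<mu> - y / \<tau> = 2 / A" by (simp add: lam)
  moreover have "2 / A \<le> 2" "0 \<le> 2 / A" using A(2) by (simp_all add: field_simps)
  ultimately show ?thesis using w_le[of y "(s, t)"] by simp
qed

text \<open>Moving the sides of the optimal rectangle changes the first-order terms as prescribed by the
  side averages; the gain in the new corners is a product and is absorbed by the quadratic losses.\<close>

lemma centered_rectangles:
  assumes \<alpha>\<beta>: "0 \<le> \<alpha>" "0 \<le> \<beta>" "1 \<le> \<alpha> * \<beta>"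
  shows "U {- \<alpha> / 2..\<alpha> / 2} {- \<beta> / 2..\<beta> / 2} \<le> U I J + 2 * (\<alpha> - A) + 2 * (\<beta> - B)" (is "?U \<le> _")
    and "U {- \<alpha> / 2..\<alpha> / 2} {- \<beta> / 2..\<beta> / 2} = U I J + 2 * (\<alpha> - A) + 2 * (\<beta> - B) \<Longrightarrow> \<alpha> = A \<and> \<beta> = B"
proof -
  define X where "X = {- \<alpha> / 2..\<alpha> / 2}"
  define Y where "Y = {- \<beta> / 2..\<beta> / 2}"
  have mX: "s \<in> X \<longleftrightarrow> \<bar>s\<bar> \<le> \<alpha> / 2" and mY: "s \<in> Y \<longleftrightarrow> \<bar>s\<bar> \<le> \<beta> / 2" for s
    by (auto simp: X_def Y_def abs_le_iff)
  have XY: "X \<in> sets borel" "Y \<in> sets borel" by (simp_all add: X_def Y_def)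
  have len: "measure lborel X = \<alpha>" "measure lborel Y = \<beta>" "measure lborel I = A" "measure lborel J = B"
    using \<alpha>\<beta> A_pos B_pos by (simp_all add: X_def Y_def I_def J_def)
  have ii: "integrable lborel (indicator X :: real \<Rightarrow> real)" "integrable lborel (indicator Y :: real \<Rightarrow> real)"
    "integrable lborel (indicator I :: real \<Rightarrow> real)" "integrable lborel (indicator J :: real \<Rightarrow> real)"
    unfolding X_def Y_def I_def J_def by (auto intro!: integrable_real_indicator simp: emeasure_lborel_Icc_eq)
  define p where "p s = (indicator X s - indicator I s :: real)" for s
  define q where "q t = (indicator Y t - indicator J t :: real)" for t
  have p: "p \<in> borel_measurable borel" "\<bar>p s\<bar> \<le> 1" and q: "q \<in> borel_measurable borel" "\<bar>q s\<bar> \<le> 1" for s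
    unfolding p_def[abs_def] q_def[abs_def] using XY by (auto simp: indicator_def)
  note wI = indicator_weights[OF I_borel] and wJ = indicator_weights[OF J_borel]
  \<comment> \<open>How far the vertical side moves outward: clipped at the distance
    \<open>K * \<tau>\<close> beyond which \<open>w\<close> is 0, and set to 0 for inward motion.
    \<open>Q\<close> is the analogue for the horizontal side.\<close>
  define P where "P = max 0 (min ((\<alpha> - A) / 2) (K * \<tau>))"
  define Q where "Q = max 0 (min ((\<beta> - B) / 2) (2 * \<tau> / A))"
  have P0: "0 \<le> P" "P \<le> K * \<tau>" using K_pos \<tau>(1) by (auto simp: P_def)
  have Q0: "0 \<le> Q" "Q \<le> 2 * \<tau> / A" using A_pos \<tau>(1) by (auto simp: Q_def)
  have P1: "A / 2 + P \<le> \<alpha> / 2" if "0 < P"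
  proof -
    have "P = min ((\<alpha> - A) / 2) (K * \<tau>)" using that unfolding P_def by linarith
    then have "P \<le> (\<alpha> - A) / 2" by (simp only: min.cobounded1)
    then show ?thesis by (simp add: diff_divide_distrib)
  qed
  have Q1: "B / 2 + Q \<le> \<beta> / 2" if "0 < Q"
  proof -
    have "Q = min ((\<beta> - B) / 2) (2 * \<tau> / A)" using that unfolding Q_def by linarith
    then have "Q \<le> (\<beta> - B) / 2" by (simp only: min.cobounded1)
    then show ?thesis by (simp add: diff_divide_distrib)
  qed
  have P2: "r \<le> A / 2 + P" if "A / 2 < r" "r \<le> \<alpha> / 2" "r \<le> A / 2 + K * \<tau>" for r
  proof -
    have "r - A / 2 \<le> min ((\<alpha> - A) / 2) (K * \<tau>)" using that by (intro min.boundedI) (simp_all add: field_simps)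
    also have "\<dots> \<le> P" unfolding P_def by (rule max.cobounded2)
    finally show ?thesis by simp
  qed
  have Q2: "r \<le> B / 2 + Q" if "B / 2 < r" "r \<le> \<beta> / 2" "r \<le> B / 2 + 2 * \<tau> / A" for r
  proof -
    have "r - B / 2 \<le> min ((\<beta> - B) / 2) (2 * \<tau> / A)" using that by (intro min.boundedI) (simp_all add: field_simps)
    also have "\<dots> \<le> Q" unfolding Q_def by (rule max.cobounded2)
    finally show ?thesis by simp
  qed
  \<comment> \<open>The outer half of the extension suffices: there the distance to the side exceeds
    \<open>P / 2\<close>, so \<open>\<omega>1\<close> lies below 2 by at least \<open>5 * P\<close>
    on a set of measure \<open>P\<close>, a loss of \<open>5 * P\<^sup>2\<close>.\<close>
  define OP where "OP = {s. A / 2 + P / 2 < \<bar>s\<bar> \<and> \<bar>s\<bar> \<le> A / 2 + P}"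
  define OQ where "OQ = {t. B / 2 + Q / 2 < \<bar>t\<bar> \<and> \<bar>t\<bar> \<le> B / 2 + Q}"
  have OP: "OP \<in> sets borel" "emeasure lborel OP = ennreal P"
    using annulus[of "A / 2 + P / 2" "A / 2 + P"] A_pos P0 unfolding OP_def by simp_all
  have OQ: "OQ \<in> sets borel" "emeasure lborel OQ = ennreal Q"
    using annulus[of "B / 2 + Q / 2" "B / 2 + Q"] B_pos Q0 unfolding OQ_def by simp_all
  have iO: "integrable lborel (indicator OP :: real \<Rightarrow> real)" "integrable lborel (indicator OQ :: real \<Rightarrow> real)"
    using OP OQ by (auto intro!: integrable_real_indicator)
  have mO: "measure lborel OP = P" "measure lborel OQ = Q" using OP OQ P0 Q0 by (simp_all add: measure_def)
  have T1: "(LINT s|lborel. p s * \<omega>1 s) \<le> 2 * (\<alpha> - A) - 5 * P\<^sup>2"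
  proof -
    have pt: "p s * \<omega>1 s \<le> 2 * (indicator X s - indicator I s) - 5 * P * indicator OP s" for s
    proof (cases "s \<in> OP")
      case True
      then have s: "A / 2 + P / 2 < \<bar>s\<bar>" "\<bar>s\<bar> \<le> A / 2 + P" by (auto simp: OP_def)
      then have "0 < P" using P0 by linarith
      then have "s \<in> X" "s \<notin> I" using P1 s mX mem_I P0 by auto
      moreover have "\<omega>1 s \<le> 2 - 10 * (\<bar>s\<bar> - A / 2)" using s P0 \<open>0 < P\<close> by (intro \<omega>1_drop) auto
      ultimately show ?thesis using True s by (simp add: p_def)
    next
      case False
      consider "s \<in> X" "s \<in> I" | "s \<in> X" "s \<notin> I" | "s \<notin> X" "s \<in> I" | "s \<notin> X" "s \<notin> I" by blast
      then show ?thesis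
        using False \<omega>1_bounds[of s] mem_I[of s] by cases (simp_all add: p_def)
    qed
    have "(LINT s|lborel. p s * \<omega>1 s) \<le> (LINT s|lborel. 2 * (indicator X s - indicator I s) - 5 * P * indicator OP s)"
    proof (rule integral_mono)
      show "integrable lborel (\<lambda>s. p s * \<omega>1 s)"
        using weighted_fubini(2)[OF p(1) wJ(1) p(2) wJ(2)] by (simp add: \<omega>1_def)
      show "integrable lborel (\<lambda>s. 2 * (indicator X s - indicator I s) - 5 * P * indicator OP s :: real)"
        by (intro Bochner_Integration.integrable_diff integrable_mult_right ii iO)
    qed (rule pt)
    also have "\<dots> = 2 * (\<alpha> - A) - 5 * P * P" using ii iO len mO XY OP(1) by simp
    finally show ?thesis by (simp add: power2_eq_square)
  qed
  have T2: "(LINT t|lborel. q t * \<omega>2 t) \<le> 2 * (\<beta> - B) - 5 * Q\<^sup>2"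
  proof -
    have pt: "q s * \<omega>2 s \<le> 2 * (indicator Y s - indicator J s) - 5 * Q * indicator OQ s" for s
    proof (cases "s \<in> OQ")
      case True
      then have s: "B / 2 + Q / 2 < \<bar>s\<bar>" "\<bar>s\<bar> \<le> B / 2 + Q" by (auto simp: OQ_def)
      then have "0 < Q" using Q0 by linarith
      then have "s \<in> Y" "s \<notin> J" using Q1 s mY mem_J Q0 by auto
      moreover have "\<omega>2 s \<le> 2 - 10 * (\<bar>s\<bar> - B / 2)" using s Q0 \<open>0 < Q\<close> by (intro \<omega>2_drop) auto
      ultimately show ?thesis using True s by (simp add: q_def)
    next
      case False
      consider "s \<in> Y" "s \<in> J" | "s \<in> Y" "s \<notin> J" | "s \<notin> Y" "s \<in> J" | "s \<notin> Y" "s \<notin> J" by blast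
      then show ?thesis
        using False \<omega>2_bounds[of s] mem_J[of s] by cases (simp_all add: q_def)
    qed
    have "(LINT s|lborel. q s * \<omega>2 s) \<le> (LINT s|lborel. 2 * (indicator Y s - indicator J s) - 5 * Q * indicator OQ s)"
    proof (rule integral_mono)
      show "integrable lborel (\<lambda>s. q s * \<omega>2 s)"
        using weighted_fubini(3)[OF wI(1) q(1) wI(2) q(2)] by (simp add: \<omega>2_def)
      show "integrable lborel (\<lambda>s. 2 * (indicator Y s - indicator J s) - 5 * Q * indicator OQ s :: real)"
        by (intro Bochner_Integration.integrable_diff integrable_mult_right ii iO)
    qed (rule pt)
    also have "\<dots> = 2 * (\<beta> - B) - 5 * Q * Q" using ii iO len mO XY OQ(1) by simp
    finally show ?thesis by (simp add: power2_eq_square)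
  qed
  \<comment> \<open>The area constraint forbids shrinking both sides at once. This excludes one of
    the two cases in which \<open>p\<close> and \<open>q\<close> have the same nonzero sign.\<close>
  have nn: "\<not> (\<alpha> < A \<and> \<beta> < B)"
  proof
    assume "\<alpha> < A \<and> \<beta> < B"
    then have "\<alpha> * \<beta> < A * B" using \<alpha>\<beta> by (intro mult_strict_mono') auto
    then show False using \<alpha>\<beta>(3) AB by simp
  qed
  define CP where "CP = {s. A / 2 < \<bar>s\<bar> \<and> \<bar>s\<bar> \<le> A / 2 + P}"
  define CQ where "CQ = {t. B / 2 < \<bar>t\<bar> \<and> \<bar>t\<bar> \<le> B / 2 + Q}"
  have CP: "CP \<in> sets borel" "emeasure lborel CP = ennreal (2 * P)"
    using annulus[of "A / 2" "A / 2 + P"] A_pos P0 unfolding CP_def by simp_all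
  have CQ: "CQ \<in> sets borel" "emeasure lborel CQ = ennreal (2 * Q)"
    using annulus[of "B / 2" "B / 2 + Q"] B_pos Q0 unfolding CQ_def by simp_all
  have CC: "CP \<times> CQ \<in> sets lborel" "emeasure lborel (CP \<times> CQ) = ennreal (4 * P * Q)"
  proof -
    have "emeasure (lborel \<Otimes>\<^sub>M lborel) (CP \<times> CQ) = emeasure lborel CP * emeasure lborel CQ"
      using CP(1) CQ(1) by (intro lborel.emeasure_pair_measure_Times) auto
    then show "emeasure lborel (CP \<times> CQ) = ennreal (4 * P * Q)"
      using P0 Q0 by (simp add: lborel_prod CP CQ ac_simps flip: ennreal_mult)
    show "CP \<times> CQ \<in> sets lborel"
      unfolding lborel_prod[symmetric] using CP(1) CQ(1) by (intro pair_measureI) auto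
  qed
  \<comment> \<open>The cross term is positive only over the new corners, whose total area after
    clipping is \<open>4 * P * Q\<close>, and \<open>w\<close> is at most 2 there.\<close>
  have T3: "(LINT z|lborel. p (fst z) * (q (snd z) * w z)) \<le> 8 * P * Q"
  proof -
    have pt: "p (fst z) * (q (snd z) * w z) \<le> 2 * indicator (CP \<times> CQ) z" for z
    proof -
      obtain s t where z: "z = (s, t)" by (cases z)
      have r: "0 \<le> (2 * indicator (CP \<times> CQ) z :: real)" by simp
      consider (pp) "s \<in> X" "s \<notin> I" "t \<in> Y" "t \<notin> J" | (mm) "s \<notin> X" "s \<in> I" "t \<notin> Y" "t \<in> J"
        | (o) "p s * q t \<le> 0"
        by (cases "s \<in> X"; cases "s \<in> I"; cases "t \<in> Y"; cases "t \<in> J") (simp_all add: p_def q_def)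
      then show ?thesis
      proof cases
        case pp
        then have pq: "p s = 1" "q t = 1" by (simp_all add: p_def q_def)
        have st: "A / 2 < \<bar>s\<bar>" "\<bar>s\<bar> \<le> \<alpha> / 2" "B / 2 < \<bar>t\<bar>" "\<bar>t\<bar> \<le> \<beta> / 2"
          using pp mX mY mem_I mem_J by (auto simp: not_le)
        show ?thesis
        proof (cases "\<bar>s\<bar> \<le> A / 2 + K * \<tau> \<and> \<bar>t\<bar> \<le> B / 2 + 2 * \<tau> / A")
          case True
          then have "s \<in> CP" "t \<in> CQ" unfolding CP_def CQ_def using st P2 Q2 by auto
          then show ?thesis using w_corner[of t s] st by (simp add: z pq)
        next
          case False
          then have "w (s, t) = 0" using w_far_fst w_far_snd by (auto simp: not_le)
          then show ?thesis using r by (simp add: z)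
        qed
      next
        case mm
        then have "\<alpha> / 2 < A / 2" "\<beta> / 2 < B / 2" using mX[of s] mY[of t] mem_I[of s] mem_J[of t] by linarith+
        then show ?thesis using nn by simp
      next
        case o
        then have "p s * q t * w z \<le> 0" using w_nonneg[of z] by (rule mult_nonpos_nonneg)
        moreover have "p (fst z) * (q (snd z) * w z) = p s * q t * w z" by (simp add: z)
        ultimately show ?thesis using r by linarith
      qed
    qed
    have "(LINT z|lborel. p (fst z) * (q (snd z) * w z)) \<le> (LINT z|lborel. 2 * indicator (CP \<times> CQ) z)"
    proof (rule integral_mono)
      show "integrable lborel (\<lambda>z. p (fst z) * (q (snd z) * w z))" by (rule weighted_fubini(1)[OF p(1) q(1) p(2) q(2)])
      show "integrable lborel (\<lambda>z. 2 * indicator (CP \<times> CQ) z :: real)"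
        using CC by (intro integrable_mult_right integrable_real_indicator) auto
    qed (rule pt)
    also have "\<dots> = 2 * measure lborel (CP \<times> CQ)" using CC(1) by simp
    also have "measure lborel (CP \<times> CQ) = 4 * P * Q" using CC(2) P0 Q0 by (simp add: measure_def)
    finally show ?thesis by simp
  qed
  \<comment> \<open>Bilinear expansion about the pair \<open>I\<close>, \<open>J\<close>: one first
    variation per direction and the corner term.\<close>
  have dec: "U X Y - U I J = (LINT s|lborel. p s * \<omega>1 s) + (LINT t|lborel. q t * \<omega>2 t)
      + (LINT z|lborel. p (fst z) * (q (snd z) * w z))"
  proof -
    note i1 = weighted_fubini(1)[OF p(1) wJ(1) p(2) wJ(2)] and i2 = weighted_fubini(1)[OF wI(1) q(1) wI(2) q(2)]
      and i3 = weighted_fubini(1)[OF p(1) q(1) p(2) q(2)] and i4 = weighted_fubini(1)[OF wI(1) wJ(1) wI(2) wJ(2)]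
    have "U X Y = (LINT z|lborel. (p (fst z) * (indicator J (snd z) * w z) + indicator I (fst z) * (q (snd z) * w z))
        + (p (fst z) * (q (snd z) * w z) + indicator I (fst z) * (indicator J (snd z) * w z)))"
      unfolding U_def by (intro Bochner_Integration.integral_cong) (auto simp: p_def q_def algebra_simps)
    also have "\<dots> = ((LINT z|lborel. p (fst z) * (indicator J (snd z) * w z)) + (LINT z|lborel. indicator I (fst z) * (q (snd z) * w z)))
        + ((LINT z|lborel. p (fst z) * (q (snd z) * w z)) + U I J)"
      unfolding U_def by (simp only: Bochner_Integration.integral_add i1 i2 i3 i4 Bochner_Integration.integrable_add)
    also have "(LINT z|lborel. p (fst z) * (indicator J (snd z) * w z)) = (LINT s|lborel. p s * \<omega>1 s)"
      unfolding \<omega>1_def by (rule weighted_fubini(4)[OF p(1) wJ(1) p(2) wJ(2)])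
    also have "(LINT z|lborel. indicator I (fst z) * (q (snd z) * w z)) = (LINT t|lborel. q t * \<omega>2 t)"
      unfolding \<omega>2_def by (rule weighted_fubini(5)[OF wI(1) q(1) wI(2) q(2)])
    finally show ?thesis by simp
  qed
  have main: "U X Y \<le> U I J + 2 * (\<alpha> - A) + 2 * (\<beta> - B) - (5 * P\<^sup>2 + 5 * Q\<^sup>2 - 8 * P * Q)"
    using dec T1 T2 T3 by linarith
  \<comment> \<open>The quadratic form is positive definite: the losses are at least
    \<open>10 * P * Q\<close> and beat the corner gain \<open>8 * P * Q\<close>. Equality thus
    forces \<open>P = Q = 0\<close>.\<close>
  have sq: "5 * P\<^sup>2 + 5 * Q\<^sup>2 - 8 * P * Q = (P\<^sup>2 + Q\<^sup>2) + 4 * (P - Q)\<^sup>2"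
    by (simp add: power2_eq_square algebra_simps)
  have "0 \<le> 5 * P\<^sup>2 + 5 * Q\<^sup>2 - 8 * P * Q" unfolding sq by simp
  with main show "?U \<le> U I J + 2 * (\<alpha> - A) + 2 * (\<beta> - B)" by (simp add: X_def Y_def)
  assume "?U = U I J + 2 * (\<alpha> - A) + 2 * (\<beta> - B)"
  then have "(P\<^sup>2 + Q\<^sup>2) + 4 * (P - Q)\<^sup>2 \<le> 0" using main unfolding sq X_def Y_def by linarith
  moreover have "0 \<le> P\<^sup>2" "0 \<le> Q\<^sup>2" "0 \<le> (P - Q)\<^sup>2" by simp_all
  ultimately have "P\<^sup>2 = 0" "Q\<^sup>2 = 0" by linarith+
  then have "P = 0" "Q = 0" by simp_all
  \<comment> \<open>With \<open>P = Q = 0\<close> no side has moved outward, and the lower bound on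
    the area then pins both lengths.\<close>
  have "\<alpha> \<le> A"
  proof (rule ccontr)
    assume "\<not> \<alpha> \<le> A"
    then have "0 < min ((\<alpha> - A) / 2) (K * \<tau>)" using K_pos \<tau>(1) by simp
    then show False using \<open>P = 0\<close> unfolding P_def by linarith
  qed
  moreover have "\<beta> \<le> B"
  proof (rule ccontr)
    assume "\<not> \<beta> \<le> B"
    then have "0 < min ((\<beta> - B) / 2) (2 * \<tau> / A)" using A_pos \<tau>(1) by simp
    then show False using \<open>Q = 0\<close> unfolding Q_def by linarith
  qed
  moreover have "A \<le> \<alpha>"
  proof (rule ccontr)
    assume "\<not> A \<le> \<alpha>"
    then have "\<alpha> * \<beta> < A * B" using \<open>\<beta> \<le> B\<close> \<alpha>\<beta> B_pos
      by (meson le_less_trans mult_left_mono mult_strict_right_mono not_le)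
    then show False using \<alpha>\<beta>(3) AB by simp
  qed
  moreover have "B \<le> \<beta>"
  proof (rule ccontr)
    assume "\<not> B \<le> \<beta>"
    then have "A * \<beta> < A * B" using A_pos by simp
    moreover have "\<alpha> * \<beta> \<le> A * \<beta>" using \<open>\<alpha> \<le> A\<close> \<alpha>\<beta> by (intro mult_right_mono) auto
    ultimately show False using \<alpha>\<beta>(3) AB by simp
  qed
  ultimately show "\<alpha> = A \<and> \<beta> = B" by simp
qed

text \<open>\<open>T\<close> is rearranged first while \<open>S\<close> is kept, then
  \<open>S\<close>. This is legitimate because each partial integral of \<open>w\<close> is again
  nonincreasing in the absolute value of the remaining variable. Equality at the end makes all
  intermediate inequalities equalities.\<close>

lemma product_sets:
  assumes S: "S \<in> sets borel" "emeasure lborel S = ennreal \<alpha>" "0 \<le> \<alpha>"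
    and T: "T \<in> sets borel" "emeasure lborel T = ennreal \<beta>" "0 \<le> \<beta>" and \<alpha>\<beta>: "1 \<le> \<alpha> * \<beta>"
  shows "U S T \<le> U I J + 2 * (\<alpha> - A) + 2 * (\<beta> - B)"
    and "U S T = U I J + 2 * (\<alpha> - A) + 2 * (\<beta> - B) \<Longrightarrow>
      (AE s in lborel. s \<in> S \<longleftrightarrow> s \<in> I) \<and> (AE t in lborel. t \<in> T \<longleftrightarrow> t \<in> J)"
proof -
  define X where "X = {- \<alpha> / 2..\<alpha> / 2}"
  define Y where "Y = {- \<beta> / 2..\<beta> / 2}"
  have XY: "X \<in> sets borel" "Y \<in> sets borel" by (simp_all add: X_def Y_def)
  note wS = indicator_weights[OF S(1)] and wT = indicator_weights[OF T(1)] and wY = indicator_weights[OF XY(2)]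
    and wX = indicator_weights[OF XY(1)]
  define one where "one = (\<lambda>_ :: real. 1 :: real)"
  have w1: "one \<in> borel_measurable borel" "\<bar>one s\<bar> \<le> 1" for s :: real by (simp_all add: one_def)
  define \<psi> where "\<psi> t = (LINT s|lborel. indicator S s * w (s, t))" for t
  define \<phi> where "\<phi> s = (LINT t|lborel. indicator Y t * w (s, t))" for s
  have i\<psi>: "integrable lborel \<psi>" using weighted_fubini(3)[OF wS(1) w1(1) wS(2) w1(2)] by (simp add: \<psi>_def[abs_def] one_def)
  have i\<phi>: "integrable lborel \<phi>" using weighted_fubini(2)[OF w1(1) wY(1) w1(2) wY(2)] by (simp add: \<phi>_def[abs_def] one_def)
  have m\<psi>: "\<psi> t \<le> \<psi> t'" if "\<bar>t'\<bar> \<le> \<bar>t\<bar>" for t t' unfolding \<psi>_def by (rule slice_integral_mono(1)[OF S(1) that])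
  have m\<phi>: "\<phi> s \<le> \<phi> s'" if "\<bar>s'\<bar> \<le> \<bar>s\<bar>" for s s' unfolding \<phi>_def by (rule slice_integral_mono(2)[OF XY(2) that])
  have e1: "U S T = (LINT t|lborel. indicator T t * \<psi> t)"
    unfolding U_def \<psi>_def by (rule weighted_fubini(5)[OF wS(1) wT(1) wS(2) wT(2)])
  have e2: "U S Y = (LINT t|lborel. indicator Y t * \<psi> t)"
    unfolding U_def \<psi>_def by (rule weighted_fubini(5)[OF wS(1) wY(1) wS(2) wY(2)])
  have e3: "U S Y = (LINT s|lborel. indicator S s * \<phi> s)"
    unfolding U_def \<phi>_def by (rule weighted_fubini(4)[OF wS(1) wY(1) wS(2) wY(2)])
  have e4: "U X Y = (LINT s|lborel. indicator X s * \<phi> s)"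
    unfolding U_def \<phi>_def by (rule weighted_fubini(4)[OF wX(1) wY(1) wX(2) wY(2)])
  have le1: "U S T \<le> U S Y" unfolding e1 e2 unfolding Y_def by (rule bathtub(1)[OF i\<psi> m\<psi> T])
  have le2: "U S Y \<le> U X Y" unfolding e3 e4 unfolding X_def by (rule bathtub(1)[OF i\<phi> m\<phi> S])
  have le3: "U X Y \<le> U I J + 2 * (\<alpha> - A) + 2 * (\<beta> - B)"
    unfolding X_def Y_def by (rule centered_rectangles(1)[OF S(3) T(3) \<alpha>\<beta>])
  show "U S T \<le> U I J + 2 * (\<alpha> - A) + 2 * (\<beta> - B)" using le1 le2 le3 by linarith
  assume "U S T = U I J + 2 * (\<alpha> - A) + 2 * (\<beta> - B)"
  then have eq: "U X Y = U I J + 2 * (\<alpha> - A) + 2 * (\<beta> - B)" "U S T = U S Y" "U S Y = U X Y"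
    using le1 le2 le3 by linarith+
  have AB': "\<alpha> = A" "\<beta> = B"
    using centered_rectangles(2)[OF S(3) T(3) \<alpha>\<beta> eq(1)[unfolded X_def Y_def]] by auto
  have XI: "X = I" "Y = J" by (simp_all add: X_def Y_def I_def J_def AB')
  have h: "\<bar>A / 2\<bar> = A / 2" "\<bar>B / 2\<bar> = B / 2" using A_pos B_pos by simp_all
  have \<phi>\<omega>: "\<phi> = \<omega>1" by (simp add: fun_eq_iff \<phi>_def \<omega>1_def XI)
  have SI: "AE s in lborel. s \<in> S \<longleftrightarrow> s \<in> {- \<alpha> / 2..\<alpha> / 2}"
  proof (rule bathtub(2)[OF i\<phi> m\<phi> S])
    show "\<phi> s < \<phi> (\<alpha> / 2)" if "\<alpha> / 2 < \<bar>s\<bar>" for s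
      using that \<omega>_strict(1)[of s] \<omega>1_side[OF h(1)] unfolding \<phi>\<omega> AB' by simp
    show "(LINT s|lborel. indicator S s * \<phi> s) = (LINT s|lborel. indicator {- \<alpha> / 2..\<alpha> / 2} s * \<phi> s)"
      using eq(3) e3 e4 by (simp add: X_def)
  qed
  \<comment> \<open>The rearrangement of \<open>T\<close> used the weight \<open>\<psi>\<close>
    built from \<open>S\<close>. Only now, with \<open>S\<close> equal to \<open>I\<close> almost
    everywhere, can it be identified with \<open>\<omega>2\<close>, whose strict drop beyond
    \<open>J\<close> yields uniqueness.\<close>
  have \<psi>\<omega>: "\<psi> t = \<omega>2 t" for t
    unfolding \<psi>_def \<omega>2_def
  proof (rule integral_cong_AE)
    show "AE s in lborel. indicator S s * w (s, t) = indicator I s * w (s, t)"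
      using SI by eventually_elim (simp add: indicator_def I_def AB')
  qed (use weighted_slices(2)[OF wS(1) wS(1) wS(2) wS(2), of t] weighted_slices(2)[OF indicator_weights(1)[OF I_borel] wS(1) indicator_weights(2)[OF I_borel] wS(2), of t] in \<open>auto intro: borel_measurable_integrable\<close>)
  have TJ: "AE t in lborel. t \<in> T \<longleftrightarrow> t \<in> {- \<beta> / 2..\<beta> / 2}"
  proof (rule bathtub(2)[OF i\<psi> m\<psi> T])
    show "\<psi> s < \<psi> (\<beta> / 2)" if "\<beta> / 2 < \<bar>s\<bar>" for s
      using that \<omega>_strict(2)[of s] \<omega>2_side[OF h(2)] unfolding \<psi>\<omega> AB' by simp
    show "(LINT s|lborel. indicator T s * \<psi> s) = (LINT s|lborel. indicator {- \<beta> / 2..\<beta> / 2} s * \<psi> s)"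
      using eq(2) e1 e2 by (simp add: Y_def)
  qed
  show "(AE s in lborel. s \<in> S \<longleftrightarrow> s \<in> I) \<and> (AE t in lborel. t \<in> T \<longleftrightarrow> t \<in> J)"
    using SI TJ by (simp add: I_def J_def AB')
qed


section \<open>Arbitrary competitors and uniqueness of the minimizer\<close>

lemma mem_rect: "z \<in> rect A B \<longleftrightarrow> fst z \<in> I \<and> snd z \<in> J"
  by (cases z) (auto simp: rect_def I_def J_def)

lemma w_on_rect: "z \<in> rect A B \<Longrightarrow> w z = \<mu> - sd a b z / \<tau>"
  using sd_le_y[of "fst z" "snd z" 0] mem_I[of "fst z"] mem_J[of "snd z"] y_le
  by (intro w_eq) (simp add: mem_rect)

definition u0 :: real where "u0 = U {- a / 2..a / 2} {- b / 2..b / 2}"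

lemma nn_integral_U:
  assumes "S \<in> sets borel" "T \<in> sets borel"
  shows "(\<integral>\<^sup>+z. ennreal (indicator S (fst z) * (indicator T (snd z) * w z)) \<partial>lborel) = ennreal (U S T)"
  unfolding U_def
  by (rule nn_integral_eq_integral[OF weighted_fubini(1)])
     (use indicator_weights[OF assms(1)] indicator_weights[OF assms(2)] w_nonneg in auto)

lemma U_nonneg: "0 \<le> U S T"
  unfolding U_def by (intro Bochner_Integration.integral_nonneg) (simp add: w_nonneg)

lemma nn_u0: "(\<integral>\<^sup>+z. ennreal (indicator (rect a b) z * w z) \<partial>lborel) = ennreal u0"
proof -
  have "(\<integral>\<^sup>+z. ennreal (indicator (rect a b) z * w z) \<partial>lborel)
      = (\<integral>\<^sup>+z. ennreal (indicator {- a / 2..a / 2} (fst z) * (indicator {- b / 2..b / 2} (snd z) * w z)) \<partial>lborel)"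
    by (intro nn_integral_cong) (auto simp: rect_def indicator_def)
  then show ?thesis unfolding u0_def by (simp add: nn_integral_U)
qed

text \<open>The comparison involves \<open>\<mu> - sd / \<tau>\<close>, whose sign varies, and
  \<open>Dfun\<close> may be infinite. Placing \<open>\<mu>\<close> times the indicator of
  \<open>E\<close> on one side and \<open>\<mu>\<close> times that of the old rectangle on the other
  keeps all integrands nonnegative; both areas are 1, so the two copies of \<open>\<mu>\<close>
  cancel in the end.\<close>

lemma split_energy:
  assumes E: "E \<in> sets borel" "emeasure lborel E = 1" and ST: "S \<in> sets borel" "T \<in> sets borel"
  shows "(\<integral>\<^sup>+z. ennreal (\<mu> * indicator E z + indicator (rect a b) z * w z) \<partial>lborel) = ennreal \<mu> + ennreal u0"
    and "(\<integral>\<^sup>+z. ennreal (\<mu> * indicator (rect a b) z + ((indicator E z - indicator (rect a b) z) * sd a b z / \<tau>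
        + indicator S (fst z) * (indicator T (snd z) * w z))) \<partial>lborel)
      = ennreal \<mu> + (ennreal (1 / \<tau>) * Dfun E (rect a b) + ennreal (U S T))"
proof -
  have [measurable]: "(fst :: pt \<Rightarrow> real) \<in> borel_measurable borel" "(snd :: pt \<Rightarrow> real) \<in> borel_measurable borel"
    by (auto intro!: borel_measurable_continuous_onI continuous_intros)
  note [measurable] = E(1) ST
  have R1: "emeasure lborel (rect a b) = 1" using emeasure_rect[of a b] a_pos b ab by simp
  have i: "(\<integral>\<^sup>+z. ennreal (\<mu> * indicator X z) \<partial>lborel) = ennreal \<mu>" if "X \<in> sets borel" "emeasure lborel X = 1" for X :: "pt set"
  proof -
    have "(\<integral>\<^sup>+z. ennreal (\<mu> * indicator X z) \<partial>lborel) = (\<integral>\<^sup>+z. ennreal \<mu> * indicator X z \<partial>lborel)"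
      by (intro nn_integral_cong) (simp add: indicator_def)
    also have "\<dots> = ennreal \<mu>" using that by (subst nn_integral_cmult_indicator) auto
    finally show ?thesis .
  qed
  have s0: "0 \<le> (indicator E z - indicator (rect a b) z) * sd a b z" for z
    using mem_rect_iff_sd[of z a b] by (cases "z \<in> E"; cases "z \<in> rect a b") auto
  have "(\<integral>\<^sup>+z. ennreal (\<mu> * indicator E z + indicator (rect a b) z * w z) \<partial>lborel)
      = (\<integral>\<^sup>+z. ennreal (\<mu> * indicator E z) + ennreal (indicator (rect a b) z * w z) \<partial>lborel)"
    using lam_pos w_nonneg by (intro nn_integral_cong ennreal_plus) auto
  also have "\<dots> = ennreal \<mu> + ennreal u0"
    by (subst nn_integral_add) (measurable, simp add: i[OF E] nn_u0)
  finally show "(\<integral>\<^sup>+z. ennreal (\<mu> * indicator E z + indicator (rect a b) z * w z) \<partial>lborel) = ennreal \<mu> + ennreal u0" .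
  have mz: "(\<lambda>z. (indicator E z - indicator (rect a b) z) * sd a b z) \<in> borel_measurable borel"
    by measurable
  have "(\<integral>\<^sup>+z. ennreal (\<mu> * indicator (rect a b) z + ((indicator E z - indicator (rect a b) z) * sd a b z / \<tau>
        + indicator S (fst z) * (indicator T (snd z) * w z))) \<partial>lborel)
      = (\<integral>\<^sup>+z. ennreal (\<mu> * indicator (rect a b) z) + (ennreal (1 / \<tau>) * ennreal ((indicator E z - indicator (rect a b) z) * sd a b z)
        + ennreal (indicator S (fst z) * (indicator T (snd z) * w z))) \<partial>lborel)"
  proof (rule nn_integral_cong)
    fix z
    have "ennreal (1 / \<tau>) * ennreal ((indicator E z - indicator (rect a b) z) * sd a b z) = ennreal ((indicator E z - indicator (rect a b) z) * sd a b z / \<tau>)"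
      using s0[of z] \<tau>(1) by (subst ennreal_mult[symmetric]) auto
    moreover have "0 \<le> (indicator E z - indicator (rect a b) z) * sd a b z / \<tau>" using s0[of z] \<tau>(1) by simp
    moreover have "0 \<le> indicator S (fst z) * (indicator T (snd z) * w z)" using w_nonneg by simp
    moreover have "0 \<le> \<mu> * indicator (rect a b) z" using lam_pos by simp
    ultimately show "ennreal (\<mu> * indicator (rect a b) z + ((indicator E z - indicator (rect a b) z) * sd a b z / \<tau>
        + indicator S (fst z) * (indicator T (snd z) * w z)))
      = ennreal (\<mu> * indicator (rect a b) z) + (ennreal (1 / \<tau>) * ennreal ((indicator E z - indicator (rect a b) z) * sd a b z)
        + ennreal (indicator S (fst z) * (indicator T (snd z) * w z)))"
      by (simp only: ennreal_plus add_nonneg_nonneg)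
  qed
  also have "\<dots> = (\<integral>\<^sup>+z. ennreal (\<mu> * indicator (rect a b) z) \<partial>lborel)
      + ((\<integral>\<^sup>+z. ennreal (1 / \<tau>) * ennreal ((indicator E z - indicator (rect a b) z) * sd a b z) \<partial>lborel)
        + (\<integral>\<^sup>+z. ennreal (indicator S (fst z) * (indicator T (snd z) * w z)) \<partial>lborel))"
  proof (subst nn_integral_add)
    show "(\<lambda>z. ennreal (\<mu> * indicator (rect a b) z)) \<in> borel_measurable lborel" by measurable
    have m1: "(\<lambda>z. ennreal (1 / \<tau>) * ennreal ((indicator E z - indicator (rect a b) z) * sd a b z)) \<in> borel_measurable lborel"
      using mz by simp
    have m2: "(\<lambda>z. ennreal (indicator S (fst z) * (indicator T (snd z) * w z))) \<in> borel_measurable lborel" by measurable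
    show "(\<lambda>z. ennreal (1 / \<tau>) * ennreal ((indicator E z - indicator (rect a b) z) * sd a b z)
        + ennreal (indicator S (fst z) * (indicator T (snd z) * w z))) \<in> borel_measurable lborel"
      by (rule borel_measurable_add[OF m1 m2])
    show "(\<integral>\<^sup>+z. ennreal (\<mu> * indicator (rect a b) z) \<partial>lborel)
        + (\<integral>\<^sup>+z. ennreal (1 / \<tau>) * ennreal ((indicator E z - indicator (rect a b) z) * sd a b z)
          + ennreal (indicator S (fst z) * (indicator T (snd z) * w z)) \<partial>lborel)
      = (\<integral>\<^sup>+z. ennreal (\<mu> * indicator (rect a b) z) \<partial>lborel)
      + ((\<integral>\<^sup>+z. ennreal (1 / \<tau>) * ennreal ((indicator E z - indicator (rect a b) z) * sd a b z) \<partial>lborel)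
        + (\<integral>\<^sup>+z. ennreal (indicator S (fst z) * (indicator T (snd z) * w z)) \<partial>lborel))"
      unfolding nn_integral_add[OF m1 m2] by (rule refl)
  qed
  also have "(\<integral>\<^sup>+z. ennreal (1 / \<tau>) * ennreal ((indicator E z - indicator (rect a b) z) * sd a b z) \<partial>lborel)
      = ennreal (1 / \<tau>) * Dfun E (rect a b)"
    unfolding Dfun_rect[OF a_pos b E(1)] using mz by (intro nn_integral_cmult) simp
  finally show "(\<integral>\<^sup>+z. ennreal (\<mu> * indicator (rect a b) z + ((indicator E z - indicator (rect a b) z) * sd a b z / \<tau>
        + indicator S (fst z) * (indicator T (snd z) * w z))) \<partial>lborel)
      = ennreal \<mu> + (ennreal (1 / \<tau>) * Dfun E (rect a b) + ennreal (U S T))"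
    unfolding i[OF rect_in_borel R1] nn_integral_U[OF ST] .
qed

text \<open>Pointwise in four cases: on \<open>E\<close> the inequality \<open>w_ge\<close> is
  available, on the old rectangle \<open>w\<close> equals \<open>\<mu> - sd / \<tau>\<close> because
  \<open>sd \<le> 0\<close> there, and outside \<open>E\<close> the weight over the product of
  \<open>S\<close> and \<open>T\<close> is nonnegative.\<close>

lemma dissipation_ge:
  assumes E: "E \<in> sets borel" "emeasure lborel E = 1" and ST: "S \<in> sets borel" "T \<in> sets borel"
    and sub: "AE z in lborel. z \<in> E \<longrightarrow> fst z \<in> S \<and> snd z \<in> T"
  shows "ennreal u0 \<le> ennreal (1 / \<tau>) * Dfun E (rect a b) + ennreal (U S T)"
proof -
  have "ennreal \<mu> + ennreal u0 \<le> ennreal \<mu> + (ennreal (1 / \<tau>) * Dfun E (rect a b) + ennreal (U S T))"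
    unfolding split_energy(1)[OF E ST, symmetric] split_energy(2)[OF E ST, symmetric]
  proof (rule nn_integral_mono_AE, use sub in eventually_elim)
    fix z assume z: "z \<in> E \<longrightarrow> fst z \<in> S \<and> snd z \<in> T"
    have w: "z \<in> rect a b \<Longrightarrow> w z = \<mu> - sd a b z / \<tau>"
      using mem_rect_iff_sd[of z a b] lam_pos \<tau>(1) by (intro w_eq) (meson mult_pos_pos less_imp_le order_trans)
    define v where "v = indicator S (fst z) * (indicator T (snd z) * w z)"
    have v: "0 \<le> v" "z \<in> E \<Longrightarrow> v = w z" using w_nonneg z by (simp_all add: v_def)
    have "\<mu> * indicator E z + indicator (rect a b) z * w z \<le> \<mu> * indicator (rect a b) z
      + ((indicator E z - indicator (rect a b) z) * sd a b z / \<tau> + indicator S (fst z) * (indicator T (snd z) * w z))"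
      unfolding v_def[symmetric]
      by (cases "z \<in> E"; cases "z \<in> rect a b") (use v w w_ge[of z] in simp_all)
    then show "ennreal (\<mu> * indicator E z + indicator (rect a b) z * w z) \<le> ennreal (\<mu> * indicator (rect a b) z
      + ((indicator E z - indicator (rect a b) z) * sd a b z / \<tau> + indicator S (fst z) * (indicator T (snd z) * w z)))"
      by (rule ennreal_leI)
  qed
  then show ?thesis by (simp add: ennreal_add_left_cancel_le)
qed

text \<open>The equality case of \<open>dissipation_ge\<close>: the new rectangle is the product of
  \<open>I\<close> and \<open>J\<close>, and \<open>w\<close> is not truncated on it since
  \<open>sd \<le> y \<le> \<mu> * \<tau>\<close>.\<close>

lemma dissipation_rect: "ennreal (1 / \<tau>) * Dfun (rect A B) (rect a b) + ennreal (U I J) = ennreal u0"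
proof -
  have E: "rect A B \<in> sets borel" "emeasure lborel (rect A B) = 1"
    using emeasure_rect[of A B] A_pos B_pos AB by simp_all
  have "ennreal \<mu> + (ennreal (1 / \<tau>) * Dfun (rect A B) (rect a b) + ennreal (U I J)) = ennreal \<mu> + ennreal u0"
    unfolding split_energy(1)[OF E I_borel J_borel, symmetric] split_energy(2)[OF E I_borel J_borel, symmetric]
  proof (rule nn_integral_cong, rule arg_cong[where f = ennreal])
    fix z
    have w: "z \<in> rect a b \<Longrightarrow> w z = \<mu> - sd a b z / \<tau>"
      using mem_rect_iff_sd[of z a b] lam_pos \<tau>(1) by (intro w_eq) (meson mult_pos_pos less_imp_le order_trans)
    show "\<mu> * indicator (rect a b) z + ((indicator (rect A B) z - indicator (rect a b) z) * sd a b z / \<tau>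
        + indicator I (fst z) * (indicator J (snd z) * w z)) = \<mu> * indicator (rect A B) z + indicator (rect a b) z * w z"
    proof -
      define v where "v = indicator I (fst z) * (indicator J (snd z) * w z)"
      have v: "z \<in> rect A B \<Longrightarrow> v = w z" "z \<notin> rect A B \<Longrightarrow> v = 0" by (auto simp: v_def mem_rect indicator_def)
      show ?thesis unfolding v_def[symmetric]
        by (cases "z \<in> rect A B"; cases "z \<in> rect a b") (use v w w_on_rect[of z] in simp_all)
    qed
  qed
  then show ?thesis by (simp add: ennreal_add_left_cancel)
qed

text \<open>The minimal energy. By \<open>dissipation_rect\<close> the difference
  \<open>u0 - U I J\<close> is the scaled dissipation of the new rectangle.\<close>

definition F0 :: real where "F0 = 2 * A + 2 * B + (u0 - U I J)"

lemma Ftau_rect_le: "Ftau \<tau> (rect A B) (rect a b) \<le> ennreal F0" and u0_ge: "U I J \<le> u0"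
proof -
  define d where "d = ennreal (1 / \<tau>) * Dfun (rect A B) (rect a b)"
  have d: "d + ennreal (U I J) = ennreal u0" unfolding d_def by (rule dissipation_rect)
  have "ennreal (U I J) \<le> ennreal u0" unfolding d[symmetric] by simp
  then show le: "U I J \<le> u0" using U_nonneg by (simp add: u0_def)
  have "d \<noteq> top"
  proof
    assume "d = top" then show False using d by simp
  qed
  then obtain r where r: "0 \<le> r" "d = ennreal r" by (cases d) auto
  have n: "0 \<le> r + U I J" "0 \<le> u0" using r(1) U_nonneg by (simp_all add: u0_def)
  have "ennreal (r + U I J) = ennreal u0" using d r U_nonneg by (simp only: ennreal_plus)
  then have "r + U I J = u0" by (simp only: ennreal_inj[OF n])
  then have "d = ennreal (u0 - U I J)" using r by simp
  then have "Ftau \<tau> (rect A B) (rect a b) \<le> ennreal (2 * A + 2 * B) + ennreal (u0 - U I J)"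
    unfolding Ftau_def d_def[symmetric] using perimeter1_rect_le[of A B] A_pos B_pos by (simp add: add_right_mono)
  also have "\<dots> = ennreal F0" unfolding F0_def using A_pos B_pos le by (simp flip: ennreal_plus)
  finally show "Ftau \<tau> (rect A B) (rect a b) \<le> ennreal F0" .
qed

lemma AE_lift:
  assumes "AE s in (lborel :: real measure). P s"
  shows "AE z in (lborel :: pt measure). P (fst z)" "AE z in (lborel :: pt measure). P (snd z)"
proof -
  obtain N where N: "{s. \<not> P s} \<subseteq> N" "N \<in> null_sets lborel" using assms by (auto simp: eventually_ae_filter)
  have "N \<times> UNIV \<in> null_sets (lborel \<Otimes>\<^sub>M (lborel :: real measure))" using N(2) by (intro lborel.times_in_null_sets1) auto
  then have "N \<times> UNIV \<in> null_sets (lborel :: pt measure)" by (simp add: lborel_prod)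
  from AE_not_in[OF this] show "AE z in (lborel :: pt measure). P (fst z)"
    by eventually_elim (use N(1) in auto)
  have "UNIV \<times> N \<in> null_sets ((lborel :: real measure) \<Otimes>\<^sub>M lborel)" using N(2) by (intro lborel.times_in_null_sets2) auto
  then have "UNIV \<times> N \<in> null_sets (lborel :: pt measure)" by (simp add: lborel_prod)
  from AE_not_in[OF this] show "AE z in (lborel :: pt measure). P (snd z)"
    by eventually_elim (use N(1) in auto)
qed

text \<open>The projection bound for the perimeter, the multiplier bound for the dissipation and
  \<open>product_sets\<close> are added. If the sum is tight, the projections are \<open>I\<close>
  and \<open>J\<close> up to null sets; \<open>E\<close> lies in their product and has the same area
  as the new rectangle, so it fills it.\<close>

lemma Ftau_ge_borel:
  assumes E: "E \<in> sets borel" "emeasure lborel E = 1"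
  shows "ennreal F0 \<le> Ftau \<tau> E (rect a b)"
    and "Ftau \<tau> E (rect a b) \<le> ennreal F0 \<Longrightarrow> AE z in lborel. z \<in> E \<longleftrightarrow> z \<in> rect A B"
proof -
  have fin: "emeasure lborel E < \<infinity>" using E by simp
  define S where "S = {s. 0 < col E s}"
  define T where "T = {t. 0 < row E t}"
  have ST: "S \<in> sets borel" "T \<in> sets borel"
    unfolding S_def T_def using measurable_row_col[OF E(1)] by measurable
  have sub: "AE z in lborel. z \<in> E \<longrightarrow> fst z \<in> S \<and> snd z \<in> T"
    unfolding S_def T_def mem_Collect_eq by (rule AE_in_projections[OF E(1) fin])
  have proj: "2 * emeasure lborel T + 2 * emeasure lborel S \<le> perimeter1 E"
    unfolding S_def T_def by (rule projections_le_perimeter1[OF E(1) fin])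
  have diss: "ennreal u0 \<le> ennreal (1 / \<tau>) * Dfun E (rect a b) + ennreal (U S T)"
    by (rule dissipation_ge[OF E ST sub])
  have main: "F0 \<le> pr + dr \<and> (pr + dr \<le> F0 \<longrightarrow> (AE z in lborel. z \<in> E \<longleftrightarrow> z \<in> rect A B))"
    if pr: "perimeter1 E = ennreal pr" "0 \<le> pr" and dr: "ennreal (1 / \<tau>) * Dfun E (rect a b) = ennreal dr" "0 \<le> dr" for pr dr
  proof -
    have "2 * emeasure lborel T + 2 * emeasure lborel S < top"
      using proj unfolding pr(1) by (rule le_less_trans) (rule ennreal_less_top)
    then have "emeasure lborel S \<noteq> top" "emeasure lborel T \<noteq> top" by (auto simp: ennreal_mult_top)
    then obtain \<alpha> \<beta> where S: "emeasure lborel S = ennreal \<alpha>" "0 \<le> \<alpha>" and T: "emeasure lborel T = ennreal \<beta>" "0 \<le> \<beta>"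
      by (metis ennreal_cases)
    have "ennreal (2 * \<beta> + 2 * \<alpha>) = 2 * emeasure lborel T + 2 * emeasure lborel S"
      unfolding S T using S T by (simp add: ennreal_mult)
    also have "\<dots> \<le> ennreal pr" using proj pr by simp
    finally have p: "2 * \<beta> + 2 * \<alpha> \<le> pr" using pr(2) by simp
    have n: "0 \<le> dr + U S T" by (intro add_nonneg_nonneg dr U_nonneg)
    have "ennreal u0 \<le> ennreal (dr + U S T)" using diss unfolding dr(1) by (simp only: ennreal_plus[OF dr(2) U_nonneg])
    then have d: "u0 \<le> dr + U S T" by (simp only: ennreal_le_iff[OF n])
    \<comment> \<open>\<open>E\<close> fits into the product of its projections; this is how the
      area constraint reaches the two lengths.\<close>
    have "emeasure lborel E \<le> emeasure lborel (S \<times> T)"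
    proof (rule emeasure_mono_AE)
      show "AE z in lborel. z \<in> E \<longrightarrow> z \<in> S \<times> T" using sub by eventually_elim (auto simp: mem_Times_iff)
      show "S \<times> T \<in> sets lborel"
        unfolding lborel_prod[symmetric] using ST by (intro pair_measureI) auto
    qed
    also have "emeasure lborel (S \<times> T) = emeasure (lborel \<Otimes>\<^sub>M lborel) (S \<times> T)" by (simp add: lborel_prod)
    also have "\<dots> = emeasure lborel S * emeasure lborel T"
      using ST by (intro lborel.emeasure_pair_measure_Times) auto
    also have "\<dots> = ennreal (\<alpha> * \<beta>)" unfolding S T using S T by (simp add: ennreal_mult)
    finally have \<alpha>\<beta>: "1 \<le> \<alpha> * \<beta>" using E(2) by simp
    note prod = product_sets[OF ST(1) S ST(2) T \<alpha>\<beta>]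
    have "F0 \<le> pr + dr" unfolding F0_def by (rule energy_arith(1)[OF prod(1) p d])
    moreover have "AE z in lborel. z \<in> E \<longleftrightarrow> z \<in> rect A B" if "pr + dr \<le> F0"
    proof -
      have "U S T = U I J + 2 * (\<alpha> - A) + 2 * (\<beta> - B)" by (rule energy_arith(2)[OF prod(1) p d that[unfolded F0_def]])
      then have "AE s in lborel. s \<in> S \<longleftrightarrow> s \<in> I" "AE t in lborel. t \<in> T \<longleftrightarrow> t \<in> J" using prod(2) by auto
      from AE_lift(1)[OF this(1)] AE_lift(2)[OF this(2)] sub
      have "AE z in lborel. z \<in> E \<longrightarrow> z \<in> rect A B" by eventually_elim (simp add: mem_rect)
      then show ?thesis
        by (rule AE_eq_of_AE_subset[OF E(1) rect_in_borel]) (use emeasure_rect[of A B] A_pos B_pos AB E in simp_all)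
    qed
    ultimately show ?thesis by blast
  qed
  \<comment> \<open>The computation in real numbers applies when both terms are finite; otherwise
    the energy is infinite and the lower bound is trivial.\<close>
  have cases: "Ftau \<tau> E (rect a b) = top \<or> (\<exists>pr dr. 0 \<le> pr \<and> 0 \<le> dr \<and> perimeter1 E = ennreal pr \<and>
      ennreal (1 / \<tau>) * Dfun E (rect a b) = ennreal dr \<and> Ftau \<tau> E (rect a b) = ennreal (pr + dr))"
  proof (cases "perimeter1 E = top \<or> ennreal (1 / \<tau>) * Dfun E (rect a b) = top")
    case True
    then have "Ftau \<tau> E (rect a b) = top" unfolding Ftau_def by (elim disjE) simp_all
    then show ?thesis by (rule disjI1)
  next
    case False
    then obtain pr dr where h: "0 \<le> pr" "perimeter1 E = ennreal pr" "0 \<le> dr" "ennreal (1 / \<tau>) * Dfun E (rect a b) = ennreal dr"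
      by (metis ennreal_cases)
    then have "Ftau \<tau> E (rect a b) = ennreal (pr + dr)" unfolding Ftau_def h(2,4) by (simp only: ennreal_plus)
    with h show ?thesis by (intro disjI2 exI[of _ pr] exI[of _ dr] conjI)
  qed
  show "ennreal F0 \<le> Ftau \<tau> E (rect a b)"
    using cases
  proof (elim disjE exE conjE)
    fix pr dr assume h: "0 \<le> pr" "0 \<le> dr" "perimeter1 E = ennreal pr" "ennreal (1 / \<tau>) * Dfun E (rect a b) = ennreal dr"
      "Ftau \<tau> E (rect a b) = ennreal (pr + dr)"
    show ?thesis unfolding h(5) by (rule ennreal_leI) (use main[OF h(3,1,4,2)] in blast)
  qed simp
  assume le: "Ftau \<tau> E (rect a b) \<le> ennreal F0"
  show "AE z in lborel. z \<in> E \<longleftrightarrow> z \<in> rect A B"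
    using cases
  proof (elim disjE exE conjE)
    assume "Ftau \<tau> E (rect a b) = top"
    then show ?thesis using le by (simp add: top_unique)
  next
    fix pr dr assume h: "0 \<le> pr" "0 \<le> dr" "perimeter1 E = ennreal pr" "ennreal (1 / \<tau>) * Dfun E (rect a b) = ennreal dr"
      "Ftau \<tau> E (rect a b) = ennreal (pr + dr)"
    have "0 \<le> F0" unfolding F0_def using A_pos B_pos u0_ge by simp
    then have "pr + dr \<le> F0" using le unfolding h(5) by (simp only: ennreal_le_iff)
    then show ?thesis using main[OF h(3,1,4,2)] by blast
  qed
qed

lemma Ftau_ge:
  assumes E: "E \<in> sets lebesgue" "emeasure lebesgue E = 1"
  shows "ennreal F0 \<le> Ftau \<tau> E (rect a b)"
    and "Ftau \<tau> E (rect a b) \<le> ennreal F0 \<Longrightarrow> ae_eq E (rect A B)"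
proof -
  obtain E' where E': "E' \<in> sets borel" "ae_eq E E'" using borel_representative[OF E(1)] .
  have L: "E' \<in> sets lebesgue" using E'(1) by simp
  have "AE z in lebesgue. z \<in> E \<longleftrightarrow> z \<in> E'" using ae_eq_iff_AE[OF E(1) L] E'(2) by simp
  then have "emeasure lebesgue E = emeasure lebesgue E'" by (rule emeasure_eq_AE[OF _ E(1) L])
  then have 1: "emeasure lborel E' = 1" using E(2) E'(1) by simp
  have F: "Ftau \<tau> E (rect a b) = Ftau \<tau> E' (rect a b)"
    by (rule Ftau_cong[OF E'(2) L ae_eq_refl rect_in_lebesgue])
  show "ennreal F0 \<le> Ftau \<tau> E (rect a b)" unfolding F by (rule Ftau_ge_borel(1)[OF E'(1) 1])
  assume "Ftau \<tau> E (rect a b) \<le> ennreal F0"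
  then have "AE z in lborel. z \<in> E' \<longleftrightarrow> z \<in> rect A B" unfolding F by (rule Ftau_ge_borel(2)[OF E'(1) 1])
  then have "AE z in lebesgue. z \<in> E' \<longleftrightarrow> z \<in> rect A B" by (rule AE_completion)
  then have "ae_eq E' (rect A B)" using ae_eq_iff_AE[OF L rect_in_lebesgue] by simp
  with E'(2) show "ae_eq E (rect A B)" by (rule ae_eq_trans)
qed

text \<open>The old set may be any representative of the rectangle, as an iteration of minimizers
  determines sets only up to null sets. The equivalence serves twice: to identify arbitrary
  minimizers, and to verify that explicit rectangles are minimizers.\<close>

theorem minimizer_iff:
  assumes F: "ae_eq F (rect a b)"
  shows "is_minimizer \<tau> F E \<longleftrightarrow> ae_eq E (rect A B)"
proof -
  have FF: "Ftau \<tau> E F = Ftau \<tau> E (rect a b)" if "E \<in> sets lebesgue" for E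
    by (rule Ftau_cong[OF ae_eq_refl that F rect_in_lebesgue])
  have R: "emeasure lebesgue (rect A B) = 1" using emeasure_rect[of A B] A_pos B_pos AB by simp
  show ?thesis
  proof
    assume m: "is_minimizer \<tau> F E"
    then have E: "E \<in> sets lebesgue" "emeasure lebesgue E = 1" by (auto simp: is_minimizer_def)
    have "Ftau \<tau> E F \<le> Ftau \<tau> (rect A B) F" using m R by (simp add: is_minimizer_def)
    then have "Ftau \<tau> E (rect a b) \<le> ennreal F0" unfolding FF[OF E(1)] FF[OF rect_in_lebesgue]
      using Ftau_rect_le by (rule order_trans)
    then show "ae_eq E (rect A B)" by (rule Ftau_ge(2)[OF E])
  next
    assume ae: "ae_eq E (rect A B)"
    have E: "E \<in> sets lebesgue" by (rule ae_eq_in_lebesgue[OF ae rect_in_lebesgue])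
    have "AE z in lebesgue. z \<in> E \<longleftrightarrow> z \<in> rect A B" using ae_eq_iff_AE[OF E rect_in_lebesgue] ae by simp
    then have e1: "emeasure lebesgue E = 1" unfolding R[symmetric] by (rule emeasure_eq_AE[OF _ E rect_in_lebesgue])
    have "Ftau \<tau> E F = Ftau \<tau> (rect A B) (rect a b)" by (rule Ftau_cong[OF ae rect_in_lebesgue F rect_in_lebesgue])
    then have "Ftau \<tau> E F \<le> Ftau \<tau> E' F" if "E' \<in> sets lebesgue" "emeasure lebesgue E' = 1" for E'
      using order_trans[OF Ftau_rect_le Ftau_ge(1)[OF that]] FF[OF that(1)] by simp
    then show "is_minimizer \<tau> F E" unfolding is_minimizer_def using E e1 by blast
  qed
qed

end

section \<open>The sequence of rectangles\<close>

text \<open>After \<open>y\<close> is eliminated by the area constraint, the Euler-Lagrange equation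
  becomes one scalar equation \<open>H x = 0\<close>, solved by the intermediate value theorem on
  [0, 2 \<tau> a]. At the right end point \<open>b * x1 = 2 * \<tau>\<close> already balances the
  driving term, whence the bound on \<open>x\<close>.\<close>

lemma euler_step_exists:
  fixes a \<tau> :: real
  assumes a: "1 < a" and \<tau>: "0 < \<tau>" "40 * a ^ 4 * \<tau> \<le> 1"
  shows "\<exists>x y. euler_step a (1 / a) \<tau> x y (a - 2 * x) (1 / a + 2 * y) (2 / (a - 2 * x) + y / \<tau>) \<and>
      y = 1 / a * x / (a - 2 * x) \<and> x \<le> 2 * \<tau> * a \<and> 1 < a - 2 * x"
proof -
  define b where "b = 1 / a"
  have b: "0 < b" "b < 1" "a * b = 1" using a by (simp_all add: b_def)
  have pow: "a \<le> a ^ 4" "a ^ 2 \<le> a ^ 4" "1 \<le> a ^ 4"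
    using a power_increasing[of 1 4 a] power_increasing[of 2 4 a] by simp_all
  have \<tau>a: "40 * (a * \<tau>) \<le> 1" "40 * (a ^ 2 * \<tau>) \<le> 1" "40 * \<tau> \<le> 1"
  proof -
    have g: "40 * (c * \<tau>) \<le> 1" if "c \<le> a ^ 4" for c
    proof -
      have "40 * (c * \<tau>) \<le> 40 * (a ^ 4 * \<tau>)" using that \<tau>(1) by (intro mult_left_mono mult_right_mono) auto
      also have "\<dots> \<le> 1" using \<tau>(2) by (simp add: mult.assoc)
      finally show ?thesis .
    qed
    show "40 * (a * \<tau>) \<le> 1" "40 * (a ^ 2 * \<tau>) \<le> 1" "40 * \<tau> \<le> 1"
      using g[OF pow(1)] g[OF pow(2)] g[OF pow(3)] by simp_all
  qed
  define x1 where "x1 = 2 * \<tau> * a"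
  define yy where "yy x = b * x / (a - 2 * x)" for x
  define H where "H x = b * (x + yy x) + (yy x)\<^sup>2 - x\<^sup>2 - 2 * \<tau> * (1 - (b + 2 * yy x)\<^sup>2)" for x
  have den: "0 < a - 2 * x" if "x \<le> x1" for x
  proof -
    have "2 * x \<le> 4 * (\<tau> * a)" using that by (simp add: x1_def)
    also have "\<dots> \<le> 1" using \<tau>a(1) by (simp add: mult.commute)
    also have "1 < a" by (rule a)
    finally show ?thesis by simp
  qed
  have x10: "0 < x1" using \<tau> a by (simp add: x1_def)
  have y0: "0 \<le> yy x" if "0 \<le> x" "x \<le> x1" for x using den[OF that(2)] that b by (simp add: yy_def)
  have "\<exists>x\<ge>0. x \<le> x1 \<and> H x = 0"
  proof (rule IVT')
    have "b\<^sup>2 < 1" using b by (simp add: abs_square_less_1)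
    then have "0 \<le> \<tau> * (1 - b\<^sup>2)" using \<tau> by (intro mult_nonneg_nonneg) auto
    then show "H 0 \<le> 0" by (simp add: H_def yy_def)
    have bx: "b * x1 = 2 * \<tau>" using b by (simp add: x1_def b_def)
    \<comment> \<open>The source of the fourth power: the negative term \<open>x1\<^sup>2\<close> of
      \<open>H x1\<close> has to be absorbed by \<open>2 * \<tau> * b\<^sup>2\<close>, where
      \<open>b = 1 / a\<close>.\<close>
    have "x1\<^sup>2 = 4 * (\<tau> * (a\<^sup>2 * \<tau>))" by (simp add: x1_def power2_eq_square)
    also have "\<dots> \<le> 2 * \<tau> * b\<^sup>2"
    proof -
      have "40 * (a\<^sup>2 * \<tau>) * (a * a) \<le> 1"
        using \<tau>(2) by (simp add: power2_eq_square power4_eq_xxxx ac_simps)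
      then have "40 * (a\<^sup>2 * \<tau>) * (a * a) * (b * b) \<le> 1 * (b * b)" using b by (intro mult_right_mono) auto
      moreover have "40 * (a\<^sup>2 * \<tau>) * (a * a) * (b * b) = 40 * (a\<^sup>2 * \<tau>)" using a by (simp add: b_def)
      ultimately have "40 * (a\<^sup>2 * \<tau>) \<le> b * b" by simp
      moreover have "0 \<le> a\<^sup>2 * \<tau>" using \<tau>(1) by simp
      ultimately have "2 * (a\<^sup>2 * \<tau>) \<le> b * b" by linarith
      then have "2 * (a\<^sup>2 * \<tau>) \<le> b\<^sup>2" by (simp only: power2_eq_square)
      then have "(2 * \<tau>) * (2 * (a\<^sup>2 * \<tau>)) \<le> (2 * \<tau>) * b\<^sup>2" using \<tau> by (intro mult_left_mono) auto
      then show ?thesis by simp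
    qed
    also have "\<dots> \<le> 2 * \<tau> * (b + 2 * yy x1)\<^sup>2"
      using b \<tau> y0[of x1] x10 by (intro mult_left_mono power_mono) auto
    finally have s: "x1\<^sup>2 \<le> 2 * \<tau> * (b + 2 * yy x1)\<^sup>2" .
    have "H x1 = (b * x1 - 2 * \<tau>) + b * yy x1 + (yy x1)\<^sup>2 + (2 * \<tau> * (b + 2 * yy x1)\<^sup>2 - x1\<^sup>2)"
      by (simp add: H_def algebra_simps)
    also have "\<dots> \<ge> 0" using s bx b y0[of x1] x10 by simp
    finally show "0 \<le> H x1" .
    show "0 \<le> x1" using x10 by simp
    show "continuous_on {0..x1} H"
      unfolding H_def[abs_def] yy_def using den by (intro continuous_intros) force+
  qed
  then obtain x where x: "0 \<le> x" "x \<le> x1" "H x = 0" by blast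
  define y where "y = yy x"
  define A where "A = a - 2 * x"
  define B where "B = b + 2 * y"
  have EL: "2 * \<tau> * (1 - B\<^sup>2) = b * (x + y) + y\<^sup>2 - x\<^sup>2" using x(3) by (simp add: H_def B_def y_def)
  have "x \<noteq> 0"
  proof
    assume "x = 0"
    then have "B = b" "y = 0" by (simp_all add: B_def y_def yy_def)
    then have "b\<^sup>2 = 1" using EL \<tau> \<open>x = 0\<close> by simp
    then show False using b by (simp add: power2_eq_1_iff)
  qed
  then have x0: "0 < x" using x(1) by simp
  have A0: "0 < A" using den[OF x(2)] by (simp add: A_def)
  have y0': "0 < y" using x0 A0 b by (simp add: y_def yy_def A_def)
  have AB: "A * B = 1"
  proof -
    have "A * y = b * x" using A0 by (simp add: y_def yy_def A_def)
    then have "A * B = A * b + 2 * (b * x)" by (simp add: B_def algebra_simps)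
    also have "\<dots> = a * b" by (simp add: A_def algebra_simps)
    finally show ?thesis using b by simp
  qed
  have xb: "4 * x \<le> b"
  proof -
    have "4 * x * a \<le> 4 * x1 * a" using x a by (intro mult_right_mono) auto
    also have "\<dots> \<le> 1" using \<tau>a(2) \<tau> a zero_le_mult_iff[of "a\<^sup>2" \<tau>] by (simp add: x1_def power2_eq_square ac_simps)
    finally show ?thesis using a by (simp add: b_def pos_le_divide_eq)
  qed
  have B1: "B < 1"
  proof -
    \<comment> \<open>Because \<open>4 * x \<le> b\<close>, the term \<open>b * x\<close> dominates
      \<open>x\<^sup>2\<close>, so the right side of \<open>EL\<close> is positive and
      \<open>B < 1\<close>. Then \<open>A > 1\<close>, and the next step starts from the same
      situation.\<close>
    have "x * x < b * x" using xb x0 by (intro mult_strict_right_mono) auto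
    moreover have "0 < b * y + y\<^sup>2" using b y0' by (simp add: add_pos_pos)
    ultimately have "0 < 2 * \<tau> * (1 - B\<^sup>2)" unfolding EL by (simp add: power2_eq_square distrib_left)
    then have "B\<^sup>2 < 1" using \<tau>(1) by (simp add: zero_less_mult_iff)
    then show ?thesis using power2_less_imp_less[of B 1] by simp
  qed
  have A1: "1 < A"
  proof (rule ccontr)
    assume "\<not> 1 < A"
    then have "A * B \<le> 1 * B" using A0 b y0' by (intro mult_right_mono) (auto simp: B_def)
    then show False using AB B1 by simp
  qed
  have "20 * \<tau> \<le> b"
  proof -
    have "20 * \<tau> * a \<le> 1" using \<tau>a(1) \<tau> a zero_le_mult_iff[of a \<tau>] by (simp add: ac_simps)
    then show ?thesis using a by (simp add: b_def pos_le_divide_eq)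
  qed
  then have "euler_step a b \<tau> x y A B (2 / A + y / \<tau>)"
    using b x0 xb y0' \<tau>(1) A1 AB EL by unfold_locales (simp_all add: A_def B_def)
  moreover have "y = b * x / A" by (simp add: y_def yy_def A_def)
  ultimately show ?thesis using x(2) A1 unfolding A_def B_def b_def x1_def by blast
qed

section \<open>Expansion of one step in powers of the step size\<close>

context euler_step
begin

text \<open>The ratio of the displacements is \<open>b / A\<close>, and
  \<open>b < 1 \<le> A\<close>. This is the strict decrease of the perimeter in one step.\<close>

lemma y_less_x:
  assumes "y = b * x / A" "1 < a"
  shows "y < x"
proof -
  have "b * a < 1 * a" using ab assms(2) by (simp add: mult.commute)
  then have "b < 1" using assms(2) by (simp only: mult_less_cancel_right_pos)
  then have "b * x < A * x" using A(2) x by (intro mult_strict_right_mono) auto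
  then show ?thesis unfolding assms(1) using A_pos by (simp add: pos_divide_less_eq mult.commute)
qed

text \<open>The quantity in the absolute value is the defect in
  \<open>b * (x + y) = 2 * \<tau> * (1 - b\<^sup>2)\<close>, that is, what \<open>EL\<close> leaves
  over after \<open>B\<close> is replaced by \<open>b\<close> and the squares are dropped. It is of
  second order since \<open>B - b = 2 * y < 2 * x\<close> and \<open>x \<le> 2 * \<tau> * a\<close>;
  the constant is 16 + 4.\<close>

lemma defect_bound:
  assumes yx: "y < x" and x2: "x \<le> 2 * \<tau> * a" and a1: "1 < a"
  shows "\<bar>2 * \<tau> * (b\<^sup>2 - B\<^sup>2) + x\<^sup>2 - y\<^sup>2\<bar> \<le> 20 * a\<^sup>2 * \<tau>\<^sup>2" and "x\<^sup>2 \<le> 4 * a\<^sup>2 * \<tau>\<^sup>2"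
proof -
  have B1: "B \<le> 1" using mult_right_mono[OF A(2), of B] B_pos AB by simp
  have x2': "x\<^sup>2 \<le> (2 * \<tau> * a)\<^sup>2" using x x2 by (intro power_mono) auto
  then show xx: "x\<^sup>2 \<le> 4 * a\<^sup>2 * \<tau>\<^sup>2" by (simp add: power_mult_distrib ac_simps)
  have "B\<^sup>2 - b\<^sup>2 = (B + b) * (2 * y)" by (simp add: B power2_eq_square algebra_simps)
  also have "\<dots> \<le> 2 * (2 * x)" using B1 B_pos b_le_1 b y yx by (intro mult_mono) auto
  finally have "2 * \<tau> * (B\<^sup>2 - b\<^sup>2) \<le> 2 * \<tau> * (2 * (2 * x))" using \<tau>(1) by (intro mult_left_mono) auto
  also have "\<dots> \<le> 2 * \<tau> * (2 * (2 * (2 * \<tau> * a)))" using \<tau>(1) x2 by (intro mult_left_mono) auto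
  also have "\<dots> = 16 * (\<tau>\<^sup>2 * a)" by (simp add: power2_eq_square)
  also have "\<dots> \<le> 16 * (\<tau>\<^sup>2 * a\<^sup>2)"
  proof -
    have "a \<le> a\<^sup>2" using a1 by (simp add: power2_eq_square)
    then show ?thesis by (intro mult_left_mono) auto
  qed
  finally have 1: "2 * \<tau> * (B\<^sup>2 - b\<^sup>2) \<le> 16 * (a\<^sup>2 * \<tau>\<^sup>2)" by (simp add: ac_simps)
  have bB: "b\<^sup>2 \<le> B\<^sup>2" using b y B by (intro power_mono) auto
  have 2: "0 \<le> 2 * \<tau> * (B\<^sup>2 - b\<^sup>2)" using bB \<tau>(1) by simp
  have 3: "0 \<le> x\<^sup>2 - y\<^sup>2" using yx y by (simp add: power_mono)
  have 4: "0 \<le> y\<^sup>2" by simp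
  have 5: "2 * \<tau> * (b\<^sup>2 - B\<^sup>2) = - (2 * \<tau> * (B\<^sup>2 - b\<^sup>2))" by (simp add: algebra_simps)
  have 6: "20 * a\<^sup>2 * \<tau>\<^sup>2 = 16 * (a\<^sup>2 * \<tau>\<^sup>2) + 4 * a\<^sup>2 * \<tau>\<^sup>2" by simp
  show "\<bar>2 * \<tau> * (b\<^sup>2 - B\<^sup>2) + x\<^sup>2 - y\<^sup>2\<bar> \<le> 20 * a\<^sup>2 * \<tau>\<^sup>2"
    unfolding 5 6 using 1 2 3 4 xx by (intro abs_leI) linarith+
qed

text \<open>With \<open>a * b = 1\<close> the leading term \<open>X\<close> solves
  \<open>b * (1 + b\<^sup>2) * X = 2 * \<tau> * (1 - b\<^sup>2)\<close>. The true \<open>x\<close>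
  solves this up to the defect of \<open>defect_bound\<close> and the error of replacing
  \<open>b * y\<close> by \<open>b ^ 3 * x\<close>, that is, \<open>1 / A\<close> by
  \<open>1 / a\<close>. The constants 20 and 8 add up to 28, and dividing by
  \<open>b = 1 / a\<close> raises the power of \<open>a\<close> to 3.\<close>

lemma displacement_expansion:
  assumes y_eq: "y = b * x / A" and x2: "x \<le> 2 * \<tau> * a" and a1: "1 < a"
  shows "\<bar>x - 2 * (a - b) / (b * (a + b)) * \<tau>\<bar> \<le> 28 * a ^ 3 * \<tau>\<^sup>2"
proof -
  have yx: "y < x" by (rule y_less_x[OF y_eq a1])
  have ba: "b = 1 / a" using ab a1 by (simp add: field_simps)
  define X where "X = 2 * (a - b) / (b * (a + b)) * \<tau>"
  define D where "D = 2 * \<tau> * (b\<^sup>2 - B\<^sup>2) + x\<^sup>2 - y\<^sup>2"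
  have X: "b * (1 + b\<^sup>2) * X = 2 * \<tau> * (1 - b\<^sup>2)"
  proof -
    have s: "1 + b\<^sup>2 = b * (a + b)" "1 - b\<^sup>2 = b * (a - b)"
      using ab by (simp_all add: power2_eq_square algebra_simps)
    have "b * (a + b) \<noteq> 0" using b a1 by (simp add: add_pos_pos less_imp_neq[symmetric])
    then have "b * (b * (a + b)) * X = b * (2 * (a - b)) * \<tau>" by (simp add: X_def)
    then show ?thesis unfolding s by (simp add: ac_simps)
  qed
  have e: "b ^ 3 * x - b * y = - (2 * (b\<^sup>2 * x\<^sup>2) / (a * A))"
  proof -
    have 1: "b * y = b\<^sup>2 * x / A" by (simp add: y_eq power2_eq_square)
    have 2: "b ^ 3 * x = b\<^sup>2 * x / a" by (simp add: ba power2_eq_square power3_eq_cube)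
    have "b ^ 3 * x - b * y = b\<^sup>2 * x * (A - a) / (a * A)"
      unfolding 1 2 using a1 A_pos by (simp add: field_simps)
    also have "A - a = - 2 * x" by (simp add: A)
    finally show ?thesis by (simp add: power2_eq_square)
  qed
  have "b * (1 + b\<^sup>2) * (x - X) = b * x + b ^ 3 * x - 2 * \<tau> * (1 - b\<^sup>2)"
    unfolding right_diff_distrib X by (simp add: power2_eq_square power3_eq_cube algebra_simps)
  also have "b * x = 2 * \<tau> * (1 - B\<^sup>2) - y\<^sup>2 + x\<^sup>2 - b * y" using EL by (simp add: algebra_simps)
  also have "2 * \<tau> * (1 - B\<^sup>2) - y\<^sup>2 + x\<^sup>2 - b * y + b ^ 3 * x - 2 * \<tau> * (1 - b\<^sup>2) = D + (b ^ 3 * x - b * y)"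
    by (simp add: D_def algebra_simps)
  finally have main: "b * (1 + b\<^sup>2) * (x - X) = D - 2 * (b\<^sup>2 * x\<^sup>2) / (a * A)" unfolding e by simp
  have q: "0 \<le> 2 * (b\<^sup>2 * x\<^sup>2) / (a * A)" using A_pos a1 by simp
  have "2 * (b\<^sup>2 * x\<^sup>2) / (a * A) \<le> 2 * (1 * x\<^sup>2) / 1"
  proof (rule frac_le)
    show "1 \<le> a * A" using a1 A(2) mult_mono[of 1 a 1 A] by simp
    have "b\<^sup>2 \<le> 1" using b b_le_1 by (simp add: power_le_one)
    then show "2 * (b\<^sup>2 * x\<^sup>2) \<le> 2 * (1 * x\<^sup>2)" by (intro mult_left_mono mult_right_mono) auto
  qed auto
  then have q2: "2 * (b\<^sup>2 * x\<^sup>2) / (a * A) \<le> 8 * (a\<^sup>2 * \<tau>\<^sup>2)" using defect_bound(2)[OF yx x2 a1] by simp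
  have "\<bar>D\<bar> \<le> 20 * (a\<^sup>2 * \<tau>\<^sup>2)" using defect_bound(1)[OF yx x2 a1] by (simp add: D_def)
  then have r: "\<bar>b * (1 + b\<^sup>2) * (x - X)\<bar> \<le> 28 * (a\<^sup>2 * \<tau>\<^sup>2)"
    unfolding main using q q2 by (intro abs_leI) linarith+
  have "b * \<bar>x - X\<bar> \<le> b * (1 + b\<^sup>2) * \<bar>x - X\<bar>"
    using b by (intro mult_right_mono) (simp_all add: distrib_left)
  also have "\<dots> = \<bar>b * (1 + b\<^sup>2) * (x - X)\<bar>" using b by (simp add: abs_mult)
  finally have "b * \<bar>x - X\<bar> \<le> 28 * (a\<^sup>2 * \<tau>\<^sup>2)" using r by linarith
  then have "a * (b * \<bar>x - X\<bar>) \<le> a * (28 * (a\<^sup>2 * \<tau>\<^sup>2))" using a1 by (intro mult_left_mono) auto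
  moreover have "a * (b * \<bar>x - X\<bar>) = \<bar>x - X\<bar>" unfolding mult.assoc[symmetric] ab by simp
  moreover have "a * (28 * (a\<^sup>2 * \<tau>\<^sup>2)) = 28 * a ^ 3 * \<tau>\<^sup>2" by (simp add: power2_eq_square power3_eq_cube)
  ultimately have "\<bar>x - X\<bar> \<le> 28 * a ^ 3 * \<tau>\<^sup>2" by linarith
  then show ?thesis unfolding X_def .
qed

text \<open>Only the sum \<open>x + y\<close> enters the change of \<open>a - b\<close>, and
  \<open>EL\<close> determines it up to the defect. So the error is exactly twice the defect divided
  by \<open>b\<close>.\<close>

lemma difference_step:
  assumes y_eq: "y = b * x / A" and x2: "x \<le> 2 * \<tau> * a" and a1: "1 < a"
  shows "\<bar>(A - B) - (1 - 4 * \<tau>) * (a - b)\<bar> \<le> 40 * a ^ 3 * \<tau>\<^sup>2"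
proof -
  have yx: "y < x" by (rule y_less_x[OF y_eq a1])
  define D where "D = 2 * \<tau> * (b\<^sup>2 - B\<^sup>2) + x\<^sup>2 - y\<^sup>2"
  define G where "G = (A - B) - (1 - 4 * \<tau>) * (a - b)"
  have "b * G = - 2 * (b * (x + y)) + 4 * \<tau> * (b * (a - b))" by (simp add: G_def A B algebra_simps)
  also have "b * (a - b) = 1 - b\<^sup>2" using ab by (simp add: power2_eq_square algebra_simps)
  also have "b * (x + y) = 2 * \<tau> * (1 - B\<^sup>2) - y\<^sup>2 + x\<^sup>2" using EL by simp
  also have "- 2 * (2 * \<tau> * (1 - B\<^sup>2) - y\<^sup>2 + x\<^sup>2) + 4 * \<tau> * (1 - b\<^sup>2) = - 2 * D"
    by (simp add: D_def algebra_simps)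
  finally have "b * G = - 2 * D" .
  then have "a * (b * G) = - 2 * (a * D)" by simp
  then have G: "G = - 2 * (a * D)" using ab by (simp add: mult.assoc[symmetric])
  have "\<bar>D\<bar> \<le> 20 * a\<^sup>2 * \<tau>\<^sup>2" unfolding D_def by (rule defect_bound(1)[OF yx x2 a1])
  then have "2 * (a * \<bar>D\<bar>) \<le> 2 * (a * (20 * a\<^sup>2 * \<tau>\<^sup>2))" using a1 by (intro mult_left_mono) auto
  moreover have "\<bar>G\<bar> = 2 * (a * \<bar>D\<bar>)" unfolding G using a1 by (simp add: abs_mult)
  ultimately show ?thesis unfolding G_def[symmetric] by (simp add: power2_eq_square power3_eq_cube ac_simps)
qed

end

text \<open>Any solution of the step equation may be selected: \<open>minimizer_iff\<close> shows
  that the resulting rectangle does not depend on the selection. Where no solution exists the value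
  is arbitrary.\<close>

definition shift :: "real \<Rightarrow> real \<Rightarrow> real" where
  "shift \<tau> a = (SOME x. \<exists>y. euler_step a (1 / a) \<tau> x y (a - 2 * x) (1 / a + 2 * y) (2 / (a - 2 * x) + y / \<tau>) \<and>
      y = 1 / a * x / (a - 2 * x) \<and> x \<le> 2 * \<tau> * a \<and> 1 < a - 2 * x)"

definition lift :: "real \<Rightarrow> real \<Rightarrow> real" where
  "lift \<tau> a = 1 / a * shift \<tau> a / (a - 2 * shift \<tau> a)"

primrec side :: "real \<Rightarrow> real \<Rightarrow> nat \<Rightarrow> real" where
  "side \<tau> a 0 = a"
| "side \<tau> a (Suc k) = side \<tau> a k - 2 * shift \<tau> (side \<tau> a k)"

lemma shift_step:
  assumes "1 < a" "0 < \<tau>" "40 * a ^ 4 * \<tau> \<le> 1"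
  shows "euler_step a (1 / a) \<tau> (shift \<tau> a) (lift \<tau> a) (a - 2 * shift \<tau> a) (1 / a + 2 * lift \<tau> a)
      (2 / (a - 2 * shift \<tau> a) + lift \<tau> a / \<tau>)"
    and "shift \<tau> a \<le> 2 * \<tau> * a" and "1 < a - 2 * shift \<tau> a"
proof -
  have "\<exists>y. euler_step a (1 / a) \<tau> (shift \<tau> a) y (a - 2 * shift \<tau> a) (1 / a + 2 * y) (2 / (a - 2 * shift \<tau> a) + y / \<tau>) \<and>
      y = 1 / a * shift \<tau> a / (a - 2 * shift \<tau> a) \<and> shift \<tau> a \<le> 2 * \<tau> * a \<and> 1 < a - 2 * shift \<tau> a"
    unfolding shift_def by (rule someI_ex) (rule euler_step_exists[OF assms])
  then obtain y where y: "euler_step a (1 / a) \<tau> (shift \<tau> a) y (a - 2 * shift \<tau> a) (1 / a + 2 * y) (2 / (a - 2 * shift \<tau> a) + y / \<tau>)"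
    "y = lift \<tau> a" "shift \<tau> a \<le> 2 * \<tau> * a" "1 < a - 2 * shift \<tau> a" unfolding lift_def by blast
  show "euler_step a (1 / a) \<tau> (shift \<tau> a) (lift \<tau> a) (a - 2 * shift \<tau> a) (1 / a + 2 * lift \<tau> a)
      (2 / (a - 2 * shift \<tau> a) + lift \<tau> a / \<tau>)" using y(1) unfolding y(2) .
  show "shift \<tau> a \<le> 2 * \<tau> * a" "1 < a - 2 * shift \<tau> a" by (rule y(3), rule y(4))
qed

lemma small_step_mono:
  fixes a \<Lambda> \<tau> :: real
  assumes "0 \<le> a" "a \<le> \<Lambda>" "0 < \<tau>" "40 * \<Lambda> ^ 4 * \<tau> \<le> 1"
  shows "40 * a ^ 4 * \<tau> \<le> 1"
proof -
  have "40 * a ^ 4 * \<tau> \<le> 40 * \<Lambda> ^ 4 * \<tau>"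
    using assms by (intro mult_right_mono mult_left_mono power_mono) auto
  then show ?thesis using assms(4) by simp
qed

text \<open>The long side decreases but stays above 1, so the smallness condition formulated with
  \<open>\<Lambda>\<close> is preserved along the whole iteration.\<close>

lemma side_facts:
  assumes a: "1 < a" "a \<le> \<Lambda>" and \<tau>: "0 < \<tau>" "40 * \<Lambda> ^ 4 * \<tau> \<le> 1"
  shows "1 < side \<tau> a k" "side \<tau> a k \<le> \<Lambda>"
proof -
  have "1 < side \<tau> a k \<and> side \<tau> a k \<le> \<Lambda>"
  proof (induction k)
    case (Suc k)
    then have s: "1 < side \<tau> a k" "40 * side \<tau> a k ^ 4 * \<tau> \<le> 1"
      using small_step_mono[OF _ _ \<tau>, of "side \<tau> a k"] by auto
    have "0 < shift \<tau> (side \<tau> a k)" by (rule euler_step.x(1)[OF shift_step(1)[OF s(1) \<tau>(1) s(2)]])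
    then show ?case using Suc shift_step(3)[OF s(1) \<tau>(1) s(2)] by simp
  qed (use a in simp)
  then show "1 < side \<tau> a k" "side \<tau> a k \<le> \<Lambda>" by auto
qed

lemma side_step:
  assumes a: "1 < a" "a \<le> \<Lambda>" and \<tau>: "0 < \<tau>" "40 * \<Lambda> ^ 4 * \<tau> \<le> 1"
  defines "s \<equiv> side \<tau> a"
  shows "euler_step (s k) (1 / s k) \<tau> (shift \<tau> (s k)) (lift \<tau> (s k)) (s (Suc k)) (1 / s (Suc k))
      (2 / s (Suc k) + lift \<tau> (s k) / \<tau>)"
    and "shift \<tau> (s k) \<le> 2 * \<tau> * s k"
    and "1 / s (Suc k) = 1 / s k + 2 * lift \<tau> (s k)"
    and "lift \<tau> (s k) = 1 / s k * shift \<tau> (s k) / s (Suc k)"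
proof -
  have f: "1 < s k" "s k \<le> \<Lambda>" unfolding s_def by (rule side_facts[OF a \<tau>])+
  then have q: "40 * s k ^ 4 * \<tau> \<le> 1" using small_step_mono[OF _ f(2) \<tau>] by simp
  have S: "s (Suc k) = s k - 2 * shift \<tau> (s k)" by (simp add: s_def)
  note E = shift_step(1)[OF f(1) \<tau>(1) q, folded S]
  have "s (Suc k) * (1 / s k + 2 * lift \<tau> (s k)) = 1" by (rule euler_step.AB[OF E])
  moreover have "0 < s (Suc k)" by (rule euler_step.A_pos[OF E])
  ultimately show e: "1 / s (Suc k) = 1 / s k + 2 * lift \<tau> (s k)" by (simp add: field_simps)
  show "euler_step (s k) (1 / s k) \<tau> (shift \<tau> (s k)) (lift \<tau> (s k)) (s (Suc k)) (1 / s (Suc k))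
      (2 / s (Suc k) + lift \<tau> (s k) / \<tau>)" using E unfolding e .
  show "shift \<tau> (s k) \<le> 2 * \<tau> * s k" by (rule shift_step(2)[OF f(1) \<tau>(1) q])
  show "lift \<tau> (s k) = 1 / s k * shift \<tau> (s k) / s (Suc k)" by (simp add: lift_def S)
qed

lemma minimizing_sequence:
  assumes a: "1 < a" "a \<le> \<Lambda>" and \<tau>: "0 < \<tau>" "40 * \<Lambda> ^ 4 * \<tau> \<le> 1"
    and S: "S 0 = rect a (1 / a)" "\<And>k. is_minimizer \<tau> (S k) (S (Suc k))"
  shows "ae_eq (S k) (rect (side \<tau> a k) (1 / side \<tau> a k))"
proof (induction k)
  case 0
  show ?case by (simp add: S(1) ae_eq_refl)
next
  case (Suc k)
  show ?case by (rule euler_step.minimizer_iff[OF side_step(1)[OF a \<tau>] Suc, THEN iffD1, OF S(2)])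
qed

lemma approx_flat_flow_rect:
  assumes a: "1 < a" "a \<le> \<Lambda>" and \<tau>: "40 * \<Lambda> ^ 4 * \<tau> \<le> 1"
    and E: "approx_flat_flow (rect a (1 / a)) \<tau> E" and t: "0 \<le> t"
  shows "ae_eq (E t) (rect (side \<tau> a (nat \<lfloor>t / \<tau>\<rfloor>)) (1 / side \<tau> a (nat \<lfloor>t / \<tau>\<rfloor>)))"
proof -
  obtain S where S: "0 < \<tau>" "S 0 = rect a (1 / a)" "\<And>k. is_minimizer \<tau> (S k) (S (Suc k))"
    "\<And>t. 0 \<le> t \<Longrightarrow> E t = S (nat \<lfloor>t / \<tau>\<rfloor>)" using E unfolding approx_flat_flow_def by blast
  show ?thesis unfolding S(4)[OF t] by (rule minimizing_sequence[OF a S(1) \<tau> S(2,3)])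
qed

text \<open>The explicit rectangles themselves form a sequence of minimizers; this supplies the
  approximations from which the limit flow is built.\<close>

lemma approx_flat_flow_exists:
  assumes a: "1 < a" "a \<le> \<Lambda>" and \<tau>: "0 < \<tau>" "40 * \<Lambda> ^ 4 * \<tau> \<le> 1"
  shows "approx_flat_flow (rect a (1 / a)) \<tau> (\<lambda>t. rect (side \<tau> a (nat \<lfloor>t / \<tau>\<rfloor>)) (1 / side \<tau> a (nat \<lfloor>t / \<tau>\<rfloor>)))"
proof -
  define S where "S k = rect (side \<tau> a k) (1 / side \<tau> a k)" for k
  have "is_minimizer \<tau> (S k) (S (Suc k))" for k
    unfolding S_def using euler_step.minimizer_iff[OF side_step(1)[OF a \<tau>] ae_eq_refl] ae_eq_refl by blast
  moreover have "S 0 = rect a (1 / a)" by (simp add: S_def)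
  ultimately show ?thesis unfolding approx_flat_flow_def S_def[symmetric] using \<tau>(1) by blast
qed

text \<open>The essential boundary depends only on the class of the set, so both rectangles have the
  same zero set of \<open>sd\<close>. Evaluating each \<open>sd\<close> at a corner of the other
  rectangle gives both inequalities for each side.\<close>

lemma ae_eq_rect_unique:
  assumes "0 < a" "0 < b" "0 < a'" "0 < b'" "ae_eq (rect a b) (rect a' b')"
  shows "a = a' \<and> b = b'"
proof -
  have e: "{z. sd a b z = 0} = {z. sd a' b' z = 0}"
    using ess_boundary_cong[OF assms(5) rect_in_lebesgue] ess_boundary_rect assms by simp
  have "sd a b (a / 2, b / 2) = 0" "sd a' b' (a' / 2, b' / 2) = 0" using assms by (simp_all add: sd_def)
  then have "sd a' b' (a / 2, b / 2) = 0" "sd a b (a' / 2, b' / 2) = 0" using e by blast+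
  then have "a / 2 - a' / 2 \<le> 0" "b / 2 - b' / 2 \<le> 0" "a' / 2 - a / 2 \<le> 0" "b' / 2 - b / 2 \<le> 0"
    unfolding sd_def fst_conv snd_conv using assms by (simp_all add: max_def split: if_splits)
  then show ?thesis by simp
qed

lemma emeasure_symdiff_triangle:
  assumes "X \<in> sets lebesgue" "Y \<in> sets lebesgue" "Z \<in> sets lebesgue"
  shows "emeasure lebesgue (symdiff X Z) \<le> emeasure lebesgue (symdiff X Y) + emeasure lebesgue (symdiff Y Z)"
proof -
  have "emeasure lebesgue (symdiff X Z) \<le> emeasure lebesgue (symdiff X Y \<union> symdiff Y Z)"
    using assms by (intro emeasure_mono) (auto simp: symdiff_def)
  also have "\<dots> \<le> emeasure lebesgue (symdiff X Y) + emeasure lebesgue (symdiff Y Z)"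
    using assms by (intro emeasure_subadditive) (auto simp: symdiff_def)
  finally show ?thesis .
qed

lemma symdiff_commute: "symdiff X Y = symdiff Y X"
  by (simp add: symdiff_def Un_commute)

text \<open>The symmetric difference is contained in the rectangle with the larger sides minus the
  one with the smaller sides.\<close>

lemma emeasure_symdiff_rect:
  assumes pos: "0 \<le> a" "0 \<le> b" "0 \<le> a'" "0 \<le> b'" and le: "a \<le> L" "a' \<le> L" "b \<le> L" "b' \<le> L"
  shows "emeasure lebesgue (symdiff (rect a b) (rect a' b')) \<le> ennreal (L * (\<bar>a - a'\<bar> + \<bar>b - b'\<bar>))"
proof -
  define M where "M = max a a'" define m where "m = min a a'"
  define N where "N = max b b'" define n where "n = min b b'"
  have o: "0 \<le> m" "m \<le> M" "M \<le> L" "0 \<le> n" "n \<le> N" "N \<le> L" using pos le by (auto simp: M_def m_def N_def n_def)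
  have sub: "rect m n \<subseteq> rect M N" using o by (auto simp: rect_def)
  have "symdiff (rect a b) (rect a' b') \<subseteq> rect M N - rect m n"
    by (auto simp: symdiff_def rect_def M_def m_def N_def n_def)
  then have "emeasure lebesgue (symdiff (rect a b) (rect a' b')) \<le> emeasure lebesgue (rect M N - rect m n)"
    by (intro emeasure_mono) auto
  also have "\<dots> = emeasure lborel (rect M N - rect m n)" by simp
  also have "\<dots> = ennreal (measure lborel (rect M N) - measure lborel (rect m n))"
    using emeasure_rect[of M N] o sub by (intro emeasure_Diff_real) auto
  also have "measure lborel (rect M N) - measure lborel (rect m n) = M * N - m * n"
    using emeasure_rect[of M N] emeasure_rect[of m n] o by (simp add: measure_def)
  also have "M * N - m * n = M * (N - n) + n * (M - m)" by (simp add: algebra_simps)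
  also have "\<dots> \<le> L * (N - n) + L * (M - m)" using o by (intro add_mono mult_right_mono) auto
  also have "N - n = \<bar>b - b'\<bar>" by (simp add: N_def n_def max_def min_def)
  also have "M - m = \<bar>a - a'\<bar>" by (simp add: M_def m_def max_def min_def)
  finally show ?thesis by (simp add: distrib_left add.commute ennreal_leI)
qed

text \<open>The positive pair with difference \<open>v\<close> and product 1; its sum is
  \<open>sqrt (v\<^sup>2 + 4)\<close>, because the square of the sum is the square of the difference
  plus four times the product.\<close>

definition long_side :: "real \<Rightarrow> real" where "long_side v = (v + sqrt (v\<^sup>2 + 4)) / 2"
definition short_side :: "real \<Rightarrow> real" where "short_side v = (sqrt (v\<^sup>2 + 4) - v) / 2"

lemma sides_algebra:
  "long_side v * short_side v = 1" "long_side v + short_side v = sqrt (v\<^sup>2 + 4)" "long_side v - short_side v = v"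
  "0 < long_side v" "0 < short_side v"
proof -
  have s: "(sqrt (v\<^sup>2 + 4))\<^sup>2 = v\<^sup>2 + 4" by simp
  have "long_side v * short_side v = ((sqrt (v\<^sup>2 + 4))\<^sup>2 - v\<^sup>2) / 4"
    by (simp add: long_side_def short_side_def power2_eq_square algebra_simps)
  then show p: "long_side v * short_side v = 1" unfolding s by simp
  show "long_side v + short_side v = sqrt (v\<^sup>2 + 4)" "long_side v - short_side v = v"
    by (simp_all add: long_side_def short_side_def field_simps)
  have "\<bar>v\<bar> = sqrt (v\<^sup>2)" by simp
  also have "\<dots> < sqrt (v\<^sup>2 + 4)" by (subst real_sqrt_less_iff) simp
  finally have "v < sqrt (v\<^sup>2 + 4)" "- v < sqrt (v\<^sup>2 + 4)" by auto
  then show "0 < long_side v" "0 < short_side v" by (simp_all add: long_side_def short_side_def)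
qed

lemma long_side_diff:
  assumes "0 < a"
  shows "long_side (a - 1 / a) = a" "short_side (a - 1 / a) = 1 / a"
proof -
  have "(a - 1 / a)\<^sup>2 + 4 = (a + 1 / a)\<^sup>2" using assms by (simp add: power2_eq_square field_simps)
  then have "sqrt ((a - 1 / a)\<^sup>2 + 4) = a + 1 / a" using assms by (simp add: add_pos_pos less_imp_le)
  then show "long_side (a - 1 / a) = a" "short_side (a - 1 / a) = 1 / a"
    by (simp_all add: long_side_def short_side_def)
qed

text \<open>The square root is 1-Lipschitz in \<open>v\<close>, as the factored difference of
  squares shows with \<open>\<bar>u + v\<bar> \<le> p + q\<close>; averaging it with
  \<open>v\<close> or \<open>- v\<close> keeps the constant 1.\<close>

lemma sides_lipschitz:
  "\<bar>long_side u - long_side v\<bar> \<le> \<bar>u - v\<bar>" "\<bar>short_side u - short_side v\<bar> \<le> \<bar>u - v\<bar>"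
proof -
  define p where "p = sqrt (u\<^sup>2 + 4)" define q where "q = sqrt (v\<^sup>2 + 4)"
  have p: "\<bar>u\<bar> \<le> p" "0 < p" unfolding p_def by (auto intro!: real_le_rsqrt add_nonneg_pos)
  have q: "\<bar>v\<bar> \<le> q" "0 < q" unfolding q_def by (auto intro!: real_le_rsqrt add_nonneg_pos)
  have "p\<^sup>2 = u\<^sup>2 + 4" "q\<^sup>2 = v\<^sup>2 + 4" by (simp_all add: p_def q_def)
  then have "(p - q) * (p + q) = (u - v) * (u + v)" by (simp add: power2_eq_square algebra_simps)
  then have "\<bar>p - q\<bar> * (p + q) = \<bar>u - v\<bar> * \<bar>u + v\<bar>" using p q by (metis abs_mult abs_of_pos add_pos_pos)
  also have "\<dots> \<le> \<bar>u - v\<bar> * (p + q)" using p q abs_triangle_ineq[of u v] by (intro mult_left_mono) linarith+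
  finally have pq: "\<bar>p - q\<bar> \<le> \<bar>u - v\<bar>" using p q by (simp add: mult_le_cancel_right)
  have half: "\<bar>(d + e) / 2\<bar> \<le> \<bar>d\<bar>" if "\<bar>e\<bar> \<le> \<bar>d\<bar>" for d e :: real
  proof -
    have "\<bar>d + e\<bar> \<le> 2 * \<bar>d\<bar>" using abs_triangle_ineq[of d e] that by linarith
    then show ?thesis by (simp add: abs_divide)
  qed
  have "long_side u - long_side v = ((u - v) + (p - q)) / 2"
    by (simp add: long_side_def p_def q_def field_simps)
  then show "\<bar>long_side u - long_side v\<bar> \<le> \<bar>u - v\<bar>" using half[OF pq] by (simp only:)
  have "short_side u - short_side v = ((v - u) + (p - q)) / 2"
    by (simp add: short_side_def p_def q_def field_simps)
  then show "\<bar>short_side u - short_side v\<bar> \<le> \<bar>u - v\<bar>"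
    using half[OF pq[unfolded abs_minus_commute[of u v]]] by (simp only: abs_minus_commute[of u v])
qed

section \<open>Convergence of the side difference to an exponential\<close>

lemma exp_second_order:
  assumes "0 \<le> (h::real)"
  shows "\<bar>exp (- h) - (1 - h)\<bar> \<le> h\<^sup>2"
proof -
  have 1: "1 - h \<le> exp (- h)" using exp_ge_add_one_self[of "- h"] by simp
  have "exp (- h) * (1 + h) \<le> exp (- h) * exp h"
    using exp_ge_add_one_self[of h] by (intro mult_left_mono) auto
  also have "\<dots> = 1" by (simp add: exp_minus)
  finally have "exp (- h) \<le> 1 / (1 + h)" using assms by (simp add: pos_le_divide_eq)
  also have "\<dots> \<le> 1 - h + h\<^sup>2"
  proof -
    have "(1 - h + h\<^sup>2) * (1 + h) = 1 + h ^ 3" by (simp add: power2_eq_square power3_eq_cube algebra_simps)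
    then have "1 \<le> (1 - h + h\<^sup>2) * (1 + h)" using assms by simp
    then show ?thesis using assms by (simp add: pos_divide_le_eq)
  qed
  finally show ?thesis using 1 by (intro abs_leI) (simp_all add: algebra_simps)
qed

lemma exp_lipschitz:
  assumes "0 \<le> s" "s \<le> (t::real)"
  shows "\<bar>exp (- 4 * s) - exp (- 4 * t)\<bar> \<le> 4 * (t - s)"
proof -
  have "1 + - (4 * (t - s)) \<le> exp (- (4 * (t - s)))" by (rule exp_ge_add_one_self)
  then have "1 - exp (- (4 * (t - s))) \<le> 4 * (t - s)" by (simp only: diff_le_eq le_diff_eq add_uminus_conv_diff add.commute)
  then have "exp (- 4 * s) * (1 - exp (- (4 * (t - s)))) \<le> 1 * (4 * (t - s))"
    using assms by (intro mult_mono) simp_all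
  moreover have "exp (- 4 * s) * (1 - exp (- (4 * (t - s)))) = exp (- 4 * s) - exp (- 4 * t)"
    by (simp add: right_diff_distrib mult_exp_exp algebra_simps)
  moreover have "exp (- 4 * t) \<le> exp (- 4 * s)" using assms by simp
  ultimately show ?thesis by simp
qed

text \<open>Each step multiplies the accumulated error by \<open>1 - 4 * \<tau>\<close>, a factor in
  [0, 1], and adds at most \<open>40 * \<Lambda> ^ 3 * \<tau>\<^sup>2\<close> from
  \<open>difference_step\<close> and \<open>16 * \<Lambda> * \<tau>\<^sup>2\<close> from comparing
  \<open>1 - 4 * \<tau>\<close> with \<open>exp (- (4 * \<tau>))\<close>. The local errors therefore
  only add up.\<close>

lemma difference_error:
  assumes a: "1 < a" "a \<le> \<Lambda>" and \<tau>: "0 < \<tau>" "40 * \<Lambda> ^ 4 * \<tau> \<le> 1"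
  defines "v \<equiv> \<lambda>k. side \<tau> a k - 1 / side \<tau> a k"
  shows "\<bar>v k - v 0 * exp (- 4 * (real k * \<tau>))\<bar> \<le> real k * ((40 * \<Lambda> ^ 3 + 16 * \<Lambda>) * \<tau>\<^sup>2)"
proof (induction k)
  case (Suc k)
  have f: "1 < side \<tau> a k" "side \<tau> a k \<le> \<Lambda>" by (rule side_facts[OF a \<tau>])+
  have \<Lambda>4: "1 \<le> \<Lambda> ^ 4" using a by (intro one_le_power) simp
  have \<tau>4: "0 \<le> 1 - 4 * \<tau>" 
  proof -
    have "1 * \<tau> \<le> \<Lambda> ^ 4 * \<tau>" using \<Lambda>4 \<tau>(1) by (intro mult_right_mono) auto
    moreover have "40 * (\<Lambda> ^ 4 * \<tau>) \<le> 1" using \<tau>(2) by (simp only: mult.assoc)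
    ultimately show ?thesis using \<tau>(1) by linarith
  qed
  have v0: "0 \<le> v 0" "v 0 \<le> \<Lambda>"
  proof -
    have "1 / a \<le> 1" "0 \<le> 1 / a" using a by simp_all
    then show "0 \<le> v 0" "v 0 \<le> \<Lambda>" unfolding v_def side.simps using a by linarith+
  qed
  have "\<bar>v (Suc k) - (1 - 4 * \<tau>) * v k\<bar> \<le> 40 * side \<tau> a k ^ 3 * \<tau>\<^sup>2"
    unfolding v_def
    by (rule euler_step.difference_step[OF side_step(1)[OF a \<tau>] side_step(4)[OF a \<tau>] side_step(2)[OF a \<tau>] f(1)])
  also have "\<dots> \<le> 40 * \<Lambda> ^ 3 * \<tau>\<^sup>2" using f by (intro mult_right_mono mult_left_mono power_mono) auto
  finally have 1: "\<bar>v (Suc k) - (1 - 4 * \<tau>) * v k\<bar> \<le> 40 * \<Lambda> ^ 3 * \<tau>\<^sup>2" .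
  define e where "e = exp (- 4 * (real k * \<tau>))"
  have e: "0 \<le> e" "e \<le> 1" using \<tau> by (simp_all add: e_def)
  have eS: "exp (- 4 * (real (Suc k) * \<tau>)) = e * exp (- (4 * \<tau>))"
    by (simp add: e_def mult_exp_exp algebra_simps)
  have "(1 - 4 * \<tau>) * \<bar>v k - v 0 * e\<bar> \<le> 1 * \<bar>v k - v 0 * e\<bar>" using \<tau> by (intro mult_right_mono) auto
  then have 2: "\<bar>(1 - 4 * \<tau>) * (v k - v 0 * e)\<bar> \<le> real k * ((40 * \<Lambda> ^ 3 + 16 * \<Lambda>) * \<tau>\<^sup>2)"
    using Suc.IH \<tau>4 by (simp add: abs_mult e_def)
  have "\<bar>exp (- (4 * \<tau>)) - (1 - 4 * \<tau>)\<bar> \<le> (4 * \<tau>)\<^sup>2" using \<tau> by (intro exp_second_order) simp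
  then have "\<bar>(v 0 * e) * (exp (- (4 * \<tau>)) - (1 - 4 * \<tau>))\<bar> \<le> \<Lambda> * (4 * \<tau>)\<^sup>2"
    unfolding abs_mult using v0 e mult_mono[OF v0(2) e(2)] by (intro mult_mono) auto
  then have 3: "\<bar>(v 0 * e) * ((1 - 4 * \<tau>) - exp (- (4 * \<tau>)))\<bar> \<le> 16 * \<Lambda> * \<tau>\<^sup>2"
    by (simp add: power_mult_distrib abs_mult abs_minus_commute ac_simps)
  have "v (Suc k) - v 0 * (e * exp (- (4 * \<tau>))) = (v (Suc k) - (1 - 4 * \<tau>) * v k) + (1 - 4 * \<tau>) * (v k - v 0 * e)
      + (v 0 * e) * ((1 - 4 * \<tau>) - exp (- (4 * \<tau>)))" by (simp add: algebra_simps)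
  also have "\<bar>\<dots>\<bar> \<le> 40 * \<Lambda> ^ 3 * \<tau>\<^sup>2 + real k * ((40 * \<Lambda> ^ 3 + 16 * \<Lambda>) * \<tau>\<^sup>2) + 16 * \<Lambda> * \<tau>\<^sup>2"
    by (intro order_trans[OF abs_triangle_ineq] add_mono 1 2 3)
  also have "\<dots> = real (Suc k) * ((40 * \<Lambda> ^ 3 + 16 * \<Lambda>) * \<tau>\<^sup>2)" by (simp add: algebra_simps)
  finally show ?case unfolding eS .
qed simp

text \<open>Up to time \<open>t\<close> there are at most \<open>t / \<tau>\<close> steps with an
  error of second order each, which gives the first summand of \<open>D\<close>; the second one
  accounts for rounding \<open>t\<close> down to the time grid. The sides inherit the bound by
  \<open>sides_lipschitz\<close>.\<close>

lemma sides_error: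
  assumes a: "1 < a" "a \<le> \<Lambda>" and \<tau>: "0 < \<tau>" "40 * \<Lambda> ^ 4 * \<tau> \<le> 1" and t: "0 \<le> t"
  defines "n \<equiv> nat \<lfloor>t / \<tau>\<rfloor>" and "V \<equiv> (a - 1 / a) * exp (- 4 * t)"
    and "D \<equiv> (40 * \<Lambda> ^ 3 + 16 * \<Lambda>) * t + 4 * \<Lambda>"
  shows "\<bar>side \<tau> a n - long_side V\<bar> \<le> D * \<tau>" "\<bar>1 / side \<tau> a n - short_side V\<bar> \<le> D * \<tau>"
proof -
  define v where "v k = side \<tau> a k - 1 / side \<tau> a k" for k
  have "0 \<le> \<lfloor>t / \<tau>\<rfloor>" using t \<tau> by simp
  then have n: "real n = of_int \<lfloor>t / \<tau>\<rfloor>" unfolding n_def by simp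
  have "real n \<le> t / \<tau>" unfolding n by (rule of_int_floor_le)
  then have n1: "real n * \<tau> \<le> t" using \<tau>(1) by (simp add: pos_le_divide_eq)
  have "t / \<tau> < real n + 1" unfolding n by (rule floor_correct[THEN conjunct2, unfolded of_int_add of_int_1])
  then have n2: "t < (real n + 1) * \<tau>" using \<tau>(1) by (simp add: pos_divide_less_eq)
  have p: "0 < side \<tau> a n" using side_facts(1)[OF a \<tau>, of n] by simp
  have v0: "v 0 = a - 1 / a" by (simp add: v_def)
  have v0': "0 \<le> v 0" "v 0 \<le> \<Lambda>"
  proof -
    have "1 / a \<le> 1" "0 \<le> 1 / a" using a by simp_all
    then show "0 \<le> v 0" "v 0 \<le> \<Lambda>" unfolding v0 using a by linarith+
  qed
  have C: "0 \<le> 40 * \<Lambda> ^ 3 + 16 * \<Lambda>" using a by (intro add_nonneg_nonneg mult_nonneg_nonneg zero_le_power) auto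
  have "\<bar>v n - v 0 * exp (- 4 * (real n * \<tau>))\<bar> \<le> real n * ((40 * \<Lambda> ^ 3 + 16 * \<Lambda>) * \<tau>\<^sup>2)"
    unfolding v_def by (rule difference_error[OF a \<tau>])
  also have "\<dots> = (40 * \<Lambda> ^ 3 + 16 * \<Lambda>) * (real n * \<tau>) * \<tau>" by (simp add: power2_eq_square)
  also have "\<dots> \<le> (40 * \<Lambda> ^ 3 + 16 * \<Lambda>) * t * \<tau>"
    using n1 \<tau> C by (intro mult_right_mono mult_left_mono) auto
  finally have 1: "\<bar>v n - v 0 * exp (- 4 * (real n * \<tau>))\<bar> \<le> (40 * \<Lambda> ^ 3 + 16 * \<Lambda>) * t * \<tau>" .
  have "\<bar>exp (- 4 * (real n * \<tau>)) - exp (- 4 * t)\<bar> \<le> 4 * (t - real n * \<tau>)"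
    using n1 \<tau> by (intro exp_lipschitz) auto
  also have "\<dots> \<le> 4 * \<tau>" using n2 by (simp add: distrib_right)
  finally have "v 0 * \<bar>exp (- 4 * (real n * \<tau>)) - exp (- 4 * t)\<bar> \<le> \<Lambda> * (4 * \<tau>)"
    using v0' a by (intro mult_mono) auto
  then have 2: "\<bar>v 0 * exp (- 4 * (real n * \<tau>)) - v 0 * exp (- 4 * t)\<bar> \<le> 4 * \<Lambda> * \<tau>"
    using v0' by (simp add: abs_mult ac_simps flip: right_diff_distrib)
  have "v n - V = (v n - v 0 * exp (- 4 * (real n * \<tau>))) + (v 0 * exp (- 4 * (real n * \<tau>)) - v 0 * exp (- 4 * t))"
    by (simp add: V_def v0)
  also have "\<bar>\<dots>\<bar> \<le> (40 * \<Lambda> ^ 3 + 16 * \<Lambda>) * t * \<tau> + 4 * \<Lambda> * \<tau>"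
    by (rule order_trans[OF abs_triangle_ineq add_mono[OF 1 2]])
  also have "\<dots> = D * \<tau>" by (simp add: D_def distrib_right)
  finally have 3: "\<bar>v n - V\<bar> \<le> D * \<tau>" .
  have "side \<tau> a n = long_side (v n)" "1 / side \<tau> a n = short_side (v n)"
    unfolding v_def long_side_diff[OF p] by (rule refl)+
  then show "\<bar>side \<tau> a n - long_side V\<bar> \<le> D * \<tau>" "\<bar>1 / side \<tau> a n - short_side V\<bar> \<le> D * \<tau>"
    using order_trans[OF sides_lipschitz(1) 3] order_trans[OF sides_lipschitz(2) 3] by simp_all
qed

text \<open>The root \<open>s\<close> has derivative \<open>- 4 * (V t)\<^sup>2 / s\<close>, which
  equals \<open>- 4 * s + 16 / s\<close>. Taking half the sum and half the difference with
  \<open>V\<close>, and using that the two sides are reciprocal to each other, gives the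
  equations.\<close>

lemma sides_ode:
  fixes c t :: real
  defines "V \<equiv> \<lambda>t. c * exp (- 4 * t)"
  shows "((\<lambda>t. long_side (V t)) has_real_derivative
      - 4 / short_side (V t) + 8 / (long_side (V t) + short_side (V t))) (at t)"
    and "((\<lambda>t. short_side (V t)) has_real_derivative
      - 4 / long_side (V t) + 8 / (long_side (V t) + short_side (V t))) (at t)"
proof -
  define s where "s = sqrt ((V t)\<^sup>2 + 4)"
  have s0: "0 < s" unfolding s_def by (simp add: add_nonneg_pos)
  have dV: "(V has_real_derivative - 4 * V t) (at t)"
    unfolding V_def by (auto intro!: derivative_eq_intros)
  have "((\<lambda>t. (V t)\<^sup>2 + 4) has_real_derivative 2 * V t * (- 4 * V t)) (at t)"
    using DERIV_add[OF DERIV_power[OF dV, of 2] DERIV_const[of 4]] by (simp add: ac_simps)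
  moreover have pos: "0 < (V t)\<^sup>2 + 4" by (simp add: add_nonneg_pos)
  moreover have "(sqrt has_real_derivative inverse s / 2) (at ((V t)\<^sup>2 + 4))"
    unfolding s_def by (rule DERIV_real_sqrt[OF pos])
  ultimately have "((\<lambda>t. sqrt ((V t)\<^sup>2 + 4)) has_real_derivative inverse s / 2 * (2 * V t * (- 4 * V t))) (at t)"
    by (intro DERIV_chain2[where f = sqrt and g = "\<lambda>t. (V t)\<^sup>2 + 4"])
  moreover have "inverse r / 2 * (2 * q * (- 4 * q)) = - 4 * q\<^sup>2 / r" for r q :: real
    by (simp add: field_simps power2_eq_square)
  ultimately have ds: "((\<lambda>t. sqrt ((V t)\<^sup>2 + 4)) has_real_derivative - 4 * (V t)\<^sup>2 / s) (at t)" by (simp only:)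
  have alg: "long_side (V t) * short_side (V t) = 1" "long_side (V t) + short_side (V t) = s"
    "0 < long_side (V t)" "0 < short_side (V t)" unfolding s_def by (rule sides_algebra)+
  have l: "long_side (V t) = (V t + s) / 2" "short_side (V t) = (s - V t) / 2"
    by (simp_all add: long_side_def short_side_def s_def)
  have sq: "s\<^sup>2 = (V t)\<^sup>2 + 4" unfolding s_def using pos by simp
  have i: "1 / short_side (V t) = long_side (V t)" "1 / long_side (V t) = short_side (V t)"
    using alg by (simp_all add: field_simps)
  have e1: "(- 4 * V t + - 4 * (V t)\<^sup>2 / s) / 2 = - 4 / short_side (V t) + 8 / (long_side (V t) + short_side (V t))"
  proof -
    have "- 4 / short_side (V t) = - 4 * long_side (V t)" using i(1) by (metis mult.right_neutral times_divide_eq_right)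
    then have "- 4 / short_side (V t) + 8 / (long_side (V t) + short_side (V t)) = - 2 * (V t + s) + 8 / s"
      unfolding alg(2) by (simp add: l)
    also have "\<dots> = (- 2 * V t * s - 2 * s\<^sup>2 + 8) / s" using s0 by (simp add: field_simps power2_eq_square)
    also have "\<dots> = (- 4 * V t + - 4 * (V t)\<^sup>2 / s) / 2" unfolding sq using s0 by (simp add: field_simps)
    finally show ?thesis by simp
  qed
  have e2: "(- 4 * (V t)\<^sup>2 / s - - 4 * V t) / 2 = - 4 / long_side (V t) + 8 / (long_side (V t) + short_side (V t))"
  proof -
    have "- 4 / long_side (V t) = - 4 * short_side (V t)" using i(2) by (metis mult.right_neutral times_divide_eq_right)
    then have "- 4 / long_side (V t) + 8 / (long_side (V t) + short_side (V t)) = - 2 * (s - V t) + 8 / s"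
      unfolding alg(2) by (simp add: l)
    also have "\<dots> = (2 * V t * s - 2 * s\<^sup>2 + 8) / s" using s0 by (simp add: field_simps power2_eq_square)
    also have "\<dots> = (- 4 * (V t)\<^sup>2 / s - - 4 * V t) / 2" unfolding sq using s0 by (simp add: field_simps)
    finally show ?thesis by simp
  qed
  show "((\<lambda>t. long_side (V t)) has_real_derivative
      - 4 / short_side (V t) + 8 / (long_side (V t) + short_side (V t))) (at t)"
    using DERIV_cdivide[OF DERIV_add[OF dV ds], of 2] unfolding e1 long_side_def .
  show "((\<lambda>t. short_side (V t)) has_real_derivative
      - 4 / long_side (V t) + 8 / (long_side (V t) + short_side (V t))) (at t)"
    using DERIV_cdivide[OF DERIV_diff[OF ds dV], of 2] unfolding e2 short_side_def .
qed

section \<open>Convergence to the flat flow\<close>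

text \<open>The single constant \<open>40 * \<Lambda> ^ 3\<close> covers the factor 28 of the
  displacement expansion as well as the bound \<open>4 * \<Lambda>\<close> per unit of
  \<open>\<tau>\<close> for the motion of the sides.\<close>

lemma side_estimates:
  assumes a: "1 < a" "a \<le> \<Lambda>" and \<tau>: "0 < \<tau>" "40 * \<Lambda> ^ 4 * \<tau> \<le> 1"
  defines "s \<equiv> side \<tau> a"
  shows "\<bar>shift \<tau> (s k) - 2 * (s k - 1 / s k) / (1 / s k * (s k + 1 / s k)) * \<tau>\<bar> \<le> 40 * \<Lambda> ^ 3 * \<tau>\<^sup>2"
    and "s (Suc k) + 1 / s (Suc k) < s k + 1 / s k"
    and "\<bar>s (Suc k) - s k\<bar> \<le> \<tau> * (40 * \<Lambda> ^ 3)" and "\<bar>1 / s (Suc k) - 1 / s k\<bar> \<le> \<tau> * (40 * \<Lambda> ^ 3)"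
proof -
  have f: "1 < s k" "s k \<le> \<Lambda>" unfolding s_def by (rule side_facts[OF a \<tau>])+
  note S = side_step[OF a \<tau>, of k, folded s_def]
  have x: "0 < shift \<tau> (s k)" by (rule euler_step.x(1)[OF S(1)])
  have y: "0 < lift \<tau> (s k)" by (rule euler_step.y[OF S(1)])
  have yx: "lift \<tau> (s k) < shift \<tau> (s k)" by (rule euler_step.y_less_x[OF S(1) S(4) f(1)])
  have sS: "s (Suc k) = s k - 2 * shift \<tau> (s k)" by (simp add: s_def)
  have "\<bar>shift \<tau> (s k) - 2 * (s k - 1 / s k) / (1 / s k * (s k + 1 / s k)) * \<tau>\<bar> \<le> 28 * s k ^ 3 * \<tau>\<^sup>2"
    by (rule euler_step.displacement_expansion[OF S(1) S(4) S(2) f(1)])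
  also have "\<dots> \<le> 40 * \<Lambda> ^ 3 * \<tau>\<^sup>2" using f by (intro mult_right_mono mult_mono power_mono) auto
  finally show "\<bar>shift \<tau> (s k) - 2 * (s k - 1 / s k) / (1 / s k * (s k + 1 / s k)) * \<tau>\<bar> \<le> 40 * \<Lambda> ^ 3 * \<tau>\<^sup>2" .
  show "s (Suc k) + 1 / s (Suc k) < s k + 1 / s k" unfolding S(3) unfolding sS using yx by linarith
  have "2 * shift \<tau> (s k) \<le> 4 * (\<tau> * s k)" using S(2) by linarith
  also have "\<dots> \<le> 4 * (\<tau> * \<Lambda>)" using f \<tau> by (intro mult_left_mono) auto
  also have "\<dots> \<le> \<tau> * (40 * \<Lambda> ^ 3)"
  proof -
    have "\<Lambda> ^ 1 \<le> \<Lambda> ^ 3" using a by (intro power_increasing) auto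
    then have "4 * \<Lambda> \<le> 40 * \<Lambda> ^ 3" using a by (simp add: order_trans[of "4 * \<Lambda>" "40 * \<Lambda>"])
    then have "\<tau> * (4 * \<Lambda>) \<le> \<tau> * (40 * \<Lambda> ^ 3)" using \<tau> by (intro mult_left_mono) auto
    then show ?thesis by (simp add: ac_simps)
  qed
  finally have d: "2 * shift \<tau> (s k) \<le> \<tau> * (40 * \<Lambda> ^ 3)" .
  show "\<bar>s (Suc k) - s k\<bar> \<le> \<tau> * (40 * \<Lambda> ^ 3)" unfolding sS using x d by simp
  show "\<bar>1 / s (Suc k) - 1 / s k\<bar> \<le> \<tau> * (40 * \<Lambda> ^ 3)" unfolding S(3) using y yx d by simp
qed

lemma side_sum_less:
  assumes a: "1 < a" "a + 1 / a < \<Lambda>" and \<tau>: "0 < \<tau>" "40 * \<Lambda> ^ 4 * \<tau> \<le> 1"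
  shows "side \<tau> a k + 1 / side \<tau> a k < \<Lambda>"
proof (induction k)
  case 0
  show ?case using a(2) by (simp only: side.simps(1))
next
  case (Suc k)
  have "0 < 1 / a" using a(1) by simp
  then have a2: "a \<le> \<Lambda>" using a(2) by linarith
  show ?case by (rule less_trans[OF side_estimates(2)[OF a(1) a2 \<tau>] Suc])
qed

definition limit_long :: "real \<Rightarrow> real \<Rightarrow> real" where
  "limit_long a t = long_side ((a - 1 / a) * exp (- 4 * t))"

definition limit_short :: "real \<Rightarrow> real \<Rightarrow> real" where
  "limit_short a t = short_side ((a - 1 / a) * exp (- 4 * t))"

definition error_rate :: "real \<Rightarrow> real \<Rightarrow> real" where
  "error_rate \<Lambda> t = (40 * \<Lambda> ^ 3 + 16 * \<Lambda>) * t + 4 * \<Lambda>"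

lemma error_rate_pos:
  assumes "1 < \<Lambda>" "0 \<le> t"
  shows "0 < error_rate \<Lambda> t"
  unfolding error_rate_def using assms by (intro add_nonneg_pos mult_nonneg_nonneg add_nonneg_nonneg zero_le_power) auto

lemma error_rate_mono:
  assumes "1 < \<Lambda>" "t \<le> T"
  shows "error_rate \<Lambda> t \<le> error_rate \<Lambda> T"
  unfolding error_rate_def using assms by (intro add_right_mono mult_left_mono add_nonneg_nonneg mult_nonneg_nonneg zero_le_power) auto

lemma sides_le:
  "long_side v \<le> \<bar>v\<bar> + 1" "short_side v \<le> \<bar>v\<bar> + 1"
proof -
  have "v\<^sup>2 + 4 \<le> (\<bar>v\<bar> + 2)\<^sup>2" by (simp add: power2_sum)
  then have s: "sqrt (v\<^sup>2 + 4) \<le> \<bar>v\<bar> + 2" by (intro real_le_lsqrt) auto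
  have v: "v \<le> \<bar>v\<bar>" "- v \<le> \<bar>v\<bar>" by auto
  show "long_side v \<le> \<bar>v\<bar> + 1" using add_mono[OF v(1) s] unfolding long_side_def by (simp add: field_simps)
  show "short_side v \<le> \<bar>v\<bar> + 1" using add_mono[OF s v(2)] unfolding short_side_def by (simp add: field_simps)
qed

lemma limit_le:
  assumes "1 < a" "a \<le> \<Lambda>" "0 \<le> t"
  shows "limit_long a t \<le> \<Lambda> + 1" "limit_short a t \<le> \<Lambda> + 1"
proof -
  have "1 / a \<le> 1" "0 \<le> 1 / a" using assms by simp_all
  then have "0 \<le> a - 1 / a" "a - 1 / a \<le> \<Lambda>" using assms by linarith+
  then have "\<bar>(a - 1 / a) * exp (- 4 * t)\<bar> \<le> \<Lambda> * 1"
    using assms unfolding abs_mult by (intro mult_mono) auto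
  then show "limit_long a t \<le> \<Lambda> + 1" "limit_short a t \<le> \<Lambda> + 1"
    unfolding limit_long_def limit_short_def
    using sides_le[of "(a - 1 / a) * exp (- 4 * t)"] by linarith+
qed

lemma limit_pos: "0 < limit_long a t" "0 < limit_short a t"
  unfolding limit_long_def limit_short_def by (rule sides_algebra)+

text \<open>The bound is uniform in time up to \<open>T\<close> and in the choice of minimizers,
  since every choice differs from the explicit rectangles by null sets. Both existence and
  uniqueness of the flat flow rest on it.\<close>

lemma approx_flow_error:
  assumes a: "1 < a" "a \<le> \<Lambda>" and \<tau>: "40 * \<Lambda> ^ 4 * \<tau> \<le> 1"
    and E: "approx_flat_flow (rect a (1 / a)) \<tau> E" and t: "0 \<le> t" "t \<le> T"
  shows "emeasure lebesgue (symdiff (E t) (rect (limit_long a t) (limit_short a t)))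
      \<le> ennreal ((\<Lambda> + 1) * (2 * error_rate \<Lambda> T) * \<tau>)"
    and "E t \<in> sets lebesgue"
proof -
  have \<tau>0: "0 < \<tau>" using E by (simp add: approx_flat_flow_def)
  define n where "n = nat \<lfloor>t / \<tau>\<rfloor>"
  define Q where "Q = rect (side \<tau> a n) (1 / side \<tau> a n)"
  define R where "R = rect (limit_long a t) (limit_short a t)"
  have ae: "ae_eq (E t) Q" unfolding Q_def n_def by (rule approx_flat_flow_rect[OF a \<tau> E t(1)])
  have QR: "Q \<in> sets lebesgue" "R \<in> sets lebesgue" by (simp_all add: Q_def R_def)
  show Et: "E t \<in> sets lebesgue" by (rule ae_eq_in_lebesgue[OF ae QR(1)])
  have f: "1 < side \<tau> a n" "side \<tau> a n \<le> \<Lambda>" by (rule side_facts[OF a \<tau>0 \<tau>])+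
  have g: "0 \<le> 1 / side \<tau> a n" "1 / side \<tau> a n \<le> \<Lambda> + 1" "side \<tau> a n \<le> \<Lambda> + 1" "0 \<le> side \<tau> a n"
  proof -
    have "1 / side \<tau> a n \<le> 1" using f by simp
    then show "1 / side \<tau> a n \<le> \<Lambda> + 1" using a by linarith
  qed (use f in auto)
  have e: "\<bar>side \<tau> a n - limit_long a t\<bar> \<le> error_rate \<Lambda> t * \<tau>" "\<bar>1 / side \<tau> a n - limit_short a t\<bar> \<le> error_rate \<Lambda> t * \<tau>"
    unfolding limit_long_def limit_short_def error_rate_def n_def by (rule sides_error[OF a \<tau>0 \<tau> t(1)])+
  have \<Lambda>: "1 < \<Lambda>" using a by linarith
  have rate: "error_rate \<Lambda> t * \<tau> \<le> error_rate \<Lambda> T * \<tau>"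
    using error_rate_mono[OF \<Lambda> t(2)] \<tau>0 by (intro mult_right_mono) auto
  have "emeasure lebesgue (symdiff (E t) R) \<le> emeasure lebesgue (symdiff (E t) Q) + emeasure lebesgue (symdiff Q R)"
    by (rule emeasure_symdiff_triangle[OF Et QR])
  also have "emeasure lebesgue (symdiff (E t) Q) = 0" using ae unfolding ae_eq_def by (rule null_setsD1)
  also have "0 + emeasure lebesgue (symdiff Q R) = emeasure lebesgue (symdiff Q R)" by (rule add_0_left)
  also have "\<dots> \<le> ennreal ((\<Lambda> + 1) * (\<bar>side \<tau> a n - limit_long a t\<bar> + \<bar>1 / side \<tau> a n - limit_short a t\<bar>))"
    unfolding Q_def R_def
    by (rule emeasure_symdiff_rect[OF g(4,1) less_imp_le[OF limit_pos(1)] less_imp_le[OF limit_pos(2)] g(3) limit_le(1)[OF a t(1)] g(2) limit_le(2)[OF a t(1)]])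
  also have "\<dots> \<le> ennreal ((\<Lambda> + 1) * (2 * (error_rate \<Lambda> T * \<tau>)))"
  proof (intro ennreal_leI mult_left_mono)
    show "\<bar>side \<tau> a n - limit_long a t\<bar> + \<bar>1 / side \<tau> a n - limit_short a t\<bar> \<le> 2 * (error_rate \<Lambda> T * \<tau>)"
      using e rate by linarith
  qed (use \<Lambda> in auto)
  also have "(\<Lambda> + 1) * (2 * (error_rate \<Lambda> T * \<tau>)) = (\<Lambda> + 1) * (2 * error_rate \<Lambda> T) * \<tau>" by simp
  finally show "emeasure lebesgue (symdiff (E t) (rect (limit_long a t) (limit_short a t)))
      \<le> ennreal ((\<Lambda> + 1) * (2 * error_rate \<Lambda> T) * \<tau>)" unfolding R_def .
qed

lemma linear_small:
  fixes c \<epsilon> \<tau>0 :: real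
  assumes "0 < c" "0 < \<epsilon>" "0 < \<tau>0"
  shows "0 < min \<tau>0 (\<epsilon> / c)" and "\<tau> < min \<tau>0 (\<epsilon> / c) \<Longrightarrow> c * \<tau> < \<epsilon> \<and> \<tau> < \<tau>0"
  using assms by (simp_all add: pos_less_divide_eq mult.commute)

lemma limit_flat_flow:
  assumes a: "1 < a" "a \<le> \<Lambda>"
  shows "flat_flow (rect a (1 / a)) (\<lambda>t. rect (limit_long a t) (limit_short a t))"
proof -
  have \<Lambda>: "1 < \<Lambda>" using a by linarith
  define c where "c = 40 * \<Lambda> ^ 4"
  have c: "0 < c" using \<Lambda> by (simp add: c_def)
  \<comment> \<open>The scaling by \<open>1 / c\<close> makes every step size admissible, including
    the one with index 0.\<close>
  define \<tau>s where "\<tau>s k = (1 / c) * inverse (real (Suc k))" for k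
  define Es where "Es k t = rect (side (\<tau>s k) a (nat \<lfloor>t / \<tau>s k\<rfloor>)) (1 / side (\<tau>s k) a (nat \<lfloor>t / \<tau>s k\<rfloor>))" for k t
  have pos: "0 < \<tau>s k" for k using c by (simp add: \<tau>s_def)
  have lim: "\<tau>s \<longlonglongrightarrow> 0"
    using tendsto_mult_right_zero[OF LIMSEQ_inverse_real_of_nat, of "1 / c"] by (simp add: \<tau>s_def[abs_def])
  have small: "40 * \<Lambda> ^ 4 * \<tau>s k \<le> 1" for k
  proof -
    have "c * \<tau>s k = inverse (real (Suc k))" using c by (simp add: \<tau>s_def)
    also have "\<dots> \<le> 1" by (simp add: inverse_le_1_iff)
    finally show ?thesis by (simp add: c_def)
  qed
  have flow: "approx_flat_flow (rect a (1 / a)) (\<tau>s k) (Es k)" for k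
    unfolding Es_def by (rule approx_flat_flow_exists[OF a pos small])
  have conv: "\<forall>\<^sub>F k in sequentially. \<forall>t\<in>{0..T}. emeasure lebesgue (symdiff (Es k t) (rect (limit_long a t) (limit_short a t))) < ennreal \<epsilon>"
    if T: "0 \<le> T" and \<epsilon>: "0 < \<epsilon>" for T \<epsilon>
  proof -
    have "(\<lambda>k. (\<Lambda> + 1) * (2 * error_rate \<Lambda> T) * \<tau>s k) \<longlonglongrightarrow> 0" by (rule tendsto_mult_right_zero[OF lim])
    then have "\<forall>\<^sub>F k in sequentially. (\<Lambda> + 1) * (2 * error_rate \<Lambda> T) * \<tau>s k < \<epsilon>" by (rule order_tendstoD) (rule \<epsilon>)
    then show ?thesis
    proof eventually_elim
      fix k assume k: "(\<Lambda> + 1) * (2 * error_rate \<Lambda> T) * \<tau>s k < \<epsilon>"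
      show "\<forall>t\<in>{0..T}. emeasure lebesgue (symdiff (Es k t) (rect (limit_long a t) (limit_short a t))) < ennreal \<epsilon>"
      proof
        fix t assume "t \<in> {0..T}"
        then have t: "0 \<le> t" "t \<le> T" by auto
        have "emeasure lebesgue (symdiff (Es k t) (rect (limit_long a t) (limit_short a t))) \<le> ennreal ((\<Lambda> + 1) * (2 * error_rate \<Lambda> T) * \<tau>s k)"
          by (rule approx_flow_error(1)[OF a small flow t])
        also have "\<dots> < ennreal \<epsilon>" using k \<epsilon> by (intro ennreal_lessI)
        finally show "emeasure lebesgue (symdiff (Es k t) (rect (limit_long a t) (limit_short a t))) < ennreal \<epsilon>" .
      qed
    qed
  qed
  have reg: "rect (limit_long a t) (limit_short a t) \<in> sets lebesgue \<and> emeasure lebesgue (rect (limit_long a t) (limit_short a t)) < \<infinity>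
      \<and> perimeter1 (rect (limit_long a t) (limit_short a t)) < \<infinity>" for t
  proof (intro conjI)
    show "emeasure lebesgue (rect (limit_long a t) (limit_short a t)) < \<infinity>"
      using emeasure_rect[of "limit_long a t" "limit_short a t"] limit_pos[where a = a and t = t] by simp
    show "perimeter1 (rect (limit_long a t) (limit_short a t)) < \<infinity>"
      unfolding infinity_ennreal_def
      by (rule le_less_trans[OF perimeter1_rect_le[OF less_imp_le[OF limit_pos(1)] less_imp_le[OF limit_pos(2)]] ennreal_less_top])
  qed simp
  show ?thesis
    unfolding flat_flow_def
  proof (intro conjI exI[of _ \<tau>s] exI[of _ Es])
    show "\<forall>k. 0 < \<tau>s k" using pos by simp
    show "\<tau>s \<longlonglongrightarrow> 0" by (rule lim)
    show "\<forall>k. approx_flat_flow (rect a (1 / a)) (\<tau>s k) (Es k)" using flow by simp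
    show "\<forall>T\<ge>0. \<forall>\<epsilon>>0. \<forall>\<^sub>F k in sequentially. \<forall>t\<in>{0..T}.
        emeasure lebesgue (symdiff (Es k t) (rect (limit_long a t) (limit_short a t))) < ennreal \<epsilon>"
      using conv by simp
    show "\<forall>t\<ge>0. rect (limit_long a t) (limit_short a t) \<in> sets lebesgue \<and> emeasure lebesgue (rect (limit_long a t) (limit_short a t)) < \<infinity>
      \<and> perimeter1 (rect (limit_long a t) (limit_short a t)) < \<infinity>" using reg by blast
  qed
qed

text \<open>Another flat flow comes with its own sequence of step sizes, but its approximations are
  close to the same explicit rectangles. The triangle inequality through one of them makes the
  symmetric difference smaller than any positive number.\<close>

lemma flat_flow_unique:
  assumes a: "1 < a" "a \<le> \<Lambda>" and R: "flat_flow (rect a (1 / a)) R" and t: "0 \<le> t"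
  shows "ae_eq (R t) (rect (limit_long a t) (limit_short a t))"
proof -
  have \<Lambda>: "1 < \<Lambda>" using a by linarith
  obtain \<tau>s Es where F: "\<And>k. 0 < \<tau>s k" "\<tau>s \<longlonglongrightarrow> 0" "\<And>k. approx_flat_flow (rect a (1 / a)) (\<tau>s k) (Es k)"
    "\<And>T \<epsilon>. 0 \<le> T \<Longrightarrow> 0 < \<epsilon> \<Longrightarrow> \<forall>\<^sub>F k in sequentially. \<forall>t\<in>{0..T}. emeasure lebesgue (symdiff (Es k t) (R t)) < ennreal \<epsilon>"
    using R unfolding flat_flow_def by blast
  have Rt: "R t \<in> sets lebesgue" using R t unfolding flat_flow_def by blast
  define Q where "Q = rect (limit_long a t) (limit_short a t)"
  have Q: "Q \<in> sets lebesgue" by (simp add: Q_def)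
  have bound: "emeasure lebesgue (symdiff (R t) Q) \<le> 0 + ennreal \<epsilon>" if \<epsilon>: "0 < \<epsilon>" for \<epsilon>
  proof -
    have \<epsilon>2: "0 < \<epsilon> / 2" using \<epsilon> by simp
    \<comment> \<open>A given vanishing sequence satisfies the smallness condition only eventually,
      so one sufficiently large index is extracted for each tolerance.\<close>
    have l: "(\<lambda>k. 40 * \<Lambda> ^ 4 * \<tau>s k) \<longlonglongrightarrow> 0" "(\<lambda>k. (\<Lambda> + 1) * (2 * error_rate \<Lambda> t) * \<tau>s k) \<longlonglongrightarrow> 0"
      by (rule tendsto_mult_right_zero[OF F(2)])+
    have "\<forall>\<^sub>F k in sequentially. 40 * \<Lambda> ^ 4 * \<tau>s k < 1"
      "\<forall>\<^sub>F k in sequentially. (\<Lambda> + 1) * (2 * error_rate \<Lambda> t) * \<tau>s k < \<epsilon> / 2"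
      by (rule order_tendstoD(2)[OF l(1) zero_less_one], rule order_tendstoD(2)[OF l(2) \<epsilon>2])
    with F(4)[OF t \<epsilon>2] have "\<forall>\<^sub>F k in sequentially. 40 * \<Lambda> ^ 4 * \<tau>s k < 1 \<and> (\<Lambda> + 1) * (2 * error_rate \<Lambda> t) * \<tau>s k < \<epsilon> / 2
        \<and> emeasure lebesgue (symdiff (Es k t) (R t)) < ennreal (\<epsilon> / 2)"
      by eventually_elim (use t in auto)
    then obtain k where k: "40 * \<Lambda> ^ 4 * \<tau>s k \<le> 1" "(\<Lambda> + 1) * (2 * error_rate \<Lambda> t) * \<tau>s k \<le> \<epsilon> / 2"
        "emeasure lebesgue (symdiff (R t) (Es k t)) \<le> ennreal (\<epsilon> / 2)"
      unfolding eventually_sequentially symdiff_commute[of "R t"] by (meson less_imp_le order_refl)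
    note err = approx_flow_error[OF a k(1) F(3) t order_refl, folded Q_def]
    have "emeasure lebesgue (symdiff (R t) Q) \<le> emeasure lebesgue (symdiff (R t) (Es k t)) + emeasure lebesgue (symdiff (Es k t) Q)"
      by (rule emeasure_symdiff_triangle[OF Rt err(2) Q])
    also have "\<dots> \<le> ennreal (\<epsilon> / 2) + ennreal (\<epsilon> / 2)"
      by (intro add_mono k(3) order_trans[OF err(1)] ennreal_leI k(2))
    also have "\<dots> = ennreal \<epsilon>" using \<epsilon> by (simp flip: ennreal_plus)
    finally show ?thesis by simp
  qed
  have "emeasure lebesgue (symdiff (R t) Q) \<le> 0" by (rule ennreal_le_epsilon) (rule bound)
  moreover have "symdiff (R t) Q \<in> sets lebesgue" using Rt Q unfolding symdiff_def by blast
  ultimately show ?thesis unfolding ae_eq_def Q_def[symmetric] by (intro null_setsI) auto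
qed

theorem theorem2p10:
  fixes \<Lambda> :: real
  assumes "\<Lambda> > 0"
  shows "\<exists>\<tau>0>0. \<exists>C>0. \<forall>a0 b0. 0 < b0 \<and> a0 * b0 = 1 \<and> b0 < a0 \<and> a0 + b0 < \<Lambda> \<longrightarrow>
    (\<forall>\<tau> E. 0 < \<tau> \<and> \<tau> < \<tau>0 \<and> approx_flat_flow (rect a0 b0) \<tau> E \<longrightarrow>
       (\<exists>a b x y :: nat \<Rightarrow> real. a 0 = a0 \<and> b 0 = b0 \<and>
          (\<forall>k. a (Suc k) = a k - 2 * x k \<and> b (Suc k) = b k + 2 * y k \<and>
               y k = b k * x k / (a k - 2 * x k) \<and>
               \<bar>x k - 2 * (a k - b k) / (b k * (a k + b k)) * \<tau>\<bar> \<le> C * \<tau>\<^sup>2) \<and>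
          (\<forall>k\<ge>1. a (Suc k) * b (Suc k) = 1 \<and>
               a (Suc k) + b (Suc k) < a k + b k \<and> a k + b k < \<Lambda> \<and>
               \<bar>a (Suc k) - a k\<bar> \<le> \<tau> * C \<and> \<bar>b (Suc k) - b k\<bar> \<le> \<tau> * C \<and>
               (\<forall>t. real (k + 1) * \<tau> \<le> t \<and> t < real (k + 2) * \<tau> \<longrightarrow>
                    ae_eq (E t) (rect (a (Suc k)) (b (Suc k)))))))
    \<and> (\<exists>Rt. flat_flow (rect a0 b0) Rt \<and>
         (\<forall>R'. flat_flow (rect a0 b0) R' \<longrightarrow> (\<forall>t\<ge>0. ae_eq (R' t) (Rt t))) \<and>
         (\<exists>atil btil :: real \<Rightarrow> real. atil 0 = a0 \<and> btil 0 = b0 \<and>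
            (\<forall>t\<ge>0. ae_eq (Rt t) (rect (atil t) (btil t))) \<and>
            (\<forall>t\<ge>0. (atil has_real_derivative (- 4 / btil t + 8 / (atil t + btil t))) (at t within {0..}) \<and>
                    (btil has_real_derivative (- 4 / atil t + 8 / (atil t + btil t))) (at t within {0..})) \<and>
            (\<forall>t\<ge>0. \<forall>\<epsilon>>0. \<exists>\<delta>>0. \<forall>\<tau> E. 0 < \<tau> \<and> \<tau> < \<delta> \<and> approx_flat_flow (rect a0 b0) \<tau> E \<longrightarrow>
                 measure lebesgue (symdiff (E t) (Rt t)) < \<epsilon>) \<and>
            (\<forall>t>0. \<forall>\<epsilon>>0. \<exists>\<delta>>0. \<forall>\<tau> E. 0 < \<tau> \<and> \<tau> < \<delta> \<and> approx_flat_flow (rect a0 b0) \<tau> E \<longrightarrow>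
                 (\<forall>a' b'. 0 < a' \<and> 0 < b' \<and> ae_eq (E t) (rect a' b') \<longrightarrow>
                    \<bar>a' - atil t\<bar> < \<epsilon> \<and> \<bar>b' - btil t\<bar> < \<epsilon>))))"
proof -
  \<comment> \<open>Every admissible long side is below \<open>\<Lambda>\<close>, so this threshold
    enforces the smallness condition at all steps.\<close>
  define \<tau>0 where "\<tau>0 = 1 / (40 * \<Lambda> ^ 4)"
  define C where "C = 40 * \<Lambda> ^ 3"
  have \<tau>0: "0 < \<tau>0" and C: "0 < C" using assms by (simp_all add: \<tau>0_def C_def)
  have \<tau>0_small: "40 * \<Lambda> ^ 4 * \<tau> \<le> 1" if "\<tau> < \<tau>0" for \<tau>
    using that assms by (simp add: \<tau>0_def pos_less_divide_eq mult.commute less_imp_le)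
  show ?thesis
  proof (rule exI[of _ \<tau>0], rule conjI[OF \<tau>0], rule exI[of _ C], rule conjI[OF C], intro allI impI, elim conjE, rule conjI)
    fix a0 b0
    assume b0: "0 < b0" "a0 * b0 = 1" "b0 < a0" "a0 + b0 < \<Lambda>"
    have a0: "1 < a0"
    proof (rule ccontr)
      assume "\<not> 1 < a0"
      then have "a0 * b0 \<le> 1 * b0" using b0 by (intro mult_right_mono) auto
      then show False using b0 \<open>\<not> 1 < a0\<close> by linarith
    qed
    have b0_eq: "b0 = 1 / a0" using b0(2) a0 by (simp add: field_simps)
    have a0\<Lambda>: "a0 \<le> \<Lambda>" using b0 by linarith
    have \<Lambda>: "1 < \<Lambda>" using a0 a0\<Lambda> by linarith
    have sum: "a0 + 1 / a0 < \<Lambda>" using b0(4) unfolding b0_eq .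
    show "\<forall>\<tau> E. 0 < \<tau> \<and> \<tau> < \<tau>0 \<and> approx_flat_flow (rect a0 b0) \<tau> E \<longrightarrow>
       (\<exists>a b x y :: nat \<Rightarrow> real. a 0 = a0 \<and> b 0 = b0 \<and>
          (\<forall>k. a (Suc k) = a k - 2 * x k \<and> b (Suc k) = b k + 2 * y k \<and>
               y k = b k * x k / (a k - 2 * x k) \<and>
               \<bar>x k - 2 * (a k - b k) / (b k * (a k + b k)) * \<tau>\<bar> \<le> C * \<tau>\<^sup>2) \<and>
          (\<forall>k\<ge>1. a (Suc k) * b (Suc k) = 1 \<and>
               a (Suc k) + b (Suc k) < a k + b k \<and> a k + b k < \<Lambda> \<and>
               \<bar>a (Suc k) - a k\<bar> \<le> \<tau> * C \<and> \<bar>b (Suc k) - b k\<bar> \<le> \<tau> * C \<and>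
               (\<forall>t. real (k + 1) * \<tau> \<le> t \<and> t < real (k + 2) * \<tau> \<longrightarrow>
                    ae_eq (E t) (rect (a (Suc k)) (b (Suc k))))))"
    proof (intro allI impI, elim conjE)
      fix \<tau> E
      assume \<tau>: "0 < \<tau>" "\<tau> < \<tau>0" and E: "approx_flat_flow (rect a0 b0) \<tau> E"
      note small = \<tau>0_small[OF \<tau>(2)]
      define s where "s = side \<tau> a0"
      note est = side_estimates[OF a0 a0\<Lambda> \<tau>(1) small, folded s_def C_def]
        and step = side_step[OF a0 a0\<Lambda> \<tau>(1) small, folded s_def]
      have sS: "s (Suc k) = s k - 2 * shift \<tau> (s k)" for k by (simp add: s_def)
      have flow: "ae_eq (E t) (rect (s (Suc k)) (1 / s (Suc k)))"
        if t: "real (k + 1) * \<tau> \<le> t" "t < real (k + 2) * \<tau>" for k t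
      proof -
        have "0 \<le> real (k + 1) * \<tau>" using \<tau> by simp
        then have t0: "0 \<le> t" using t(1) by linarith
        have "real (k + 1) \<le> t / \<tau>" using t(1) \<tau>(1) by (simp only: pos_le_divide_eq)
        moreover have "t / \<tau> < real (k + 2)" using t(2) \<tau>(1) by (simp only: pos_divide_less_eq)
        \<comment> \<open>On this interval the floor is \<open>k + 1\<close>, so \<open>E t\<close>
          is the set reached after \<open>Suc k\<close> minimizations.\<close>
        ultimately have "\<lfloor>t / \<tau>\<rfloor> = int (k + 1)" by (intro floor_unique) simp_all
        then have n: "nat \<lfloor>t / \<tau>\<rfloor> = Suc k" by simp
        show ?thesis
          using approx_flat_flow_rect[OF a0 a0\<Lambda> small E[unfolded b0_eq] t0] unfolding n s_def .
      qed
      show "\<exists>a b x y :: nat \<Rightarrow> real. a 0 = a0 \<and> b 0 = b0 \<and>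
          (\<forall>k. a (Suc k) = a k - 2 * x k \<and> b (Suc k) = b k + 2 * y k \<and>
               y k = b k * x k / (a k - 2 * x k) \<and>
               \<bar>x k - 2 * (a k - b k) / (b k * (a k + b k)) * \<tau>\<bar> \<le> C * \<tau>\<^sup>2) \<and>
          (\<forall>k\<ge>1. a (Suc k) * b (Suc k) = 1 \<and>
               a (Suc k) + b (Suc k) < a k + b k \<and> a k + b k < \<Lambda> \<and>
               \<bar>a (Suc k) - a k\<bar> \<le> \<tau> * C \<and> \<bar>b (Suc k) - b k\<bar> \<le> \<tau> * C \<and>
               (\<forall>t. real (k + 1) * \<tau> \<le> t \<and> t < real (k + 2) * \<tau> \<longrightarrow>
                    ae_eq (E t) (rect (a (Suc k)) (b (Suc k)))))"
      proof (rule exI[of _ s], rule exI[of _ "\<lambda>k. 1 / s k"], rule exI[of _ "\<lambda>k. shift \<tau> (s k)"],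
          rule exI[of _ "\<lambda>k. lift \<tau> (s k)"], intro conjI allI impI)
        show "s 0 = a0" "1 / s 0 = b0" by (simp_all add: s_def b0_eq)
        fix k
        show "s (Suc k) = s k - 2 * shift \<tau> (s k)" by (rule sS)
        show "1 / s (Suc k) = 1 / s k + 2 * lift \<tau> (s k)" by (rule step(3))
        show "lift \<tau> (s k) = 1 / s k * shift \<tau> (s k) / (s k - 2 * shift \<tau> (s k))"
          unfolding sS[symmetric] by (rule step(4))
        show "\<bar>shift \<tau> (s k) - 2 * (s k - 1 / s k) / (1 / s k * (s k + 1 / s k)) * \<tau>\<bar> \<le> C * \<tau>\<^sup>2" by (rule est(1))
        show "s (Suc k) * (1 / s (Suc k)) = 1" by (rule euler_step.AB[OF step(1)])
        show "s (Suc k) + 1 / s (Suc k) < s k + 1 / s k" by (rule est(2))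
        show "s k + 1 / s k < \<Lambda>" unfolding s_def by (rule side_sum_less[OF a0 sum \<tau>(1) small])
        show "\<bar>s (Suc k) - s k\<bar> \<le> \<tau> * C" "\<bar>1 / s (Suc k) - 1 / s k\<bar> \<le> \<tau> * C" by (rule est(3), rule est(4))
        fix t assume "real (k + 1) * \<tau> \<le> t \<and> t < real (k + 2) * \<tau>"
        then show "ae_eq (E t) (rect (s (Suc k)) (1 / s (Suc k)))" using flow by blast
      qed
    qed
    define Rt where "Rt t = rect (limit_long a0 t) (limit_short a0 t)" for t
    define K where "K t = (\<Lambda> + 1) * (2 * error_rate \<Lambda> t)" for t
    have K: "0 < K t" if "0 \<le> t" for t
      unfolding K_def using error_rate_pos[OF \<Lambda> that] \<Lambda> by (intro mult_pos_pos) auto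
    have init: "limit_long a0 0 = a0" "limit_short a0 0 = b0"
      using long_side_diff[of a0] a0 by (simp_all add: limit_long_def limit_short_def b0_eq)
    have der: "(limit_long a0 has_real_derivative (- 4 / limit_short a0 t + 8 / (limit_long a0 t + limit_short a0 t))) (at t within {0..})"
      "(limit_short a0 has_real_derivative (- 4 / limit_long a0 t + 8 / (limit_long a0 t + limit_short a0 t))) (at t within {0..})" for t
      unfolding limit_long_def[abs_def] limit_short_def[abs_def]
      by (rule has_field_derivative_at_within[OF sides_ode(1)], rule has_field_derivative_at_within[OF sides_ode(2)])
    have meas: "\<exists>\<delta>>0. \<forall>\<tau> E. 0 < \<tau> \<and> \<tau> < \<delta> \<and> approx_flat_flow (rect a0 b0) \<tau> E \<longrightarrow> measure lebesgue (symdiff (E t) (Rt t)) < \<epsilon>"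
      if t: "0 \<le> t" and \<epsilon>: "0 < \<epsilon>" for t \<epsilon>
    \<comment> \<open>Below \<open>\<tau>0\<close> the approximate flow is explicit; below
      \<open>\<epsilon> / K t\<close> the linear error bound is less than
      \<open>\<epsilon>\<close>.\<close>
    proof (rule exI[of _ "min \<tau>0 (\<epsilon> / K t)"], rule conjI[OF linear_small(1)[OF K[OF t] \<epsilon> \<tau>0]], intro allI impI, elim conjE)
      fix \<tau> E
      assume \<tau>: "0 < \<tau>" "\<tau> < min \<tau>0 (\<epsilon> / K t)" and E: "approx_flat_flow (rect a0 b0) \<tau> E"
      have s: "K t * \<tau> < \<epsilon>" "\<tau> < \<tau>0" using linear_small(2)[OF K[OF t] \<epsilon> \<tau>0 \<tau>(2)] by auto
      have "emeasure lebesgue (symdiff (E t) (Rt t)) \<le> ennreal (K t * \<tau>)"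
        unfolding Rt_def K_def by (rule approx_flow_error(1)[OF a0 a0\<Lambda> \<tau>0_small[OF s(2)] E[unfolded b0_eq] t order_refl])
      then have "measure lebesgue (symdiff (E t) (Rt t)) \<le> K t * \<tau>"
        unfolding measure_def using K[OF t] \<tau>(1) by (intro enn2real_leI) auto
      then show "measure lebesgue (symdiff (E t) (Rt t)) < \<epsilon>" using s(1) by linarith
    qed
    have conv: "\<exists>\<delta>>0. \<forall>\<tau> E. 0 < \<tau> \<and> \<tau> < \<delta> \<and> approx_flat_flow (rect a0 b0) \<tau> E \<longrightarrow>
        (\<forall>a' b'. 0 < a' \<and> 0 < b' \<and> ae_eq (E t) (rect a' b') \<longrightarrow> \<bar>a' - limit_long a0 t\<bar> < \<epsilon> \<and> \<bar>b' - limit_short a0 t\<bar> < \<epsilon>)"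
      if t: "0 < t" and \<epsilon>: "0 < \<epsilon>" for t \<epsilon>
    proof -
      have t0: "0 \<le> t" using t by simp
      have D: "0 < error_rate \<Lambda> t" by (rule error_rate_pos[OF \<Lambda> t0])
      show ?thesis
      proof (rule exI[of _ "min \<tau>0 (\<epsilon> / error_rate \<Lambda> t)"], rule conjI[OF linear_small(1)[OF D \<epsilon> \<tau>0]], intro allI impI, elim conjE)
        fix \<tau> E a' b'
        assume \<tau>: "0 < \<tau>" "\<tau> < min \<tau>0 (\<epsilon> / error_rate \<Lambda> t)" and E: "approx_flat_flow (rect a0 b0) \<tau> E"
          and ab: "0 < a'" "0 < b'" "ae_eq (E t) (rect a' b')"
        have s: "error_rate \<Lambda> t * \<tau> < \<epsilon>" "\<tau> < \<tau>0" using linear_small(2)[OF D \<epsilon> \<tau>0 \<tau>(2)] by auto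
        note small = \<tau>0_small[OF s(2)]
        define r where "r = side \<tau> a0 (nat \<lfloor>t / \<tau>\<rfloor>)"
        have "ae_eq (E t) (rect r (1 / r))"
          unfolding r_def by (rule approx_flat_flow_rect[OF a0 a0\<Lambda> small E[unfolded b0_eq] t0])
        \<comment> \<open>The sides \<open>a'\<close> and \<open>b'\<close> are given only through
          an equality up to null sets; they must be the computed ones because a rectangle is
          determined by its class.\<close>
        then have "ae_eq (rect r (1 / r)) (rect a' b')" using ae_eq_trans[OF ae_eq_sym ab(3)] by blast
        moreover have "0 < r" using side_facts(1)[OF a0 a0\<Lambda> \<tau>(1) small, of "nat \<lfloor>t / \<tau>\<rfloor>"] unfolding r_def by linarith
        ultimately have r: "r = a'" "1 / r = b'" using ae_eq_rect_unique[of r "1 / r" a' b'] ab by auto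
        show "\<bar>a' - limit_long a0 t\<bar> < \<epsilon> \<and> \<bar>b' - limit_short a0 t\<bar> < \<epsilon>"
          unfolding r[symmetric] unfolding r_def limit_long_def limit_short_def
          using sides_error[OF a0 a0\<Lambda> \<tau>(1) small t0, folded error_rate_def] s(1) by (intro conjI) linarith+
      qed
    qed
    have flow: "flat_flow (rect a0 b0) Rt"
      unfolding Rt_def[abs_def] b0_eq by (rule limit_flat_flow[OF a0 a0\<Lambda>])
    have unique: "\<forall>R'. flat_flow (rect a0 b0) R' \<longrightarrow> (\<forall>t\<ge>0. ae_eq (R' t) (Rt t))"
      unfolding Rt_def b0_eq using flat_flow_unique[OF a0 a0\<Lambda>] by blast
    show "\<exists>Rt. flat_flow (rect a0 b0) Rt \<and>
         (\<forall>R'. flat_flow (rect a0 b0) R' \<longrightarrow> (\<forall>t\<ge>0. ae_eq (R' t) (Rt t))) \<and>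
         (\<exists>atil btil :: real \<Rightarrow> real. atil 0 = a0 \<and> btil 0 = b0 \<and>
            (\<forall>t\<ge>0. ae_eq (Rt t) (rect (atil t) (btil t))) \<and>
            (\<forall>t\<ge>0. (atil has_real_derivative (- 4 / btil t + 8 / (atil t + btil t))) (at t within {0..}) \<and>
                    (btil has_real_derivative (- 4 / atil t + 8 / (atil t + btil t))) (at t within {0..})) \<and>
            (\<forall>t\<ge>0. \<forall>\<epsilon>>0. \<exists>\<delta>>0. \<forall>\<tau> E. 0 < \<tau> \<and> \<tau> < \<delta> \<and> approx_flat_flow (rect a0 b0) \<tau> E \<longrightarrow>
                 measure lebesgue (symdiff (E t) (Rt t)) < \<epsilon>) \<and>
            (\<forall>t>0. \<forall>\<epsilon>>0. \<exists>\<delta>>0. \<forall>\<tau> E. 0 < \<tau> \<and> \<tau> < \<delta> \<and> approx_flat_flow (rect a0 b0) \<tau> E \<longrightarrow>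
                 (\<forall>a' b'. 0 < a' \<and> 0 < b' \<and> ae_eq (E t) (rect a' b') \<longrightarrow>
                    \<bar>a' - atil t\<bar> < \<epsilon> \<and> \<bar>b' - btil t\<bar> < \<epsilon>)))"
    proof (rule exI[of _ Rt], rule conjI[OF flow], rule conjI[OF unique], rule exI[of _ "limit_long a0"],
        rule exI[of _ "limit_short a0"], intro conjI)
      show "limit_long a0 0 = a0" "limit_short a0 0 = b0" by (rule init)+
      show "\<forall>t\<ge>0. ae_eq (Rt t) (rect (limit_long a0 t) (limit_short a0 t))" unfolding Rt_def using ae_eq_refl by blast
    qed (use der meas conv in blast)+
  qed
qed

end
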